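(* Consider S-shaped routing, i.e. the total picking time $$T=\sum_{i=1}^{M}P_i+\frac lv\Big(\sum_{i=1}^kI_i+I_{\mathrm{odd}}(2A_{k^+}-1)\Big)+\frac2vw_a(k^+-1),$$ and write $J=\sum_{i=1}^kI_i$. Then $$\mathbb{E}[T]=\mathbb{E}[M]\mathbb{E}[P]+\frac lv\mathbb{E}[J]+\frac{2l}v\mathbb{E}[I_{\mathrm{odd}}A_{k^+}]-\frac lv\mathbb{E}[I_{\mathrm{odd}}]+\frac{2w_a}v\big(\mathbb{E}[k^+]-1\big)$$ and $$\begin{aligned}\mathbb{E}[T^2]&=\mathbb{E}[M(M-1)]\mathbb{E}[P]^2+\mathbb{E}[M]\mathbb{E}[P^2]+\frac{l^2}{v^2}\mathbb{E}[J^2]+\frac{4l^2}{v^2}\mathbb{E}[I_{\mathrm{odd}}A_{k^+}^2]+\frac{l^2}{v^2}\mathbb{E}[I_{\mathrm{odd}}]\\ &\quad+\frac{4w_a^2}{v^2}\big(\mathbb{E}[(k^+)^2]-2\mathbb{E}[k^+]+1\big)+\frac{2l}v\mathbb{E}[P]\mathbb{E}[MJ]+\frac{4l}v\mathbb{E}[P]\mathbb{E}[MI_{\mathrm{odd}}A_{k^+}]-\frac{2l}v\mathbb{E}[P]\mathbb{E}[MI_{\mathrm{odd}}]\\ &\quad+\frac{4w_a}v\mathbb{E}[P]\big(\mathbb{E}[Mk^+]-\mathbb{E}[M]\big)+\frac{4l^2}{v^2}\mathbb{E}[I_{\mathrm{odd}}A_{k^+}J]-\frac{2l^2}{v^2}\mathbb{E}[I_{\mathrm{odd}}J]+\frac{4lw_a}{v^2}\big(\mathbb{E}[k^+J]-\mathbb{E}[J]\big)\\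 &\quad-\frac{4l^2}{v^2}\mathbb{E}[I_{\mathrm{odd}}A_{k^+}]+\frac{8lw_a}{v^2}\big(\mathbb{E}[I_{\mathrm{odd}}A_{k^+}k^+]-\mathbb{E}[I_{\mathrm{odd}}A_{k^+}]\big)-\frac{4lw_a}{v^2}\big(\mathbb{E}[I_{\mathrm{odd}}k^+]-\mathbb{E}[I_{\mathrm{odd}}]\big).\end{aligned}$$ Here, writing $p_r=P_M(r/k)$ and $F_r=\int_0^1P_M\big(\frac{z+r}k\big)dz-P_M\big(\frac{r+1}k\big)$: $$\mathbb{E}[k^+]=k-\sum_{r=0}^{k-1}p_r,\quad \mathbb{E}[(k^+)^2]=k^2-\sum_{r=0}^{k-1}(2r+1)p_r,\quad \mathbb{E}[Mk^+]=k\mathbb{E}[M]-\sum_{r=0}^{k-1}\frac rkP_M'\Big(\frac rk\Big),$$ $$\mathbb{E}[J]=k-kP_M\Big(1-\frac1k\Big),\quad \mathbb{E}[J^2]=k^2+k(1-2k)P_M\Big(1-\frac1k\Big)+k(k-1)P_M\Big(1-\frac2k\Big),$$ $$\mathbb{E}[I_{\mathrm{odd}}]=\sum_{r=0}^{k-1}\binom kr(-1)^{r+1}2^{k-r-1}p_r+\mathbf 1\{k\text{ odd}\},$$ $$\mathbb{E}[MJ]=k\mathbb{E}[M]-(k-1)P_M'\Big(\frac{k-1}k\Big),\quad \mathbb{E}[k^+J]=k^2-k(k+1)p_{k-1}+\sum_{j=1}^kp_{j-1},$$ $$\mathbb{E}[I_{\mathrm{odd}}J]=\big[k-k^2p_{k-1}\big]\mathbf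 1\{k\text{ odd}\}+k(k-1)p_{k-1}\mathbf 1\{k\text{ even}\}+\sum_{r=0}^{k-2}\binom krp_r(-1)^{r+1}(k+r)2^{k-r-2},$$ $$\mathbb{E}[I_{\mathrm{odd}}k^+]=\sum_{s=1}^k\sum_{m=0}^{s-2}\binom smp_m(-1)^{m+1}(m+s)2^{s-m-2}+\sum_{\substack{1\le s\le k\\ s\text{ even}}}s(s-1)p_{s-1}+\sum_{\substack{1\le s\le k\\ s\text{ odd}}}\big[sp_s-s^2p_{s-1}\big],$$ $$\mathbb{E}[MI_{\mathrm{odd}}]=\sum_{r=0}^{k-2}\binom{k-1}r(-1)^r2^{k-2-r}P_M'\Big(\frac{1+r}k\Big)+\mathbb{E}[M]\mathbf 1\{k\text{ odd}\},$$ $$\mathbb{E}[I_{\mathrm{odd}}A_{k^+}]=\sum_{\substack{1\le j\le k\\ j\text{ odd}}}\binom kj\sum_{r=0}^{j-1}\binom{j-1}r(-1)^{j-r}F_r,$$ $$\mathbb{E}[I_{\mathrm{odd}}A_{k^+}^2]=\sum_{\substack{1\le j\le k\\ j\text{ odd}}}\binom kj\sum_{r=0}^{j-1}\binom{j-1}r(-1)^{j-r}\Big\{2\int_0^1zP_M\Big(\frac{z+r}k\Big)dz-P_M\Big(\frac{r+1}k\Big)\Big\},$$ $$\mathbb{E}[I_{\mathrm{odd}}A_{k^+}J]=\sum_{\substack{1\le j\le k\\ j\text{ odd}}}j\binom kj\sum_{r=0}^{j-1}\binom{j-1}r(-1)^{j-r}F_r,$$ $$\mathbb{E}[I_{\mathrm{odd}}A_{k^+}k^+]=-\sum_{\substack{1\le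 m\le k\\ m\text{ odd}}}mF_{m-1}+\sum_{m=1}^k\sum_{r=0}^{m-2}\binom mr(m-r)2^{m-r-2}(-1)^{r+1}F_r,$$ $$\mathbb{E}[MI_{\mathrm{odd}}A_{k^+}]=\sum_{\substack{1\le j\le k\\ j\text{ odd}}}\binom kj\sum_{r=0}^{j-1}\binom{j-1}r(-1)^{j-r}\Big\{\int_0^1\frac{z+r}kP_M'\Big(\frac{z+r}k\Big)dz-\frac{r+1}kP_M'\Big(\frac{r+1}k\Big)\Big\}.$$
   Context: Model. $k\ge1$ is an integer (number of aisles, numbered $1,\dots,k$); $l>0$ (aisle length), $w_a>0$ (distance between the middles of adjacent aisles), $v>0$ (walking speed) are constants. The order size $M$ is a nonnegative-integer-valued random variable with $\mathbb{E}[M^2]<\infty$ and probability generating function $P_M(x)=\mathbb{E}[x^M]$, $x\in[-1,1]$ (with $0^0=1$); $P_M'$ is its derivative (one-sided at $1$, so $P_M'(1)=\mathbb{E}[M]$). Given $M$, each of the $M$ items is, independently of the others, placed in an aisle uniformly distributed on $\{1,\dots,k\}$ and, independently, at a location uniformly distributed on $[0,1]$ in that aisle (fraction of the aisle length measured from the front cross-aisle). The item picking times $P_1,P_2,\dots$ are i.i.d. copies of a nonnegative random variable $P$ with $\mathbb{E}[P^2]<\infty$, independent of $M$ and of all item locations. $N_i$ is the number of items in aisle $i$ and $I_i=\mathbf 1\{N_i>0\}$. $I_{\mathrm{odd}}$ is the indicator that $\sum_{i=1}^kI_i$ is odd. $k^+=\max\{i:N_i>0\}$ (with $k^+=0$ if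 $M=0$). $A_i$ is the largest location of an item in aisle $i$ ($0$ if $N_i=0$), $A_{k^+}$ is its value for aisle $k^+$, and $I_{\mathrm{odd}}A_{k^+}=0$ if $M=0$. Empty sums are $0$. *)

theory Defs
  imports "HOL-Probability.Probability"
begin

text \<open>
  Items are numbered from 0, so an order of size \<open>M \<omega>\<close> consists of the items \<open>j < M \<omega>\<close>; aisles are
  numbered from 1. Item \<open>j\<close> lies in aisle \<open>aisle j \<omega>\<close> at the location \<open>loc j \<omega>\<close>, a fraction of the aisle
  length. The values \<open>aisle j \<omega>\<close> and \<open>loc j \<omega>\<close> with \<open>j \<ge> M \<omega>\<close> are placeholders that no quantity below uses.
\<close>

definition items_in_aisle :: "('w \<Rightarrow> nat) \<Rightarrow> (nat \<Rightarrow> 'w \<Rightarrow> nat) \<Rightarrow> nat \<Rightarrow> 'w \<Rightarrow> nat" where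
  "items_in_aisle M aisle i \<omega> = card {j. j < M \<omega> \<and> aisle j \<omega> = i}"

definition visited_aisles :: "nat \<Rightarrow> ('w \<Rightarrow> nat) \<Rightarrow> (nat \<Rightarrow> 'w \<Rightarrow> nat) \<Rightarrow> 'w \<Rightarrow> nat" where
  "visited_aisles k M aisle \<omega> = (\<Sum>i = 1..k. of_bool (0 < items_in_aisle M aisle i \<omega>))"

text \<open>The element 0 is inserted only to give the value 0 when no aisle contains an item.\<close>

definition last_aisle :: "nat \<Rightarrow> ('w \<Rightarrow> nat) \<Rightarrow> (nat \<Rightarrow> 'w \<Rightarrow> nat) \<Rightarrow> 'w \<Rightarrow> nat" where
  "last_aisle k M aisle \<omega> = Max (insert 0 {i \<in> {1..k}. 0 < items_in_aisle M aisle i \<omega>})"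

definition farthest_location ::
  "('w \<Rightarrow> nat) \<Rightarrow> (nat \<Rightarrow> 'w \<Rightarrow> nat) \<Rightarrow> (nat \<Rightarrow> 'w \<Rightarrow> real) \<Rightarrow> nat \<Rightarrow> 'w \<Rightarrow> real" where
  "farthest_location M aisle loc i \<omega> =
    (if items_in_aisle M aisle i \<omega> = 0 then 0 else Max {loc j \<omega> | j. j < M \<omega> \<and> aisle j \<omega> = i})"

definition pgf :: "'w measure \<Rightarrow> ('w \<Rightarrow> nat) \<Rightarrow> real \<Rightarrow> real" where
  "pgf \<Omega> M x = (\<integral>\<omega>. x ^ M \<omega> \<partial>\<Omega>)"

text \<open>The derivative within \<open>[-1, 1]\<close>, hence the left derivative at 1.\<close>

definition pgf_deriv :: "'w measure \<Rightarrow> ('w \<Rightarrow> nat) \<Rightarrow> real \<Rightarrow> real" where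
  "pgf_deriv \<Omega> M x = vector_derivative (pgf \<Omega> M) (at x within {-1..1})"

definition given_size :: "'w measure \<Rightarrow> ('w \<Rightarrow> nat) \<Rightarrow> nat \<Rightarrow> 'w measure" where
  "given_size \<Omega> M m = uniform_measure \<Omega> {\<omega> \<in> space \<Omega>. M \<omega> = m}"

text \<open>
  Conditionally on \<open>M = m\<close>, the positions (aisle, location) of the \<open>m\<close> items are independent, and each
  is distributed as an independent pair of a uniform aisle in \<open>{1..k}\<close> and a uniform point of \<open>[0, 1]\<close>.
\<close>

definition uniform_items ::
  "'w measure \<Rightarrow> nat \<Rightarrow> ('w \<Rightarrow> nat) \<Rightarrow> (nat \<Rightarrow> 'w \<Rightarrow> nat) \<Rightarrow> (nat \<Rightarrow> 'w \<Rightarrow> real) \<Rightarrow> bool" where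
  "uniform_items \<Omega> k M aisle loc \<longleftrightarrow>
    (\<forall>m. measure \<Omega> {\<omega> \<in> space \<Omega>. M \<omega> = m} > 0 \<longrightarrow>
      prob_space.indep_vars (given_size \<Omega> M m) (\<lambda>_. count_space UNIV \<Otimes>\<^sub>M borel)
        (\<lambda>j \<omega>. (aisle j \<omega>, loc j \<omega>)) {..<m} \<and>
      (\<forall>j<m. distr (given_size \<Omega> M m) (count_space UNIV \<Otimes>\<^sub>M borel) (\<lambda>\<omega>. (aisle j \<omega>, loc j \<omega>))
        = measure_pmf (pmf_of_set {1..k}) \<Otimes>\<^sub>M uniform_measure lborel {0..1}))"

text \<open>
  Independence of two random variables whose value types may differ, which \<open>prob_space.indep_var\<close> does
  not allow: the generated sigma-algebras are independent.
\<close>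

definition indep_rvs ::
  "'w measure \<Rightarrow> 'b measure \<Rightarrow> ('w \<Rightarrow> 'b) \<Rightarrow> 'c measure \<Rightarrow> ('w \<Rightarrow> 'c) \<Rightarrow> bool" where
  "indep_rvs \<Omega> N X N' Y \<longleftrightarrow>
    X \<in> \<Omega> \<rightarrow>\<^sub>M N \<and> Y \<in> \<Omega> \<rightarrow>\<^sub>M N' \<and>
    prob_space.indep_set \<Omega> (sets (vimage_algebra (space \<Omega>) X N)) (sets (vimage_algebra (space \<Omega>) Y N'))"

end

theory Submission
  imports Defs
begin

text \<open>
  The tour visits a random set of aisles, and every routing statistic is a function of that set and of
  the location of the farthest item in its last aisle. Write \<open>g r\<close> for \<open>P\<^sub>M (r / k)\<close>. Since the items are placed
  independently and uniformly, the probability that all of them lie in a region of measure \<open>\<rho>\<close> is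
  \<open>P\<^sub>M \<rho>\<close>; in particular the visited set lies inside a fixed set of \<open>r\<close> aisles with probability \<open>g r\<close>.
  Weighting by the order size replaces \<open>P\<^sub>M x\<close> by \<open>x P\<^sub>M' x\<close>. Both cases are treated at once by a
  generating function with an arbitrary weight \<open>h (M)\<close> (\<open>integral_all_items_in_region\<close>).

  It remains to write each statistic as a finite linear combination of indicators of ``the visited set \<open>S\<close>
  is contained in \<open>U\<close>''. The number of visited aisles is \<open>k\<close> minus the sum over \<open>i\<close> of the indicators
  of \<open>S \<subseteq> {1..k} - {i}\<close>, the last aisle is \<open>k\<close> minus the sum over \<open>r < k\<close> of those of \<open>S \<subseteq> {1..r}\<close>, and
  parity is handled by \<open>\<Sum>\<^bsub>S \<subseteq> U \<subseteq> C\<^esub> x\<^bsup>|U|\<^esup> y\<^bsup>|C| - |U|\<^esup> = x\<^bsup>|S|\<^esup> (x + y)\<^bsup>|C| - |S|\<^esup>\<close> at \<open>x = -1\<close>, \<open>y = 2\<close>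
  (\<open>odd_card_expansion\<close>). If \<open>e c\<close> is the expectation of the parity indicator
  restricted to \<open>S \<subseteq> C\<close> with \<open>|C| = c\<close>, then \<open>E[I J] = k (e k - e (k - 1))\<close>, and summation by parts
  gives \<open>E[I K] = \<Sum>\<^bsub>s \<le> k\<^esub> s (e s - e (s - 1))\<close>; this is where the similar shape of the two formulas comes from.

  For the farthest item the layer cake formula \<open>1 - a\<^bsup>q\<^esup> = \<integral>\<^sub>a\<^sup>1 q z\<^bsup>q - 1\<^esup> dz\<close> reduces powers of a
  maximum \<open>a\<close> to the events \<open>a \<le> z\<close>, which again say that all items lie in a region, now of measure
  \<open>(r + z) / k\<close> (\<open>integral_farthest_power\<close>). The farthest location of an empty aisle is \<open>0\<close>, so in an
  expansion over sets \<open>U\<close> only those containing the last aisle contribute; this explains the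
  binomial coefficients of \<open>j - 1\<close>.

  Finally the picking times are independent of the order, so expectations involving their random sum
  can be evaluated on each event \<open>M = n\<close> separately (\<open>random_index_independent\<close>), and
  squaring the total time and expanding gives the second moment (\<open>picking_time_moments\<close>).
\<close>

section \<open>The derivative of a probability generating function\<close>

text \<open>
  A crude first-order Taylor bound whose constant \<open>n\<^sup>2\<close> is chosen so that a finite second moment
  alone makes it integrable.
\<close>

lemma power_taylor1_bound:
  fixes x y :: real
  assumes "\<bar>x\<bar> \<le> 1" "\<bar>y\<bar> \<le> 1"
  shows "\<bar>y ^ n - x ^ n - real n * x ^ (n - 1) * (y - x)\<bar> \<le> (real n)\<^sup>2 * (y - x)\<^sup>2"
proof (induction n)
  case (Suc n)
  let ?e = "y ^ n - x ^ n - real n * x ^ (n - 1) * (y - x)"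
  have "y ^ Suc n - x ^ Suc n - real (Suc n) * x ^ (Suc n - 1) * (y - x)
      = y * ?e + real n * x ^ (n - 1) * (y - x)\<^sup>2"
    by (cases n) (simp_all add: algebra_simps power2_eq_square)
  also have "\<bar>\<dots>\<bar> \<le> \<bar>y\<bar> * \<bar>?e\<bar> + real n * \<bar>x\<bar> ^ (n - 1) * (y - x)\<^sup>2"
    by (rule order_trans[OF abs_triangle_ineq]) (simp add: abs_mult power_abs)
  also have "\<dots> \<le> 1 * ((real n)\<^sup>2 * (y - x)\<^sup>2) + real n * 1 * (y - x)\<^sup>2"
    using assms Suc.IH
    by (intro add_mono mult_mono mult_right_mono mult_left_mono power_le_one) auto
  also have "\<dots> \<le> (real (Suc n))\<^sup>2 * (y - x)\<^sup>2"
  proof -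
    have "(real n)\<^sup>2 + real n \<le> (real (Suc n))\<^sup>2" by (simp add: power2_eq_square algebra_simps)
    from mult_right_mono[OF this, of "(y - x)\<^sup>2"] show ?thesis by (simp add: algebra_simps)
  qed
  finally show ?case .
qed simp

text \<open>
  The second moment of \<open>N\<close> controls the first-order error uniformly on \<open>[-1, 1]\<close>, so differentiation
  under the expectation needs no power series and covers the one-sided derivative at \<open>\<plusminus>1\<close> as well.
  Multiplying by \<open>x\<close> avoids the exponent \<open>N - 1\<close>.
\<close>

lemma (in prob_space) expectation_size_power_eq_pgf_deriv:
  fixes N :: "'a \<Rightarrow> nat"
  assumes N[measurable]: "N \<in> measurable M (count_space UNIV)"
    and N2: "integrable M (\<lambda>\<omega>. (real (N \<omega>))\<^sup>2)" and x: "\<bar>x\<bar> \<le> 1"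
  shows "x * pgf_deriv M N x = (\<integral>\<omega>. real (N \<omega>) * x ^ N \<omega> \<partial>M)"
proof -
  let ?D = "\<integral>\<omega>. real (N \<omega>) * x ^ (N \<omega> - 1) \<partial>M"
  have "real n \<le> (real n)\<^sup>2" for n
    by (cases n) (auto simp: power2_eq_square algebra_simps)
  then have iN: "integrable M (\<lambda>\<omega>. real (N \<omega>))"
    by (intro Bochner_Integration.integrable_bound[OF N2]) auto
  have pw: "integrable M (\<lambda>\<omega>. y ^ N \<omega>)" if "\<bar>y\<bar> \<le> 1" for y :: real
    by (rule integrable_const_bound[where B = 1]) (auto simp: power_abs power_le_one that)
  have iD: "integrable M (\<lambda>\<omega>. real (N \<omega>) * x ^ (N \<omega> - 1))"
    by (rule Bochner_Integration.integrable_bound[OF iN])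
       (use x in \<open>auto simp: abs_mult power_abs mult_left_le power_le_one\<close>)
  let ?B = "\<integral>\<omega>. (real (N \<omega>))\<^sup>2 \<partial>M"
  have err: "\<bar>pgf M N y - pgf M N x - (y - x) * ?D\<bar> \<le> ?B * (y - x)\<^sup>2" if y: "\<bar>y\<bar> \<le> 1" for y
  proof -
    have "pgf M N y - pgf M N x - (y - x) * ?D
        = (\<integral>\<omega>. y ^ N \<omega> - x ^ N \<omega> - real (N \<omega>) * x ^ (N \<omega> - 1) * (y - x) \<partial>M)"
      using pw[OF y] pw[OF x] iD by (simp add: pgf_def)
    also have "\<bar>\<dots>\<bar> \<le> (\<integral>\<omega>. (real (N \<omega>))\<^sup>2 * (y - x)\<^sup>2 \<partial>M)"
      using power_taylor1_bound[OF x y] N2 pw[OF y] pw[OF x] iD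
      by (intro order_trans[OF integral_abs_bound] integral_mono) auto
    finally show ?thesis using N2 by simp
  qed
  have "(pgf M N has_real_derivative ?D) (at x within {-1..1})"
    unfolding has_field_derivative_iff
  proof (rule Lim_null[THEN iffD2], rule Lim_null_comparison)
    show "\<forall>\<^sub>F y in at x within {-1..1}. norm ((pgf M N y - pgf M N x) / (y - x) - ?D) \<le> ?B * \<bar>y - x\<bar>"
      unfolding eventually_at_filter
    proof (intro always_eventually allI impI)
      fix y assume y: "y \<noteq> x" "y \<in> {-1..1}"
      have "norm ((pgf M N y - pgf M N x) / (y - x) - ?D) = \<bar>(pgf M N y - pgf M N x - (y - x) * ?D) / (y - x)\<bar>"
        using y by (simp add: field_simps)
      also have "\<dots> \<le> ?B * (y - x)\<^sup>2 / \<bar>y - x\<bar>"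
        unfolding abs_divide using y by (intro divide_right_mono err) auto
      also have "\<dots> = ?B * \<bar>y - x\<bar>"
      proof -
        have "\<bar>y - x\<bar>\<^sup>2 / \<bar>y - x\<bar> = \<bar>y - x\<bar>"
          using y nonzero_mult_div_cancel_right[of "\<bar>y - x\<bar>" "\<bar>y - x\<bar>"] by (simp only: power2_eq_square)
        then show ?thesis by (simp flip: times_divide_eq_right)
      qed
      finally show "norm ((pgf M N y - pgf M N x) / (y - x) - ?D) \<le> ?B * \<bar>y - x\<bar>" .
    qed
    show "((\<lambda>y. ?B * \<bar>y - x\<bar>) \<longlongrightarrow> 0) (at x within {-1..1})"
      by (auto intro!: tendsto_eq_intros)
  qed
  then have "(pgf M N has_vector_derivative ?D) (at x within {-1..1})"
    by (simp add: has_real_derivative_iff_has_vector_derivative)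
  then have deriv: "pgf_deriv M N x = ?D"
    using x vector_derivative_within_cbox[of "-1" 1 x "pgf M N" ?D]
    by (simp add: pgf_deriv_def abs_le_iff)
  have "x * (real n * x ^ (n - 1)) = real n * x ^ n" for n
    by (cases n) auto
  then show ?thesis unfolding deriv integral_mult_right_zero[symmetric] by (simp only:)
qed

section \<open>Sums over the subsets of a finite set\<close>

text \<open>
  The sets between \<open>W\<close> and \<open>C\<close> are \<open>W \<union> X\<close> with \<open>X \<subseteq> C - W\<close>, so this is the binomial theorem for
  \<open>C - W\<close>. Taking \<open>(x, y) = (1, -1)\<close> gives Moebius inversion, and \<open>(-1, 2)\<close> gives the sign \<open>(-1)\<^bsup>|W|\<^esup>\<close>.
\<close>

lemma sum_intermediate_sets:
  fixes x y :: "'b :: comm_ring_1"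
  assumes "finite C" "W \<subseteq> C"
  shows "(\<Sum>U | W \<subseteq> U \<and> U \<subseteq> C. x ^ card U * y ^ (card C - card U))
       = x ^ card W * (x + y) ^ (card C - card W)"
proof -
  have fW: "finite W" using assms finite_subset by blast
  have "(x + y) ^ (card C - card W) = (\<Prod>i\<in>C - W. x + y)"
    using assms fW by (simp add: card_Diff_subset)
  also have "\<dots> = (\<Sum>X\<in>Pow (C - W). x ^ card X * y ^ card (C - W - X))"
    using assms by (subst prod_add) auto
  finally have "x ^ card W * (x + y) ^ (card C - card W)
      = (\<Sum>X\<in>Pow (C - W). x ^ card W * (x ^ card X * y ^ card (C - W - X)))"
    by (simp add: sum_distrib_left)
  also have "\<dots> = (\<Sum>U | W \<subseteq> U \<and> U \<subseteq> C. x ^ card U * y ^ (card C - card U))"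
  proof (rule sum.reindex_bij_witness[where i = "\<lambda>U. U - W" and j = "\<lambda>X. W \<union> X"], goal_cases)
    case (5 X)
    then have X: "finite X" "X \<subseteq> C - W" using assms finite_subset by blast+
    then have "card (W \<union> X) = card W + card X" using fW by (intro card_Un_disjoint) auto
    moreover have "card (C - W - X) = card C - card W - card X"
      using X fW assms by (simp add: card_Diff_subset)
    ultimately show ?case by (simp add: power_add mult_ac)
  qed (use assms in auto)
  finally show ?thesis by simp
qed

lemma sum_subsets_by_card:
  fixes f :: "nat \<Rightarrow> real"
  assumes "finite C"
  shows "(\<Sum>U\<in>Pow C. f (card U)) = (\<Sum>r\<le>card C. real (card C choose r) * f r)"
proof -
  have "(\<Sum>U\<in>Pow C. f (card U)) = (\<Sum>r\<le>card C. \<Sum>U | U \<in> Pow C \<and> card U = r. f (card U))"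
    using assms by (intro sum.group[symmetric]) (auto simp: card_mono)
  also have "\<dots> = (\<Sum>r\<le>card C. real (card C choose r) * f r)"
    using assms by (intro sum.cong refl) (simp add: n_subsets)
  finally show ?thesis .
qed

lemma indicator_eq_moebius:
  assumes "finite C" "W \<subseteq> C"
  shows "of_bool (W = C)
       = (\<Sum>U\<in>Pow C. (-1) ^ (card C - card U) * of_bool (W \<subseteq> U) :: real)"
proof -
  have "(\<Sum>U\<in>Pow C. (-1) ^ (card C - card U) * of_bool (W \<subseteq> U) :: real)
      = (\<Sum>U | W \<subseteq> U \<and> U \<subseteq> C. 1 ^ card U * (-1) ^ (card C - card U))"
    using assms by (intro sum.mono_neutral_cong_right) auto
  also have "\<dots> = of_bool (W = C)"
    unfolding sum_intermediate_sets[OF assms]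
    using assms by (simp add: power_0_left) (metis card_mono card_subset_eq le_antisym)
  finally show ?thesis ..
qed

text \<open>
  The coefficient of the indicator of \<open>W \<subseteq> U\<close> in the indicator that \<open>|W|\<close> is odd, for \<open>W \<subseteq> C\<close>,
  \<open>|C| = c\<close> and \<open>|U| = r\<close>. For \<open>U = C\<close> the two halves of \<open>(1 - (-1)\<^bsup>|W|\<^esup>) / 2\<close> merge.
\<close>

definition parity_coeff :: "nat \<Rightarrow> nat \<Rightarrow> real" where
  "parity_coeff c r = (if r = c then of_bool (odd c) else (-1) ^ (r + 1) * 2 ^ (c - r - 1))"

lemma odd_card_expansion:
  assumes "finite C" "W \<subseteq> C"
  shows "of_bool (odd (card W)) = (\<Sum>U\<in>Pow C. parity_coeff (card C) (card U) * of_bool (W \<subseteq> U))"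
proof -
  let ?f = "\<lambda>U. (-1) ^ card U * 2 ^ (card C - card U) :: real"
  have coeff: "parity_coeff (card C) (card U) = (of_bool (U = C) - ?f U) / 2" if "U \<subseteq> C" for U
  proof (cases "U = C")
    case False
    then have "card U < card C" using that assms by (meson psubsetI psubset_card_mono)
    then have "card C - card U = Suc (card C - card U - 1)" by simp
    then have "?f U = (-1) ^ card U * (2 * 2 ^ (card C - card U - 1))"
      by (metis power_Suc)
    with False \<open>card U < card C\<close> show ?thesis by (simp add: parity_coeff_def)
  qed (simp add: parity_coeff_def)
  have "(\<Sum>U\<in>Pow C. ?f U * of_bool (W \<subseteq> U)) = (\<Sum>U | W \<subseteq> U \<and> U \<subseteq> C. ?f U)"
    using assms by (intro sum.mono_neutral_cong_right) auto
  also have "\<dots> = (-1) ^ card W"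
    unfolding sum_intermediate_sets[OF assms] by simp
  finally have f: "(\<Sum>U\<in>Pow C. ?f U * of_bool (W \<subseteq> U)) = (-1) ^ card W" .
  have "(\<Sum>U\<in>Pow C. parity_coeff (card C) (card U) * of_bool (W \<subseteq> U))
      = (\<Sum>U\<in>Pow C. (of_bool (U = C) * of_bool (W \<subseteq> U)) / 2 - ?f U * of_bool (W \<subseteq> U) / 2)"
    by (intro sum.cong refl) (simp add: coeff diff_divide_distrib left_diff_distrib)
  also have "\<dots> = (\<Sum>U\<in>Pow C. of_bool (U = C) * of_bool (W \<subseteq> U)) / 2 - (-1) ^ card W / 2"
    by (simp only: sum_subtractf f flip: sum_divide_distrib)
  also have "(\<Sum>U\<in>Pow C. of_bool (U = C) * of_bool (W \<subseteq> U)) = (1::real)"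
    using assms by (subst sum.mono_neutral_cong_right[where S = "{C}" and h = "\<lambda>_. 1"]) auto
  finally show ?thesis by (simp add: minus_one_power_iff)
qed

text \<open>
  The probability that the visited set has odd size and lies in a given set of \<open>c\<close> aisles, when \<open>g r\<close>
  is the probability that it lies in a given set of \<open>r\<close> aisles.
\<close>

definition odd_sum :: "(nat \<Rightarrow> real) \<Rightarrow> nat \<Rightarrow> real" where
  "odd_sum g c = (\<Sum>r<c. real (c choose r) * (-1) ^ (r + 1) * 2 ^ (c - r - 1) * g r) + of_bool (odd c) * g c"

lemma odd_sum_eq_parity_coeff: "odd_sum g c = (\<Sum>r\<le>c. real (c choose r) * (parity_coeff c r * g r))"
  unfolding odd_sum_def lessThan_Suc_atMost[symmetric] sum.lessThan_Suc
  by (simp add: parity_coeff_def mult.assoc cong: sum.cong_simp)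

text \<open>
  Both formulas that combine parity with a counting statistic are built from these weighted
  differences; the factor \<open>n + s\<close> comes from \<open>2 s - (s - n)\<close> via \<open>s (s - 1 choose n) = (s - n) (s choose n)\<close>.
\<close>

lemma odd_sum_diff:
  assumes "1 \<le> s"
  shows "real s * (odd_sum g s - odd_sum g (s - 1)) =
      (\<Sum>n<s - 1. real (s choose n) * g n * (-1) ^ (n + 1) * real (n + s) * 2 ^ (s - n - 2))
    + of_bool (even s) * (real s * (real s - 1) * g (s - 1))
    + of_bool (odd s) * (real s * g s - (real s)\<^sup>2 * g (s - 1))"
proof -
  obtain t where s: "s = Suc t" using assms by (cases s) auto
  let ?d = "\<lambda>n. real (s choose n) * (-1) ^ (n + 1) * 2 ^ (t - n) * g n
      - real (t choose n) * (-1) ^ (n + 1) * 2 ^ (t - n - 1) * g n"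
  have coeff: "real s * ?d n = real (s choose n) * g n * (-1) ^ (n + 1) * real (n + s) * 2 ^ (s - n - 2)"
    if "n < t" for n
  proof -
    let ?P = "(-1) ^ (n + 1) * 2 ^ (t - n - 1) * g n"
    have pow: "2 ^ (t - n) = (2 * 2 ^ (t - n - 1) :: real)"
      using that by (subst power_Suc[symmetric]) (simp add: Suc_diff_Suc)
    have "Suc t * (t choose n) = (s - n) * (s choose n)"
      using that Suc_times_binomial_eq[of t "t - n"] binomial_symmetric[of n t] binomial_symmetric[of n s]
      by (simp add: s Suc_diff_le mult.commute)
    then have binom: "real s * real (t choose n) = (real s - real n) * real (s choose n)"
      using that s by (metis of_nat_mult of_nat_diff less_Suc_eq less_or_eq_imp_le)
    have "real s * ?d n = ?P * (2 * real s * real (s choose n)) - ?P * (real s * real (t choose n))"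
      unfolding pow by (simp only: algebra_simps)
    also have "\<dots> = ?P * (real s + real n) * real (s choose n)"
      unfolding binom by (simp only: algebra_simps)
    finally show ?thesis by (simp add: s algebra_simps)
  qed
  have "odd_sum g s - odd_sum g (s - 1)
      = (\<Sum>n<t. ?d n) + real s * (-1) ^ s * g t + of_bool (odd s) * g s - of_bool (odd t) * g t"
    by (simp add: odd_sum_def s sum_subtractf sum_negf)
  then have "real s * (odd_sum g s - odd_sum g (s - 1))
      = (\<Sum>n<t. real s * ?d n) + real s * (real s * (-1) ^ s * g t + of_bool (odd s) * g s - of_bool (odd t) * g t)"
    by (simp only: sum_distrib_left distrib_left right_diff_distrib)
  also have "(\<Sum>n<t. real s * ?d n)
      = (\<Sum>n<s - 1. real (s choose n) * g n * (-1) ^ (n + 1) * real (n + s) * 2 ^ (s - n - 2))"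
    using coeff by (intro sum.cong) (auto simp: s)
  finally show ?thesis
    by (cases "even s") (simp_all add: s algebra_simps power2_eq_square)
qed

lemma summation_by_parts:
  fixes f :: "nat \<Rightarrow> real"
  shows "real n * f n - (\<Sum>r<n. f r) = (\<Sum>s = 1..n. real s * (f s - f (s - 1)))"
  by (induction n) (simp_all add: algebra_simps)

text \<open>
  Each \<open>i\<close> in \<open>C\<close> contributes one to \<open>card S\<close> unless \<open>S\<close> avoids it.
\<close>

lemma card_eq_sum_avoided:
  assumes "finite C"
  shows "real (card S) * of_bool (S \<subseteq> C)
       = real (card C) * of_bool (S \<subseteq> C) - (\<Sum>i\<in>C. of_bool (S \<subseteq> C - {i}))"
proof (cases "S \<subseteq> C")
  case True
  then have "(\<Sum>i\<in>C. of_bool (S \<subseteq> C - {i})) = (\<Sum>i\<in>C. of_bool (i \<notin> S) :: real)"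
    by (intro sum.cong) auto
  also have "\<dots> = real (card (C - S))"
    using assms by (simp add: sum_of_bool_eq Diff_eq Compl_eq)
  also have "\<dots> = real (card C) - real (card S)"
    using True assms by (simp add: card_Diff_subset finite_subset of_nat_diff card_mono)
  finally show ?thesis using True by simp
next
  case False
  then have "\<not> S \<subseteq> C - {i}" for i by auto
  then show ?thesis using False by simp
qed

lemma sum_of_bool_less_telescope:
  fixes f :: "nat \<Rightarrow> real"
  assumes "m \<le> k"
  shows "(\<Sum>r<k. (f (Suc r) - f r) * of_bool (m \<le> r)) = f k - f m"
proof -
  have "(\<Sum>r<k. (f (Suc r) - f r) * of_bool (m \<le> r)) = (\<Sum>r = m..<k. f (Suc r) - f r)"
    by (intro sum.mono_neutral_cong_right) auto
  then show ?thesis using assms by (simp add: sum_Suc_diff')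
qed

section \<open>Splitting expectations along a discrete variable\<close>

text \<open>
  The events \<open>N = n\<close> partition the space, so dominated convergence lets an identity be checked on each
  of them, where \<open>N\<close> may be treated as a constant.
\<close>

lemma (in prob_space) integral_eq_by_size:
  fixes X Y :: "'a \<Rightarrow> real" and N :: "'a \<Rightarrow> nat"
  assumes N[measurable]: "N \<in> measurable M (count_space UNIV)"
    and X: "integrable M X" and Y: "integrable M Y"
    and eq: "\<And>n. (\<integral>\<omega>. of_bool (N \<omega> = n) * X \<omega> \<partial>M) = (\<integral>\<omega>. of_bool (N \<omega> = n) * Y \<omega> \<partial>M)"
  shows "(\<integral>\<omega>. X \<omega> \<partial>M) = (\<integral>\<omega>. Y \<omega> \<partial>M)"
proof -
  have sums: "(\<lambda>n. \<integral>\<omega>. of_bool (N \<omega> = n) * Z \<omega> \<partial>M) sums (\<integral>\<omega>. Z \<omega> \<partial>M)"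
    if Z: "integrable M Z" for Z :: "'a \<Rightarrow> real"
  proof -
    have [measurable]: "Z \<in> borel_measurable M" using Z by auto
    have "(\<integral>\<omega>. (\<Sum>n<m. of_bool (N \<omega> = n) * Z \<omega>) \<partial>M) = (\<Sum>n<m. \<integral>\<omega>. of_bool (N \<omega> = n) * Z \<omega> \<partial>M)" for m
      by (intro Bochner_Integration.integral_sum Bochner_Integration.integrable_bound[OF Z]) auto
    moreover have "(\<lambda>m. \<integral>\<omega>. (\<Sum>n<m. of_bool (N \<omega> = n) * Z \<omega>) \<partial>M) \<longlonglongrightarrow> (\<integral>\<omega>. Z \<omega> \<partial>M)"
    proof (rule integral_dominated_convergence[where w = "\<lambda>\<omega>. \<bar>Z \<omega>\<bar>"])
      have *: "(\<Sum>n<m. of_bool (N \<omega> = n) * Z \<omega>) = of_bool (N \<omega> < m) * Z \<omega>" for m \<omega>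
        by (subst sum_distrib_right[symmetric]) (simp add: of_bool_def)
      show "AE \<omega> in M. (\<lambda>m. \<Sum>n<m. of_bool (N \<omega> = n) * Z \<omega>) \<longlonglongrightarrow> Z \<omega>"
      proof (intro AE_I2 tendsto_eventually)
        fix \<omega>
        show "\<forall>\<^sub>F m in sequentially. (\<Sum>n<m. of_bool (N \<omega> = n) * Z \<omega>) = Z \<omega>"
          using eventually_gt_at_top[of "N \<omega>"] by eventually_elim (simp add: *)
      qed
      show "AE \<omega> in M. norm (\<Sum>n<m. of_bool (N \<omega> = n) * Z \<omega>) \<le> \<bar>Z \<omega>\<bar>" for m
        by (simp add: *)
    qed (use Z in auto)
    ultimately show ?thesis by (simp add: sums_def)
  qed
  show ?thesis
    using sums[OF X] sums[OF Y] by (simp add: eq sums_iff)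
qed

text \<open>
  The companion of the previous lemma for integrability: a random sum is not dominated pointwise, only
  on average over each event \<open>N = n\<close>.
\<close>

lemma (in prob_space) integrable_by_size:
  fixes X Y :: "'a \<Rightarrow> real" and N :: "'a \<Rightarrow> nat"
  assumes N[measurable]: "N \<in> measurable M (count_space UNIV)"
    and X[measurable]: "X \<in> borel_measurable M" and Y: "integrable M Y" and Y0: "\<And>\<omega>. 0 \<le> Y \<omega>"
    and fibre: "\<And>n. integrable M (\<lambda>\<omega>. of_bool (N \<omega> = n) * X \<omega>)"
    and le: "\<And>n. (\<integral>\<omega>. of_bool (N \<omega> = n) * \<bar>X \<omega>\<bar> \<partial>M) \<le> (\<integral>\<omega>. of_bool (N \<omega> = n) * Y \<omega> \<partial>M)"
  shows "integrable M X"
proof (rule integrableI_bounded)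
  have [measurable]: "Y \<in> borel_measurable M" using Y by auto
  have split: "(\<integral>\<^sup>+\<omega>. Z \<omega> \<partial>M) = (\<Sum>n. \<integral>\<^sup>+\<omega>. of_bool (N \<omega> = n) * Z \<omega> \<partial>M)"
    if [measurable]: "Z \<in> borel_measurable M" for Z :: "'a \<Rightarrow> ennreal"
  proof -
    have "(\<Sum>n. of_bool (N \<omega> = n) * Z \<omega>) = Z \<omega>" for \<omega>
      by (subst suminf_finite[of "{N \<omega>}"]) auto
    then show ?thesis by (subst nn_integral_suminf[symmetric]) auto
  qed
  have "(\<integral>\<^sup>+\<omega>. ennreal (norm (X \<omega>)) \<partial>M) = (\<Sum>n. \<integral>\<^sup>+\<omega>. of_bool (N \<omega> = n) * ennreal (norm (X \<omega>)) \<partial>M)"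
    by (rule split) auto
  also have "\<dots> \<le> (\<Sum>n. \<integral>\<^sup>+\<omega>. of_bool (N \<omega> = n) * ennreal (Y \<omega>) \<partial>M)"
  proof (rule suminf_le)
    fix n
    have "(\<integral>\<^sup>+\<omega>. of_bool (N \<omega> = n) * ennreal (norm (X \<omega>)) \<partial>M) = (\<integral>\<^sup>+\<omega>. ennreal (of_bool (N \<omega> = n) * \<bar>X \<omega>\<bar>) \<partial>M)"
      by (intro nn_integral_cong) auto
    also have "\<dots> = ennreal (\<integral>\<omega>. of_bool (N \<omega> = n) * \<bar>X \<omega>\<bar> \<partial>M)"
      using integrable_abs[OF fibre[of n]] by (intro nn_integral_eq_integral) (auto simp: abs_mult)
    also have "\<dots> \<le> ennreal (\<integral>\<omega>. of_bool (N \<omega> = n) * Y \<omega> \<partial>M)"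
      by (intro ennreal_leI le)
    also have "\<dots> = (\<integral>\<^sup>+\<omega>. ennreal (of_bool (N \<omega> = n) * Y \<omega>) \<partial>M)"
      by (intro nn_integral_eq_integral[symmetric] Bochner_Integration.integrable_bound[OF Y]) (auto simp: Y0)
    also have "\<dots> = (\<integral>\<^sup>+\<omega>. of_bool (N \<omega> = n) * ennreal (Y \<omega>) \<partial>M)"
      by (intro nn_integral_cong) auto
    finally show "(\<integral>\<^sup>+\<omega>. of_bool (N \<omega> = n) * ennreal (norm (X \<omega>)) \<partial>M) \<le> (\<integral>\<^sup>+\<omega>. of_bool (N \<omega> = n) * ennreal (Y \<omega>) \<partial>M)" .
  qed auto
  also have "\<dots> = (\<integral>\<^sup>+\<omega>. ennreal (Y \<omega>) \<partial>M)" by (rule split[symmetric]) auto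
  also have "\<dots> < \<infinity>"
    using Y Y0 by (simp add: nn_integral_eq_integral)
  finally show "(\<integral>\<^sup>+\<omega>. ennreal (norm (X \<omega>)) \<partial>M) < \<infinity>" .
qed auto

section \<open>Visited aisles, last aisle and farthest location\<close>

definition visited_set :: "nat \<Rightarrow> ('w \<Rightarrow> nat) \<Rightarrow> (nat \<Rightarrow> 'w \<Rightarrow> nat) \<Rightarrow> 'w \<Rightarrow> nat set" where
  "visited_set k M aisle \<omega> = {i \<in> {1..k}. 0 < items_in_aisle M aisle i \<omega>}"

lemma items_in_aisle_pos_iff: "0 < items_in_aisle M aisle i \<omega> \<longleftrightarrow> (\<exists>j<M \<omega>. aisle j \<omega> = i)"
  by (auto simp: items_in_aisle_def card_gt_0_iff)

lemma finite_visited_set [simp]: "finite (visited_set k M aisle \<omega>)"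
  by (simp add: visited_set_def)

lemma visited_set_subset: "visited_set k M aisle \<omega> \<subseteq> {1..k}"
  by (auto simp: visited_set_def)

lemma visited_aisles_eq_card: "visited_aisles k M aisle \<omega> = card (visited_set k M aisle \<omega>)"
proof -
  have "visited_set k M aisle \<omega> = {1..k} \<inter> {i. 0 < items_in_aisle M aisle i \<omega>}"
    by (auto simp: visited_set_def)
  then show ?thesis by (simp add: visited_aisles_def sum_of_bool_eq)
qed

lemma last_aisle_eq_Max: "last_aisle k M aisle \<omega> = Max (insert 0 (visited_set k M aisle \<omega>))"
  by (simp add: last_aisle_def visited_set_def)

lemma last_aisle_le_iff:
  "last_aisle k M aisle \<omega> \<le> r \<longleftrightarrow> visited_set k M aisle \<omega> \<subseteq> {1..r}"
  by (auto simp: last_aisle_eq_Max visited_set_def)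

lemma last_aisle_in_visited_set:
  "visited_set k M aisle \<omega> \<noteq> {} \<Longrightarrow> last_aisle k M aisle \<omega> \<in> visited_set k M aisle \<omega>"
proof -
  assume ne: "visited_set k M aisle \<omega> \<noteq> {}"
  let ?V = "visited_set k M aisle \<omega>"
  have "Max (insert 0 ?V) = Max ?V"
    using ne by (subst Max_insert) auto
  then show ?thesis using ne Max_in[of ?V] by (simp add: last_aisle_eq_Max)
qed

lemma measurable_visited_set:
  assumes [measurable]: "M \<in> measurable N (count_space UNIV)"
    "\<And>j. aisle j \<in> measurable N (count_space UNIV)"
  shows "visited_set k M aisle \<in> measurable N (count_space (Pow {1..k}))"
proof (subst measurable_count_space_eq2)
  \<comment> \<open>The target is finite, so it suffices to look at the preimage of each single set.\<close>
  show "visited_set k M aisle \<in> space N \<rightarrow> Pow {1..k} \<and>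
    (\<forall>S\<in>Pow {1..k}. visited_set k M aisle -` {S} \<inter> space N \<in> sets N)"
  proof (intro conjI ballI)
    fix S :: "nat set" assume S: "S \<in> Pow {1..k}"
    have "visited_set k M aisle \<omega> = S \<longleftrightarrow> (\<forall>i\<in>{1..k}. i \<in> S \<longleftrightarrow> (\<exists>j. j < M \<omega> \<and> aisle j \<omega> = i))" for \<omega>
      unfolding visited_set_def items_in_aisle_pos_iff using S by blast
    then have "visited_set k M aisle -` {S} \<inter> space N
        = {\<omega> \<in> space N. \<forall>i\<in>{1..k}. i \<in> S \<longleftrightarrow> (\<exists>j. j < M \<omega> \<and> aisle j \<omega> = i)}"
      by auto
    also have "\<dots> \<in> sets N" by measurable
    finally show "visited_set k M aisle -` {S} \<inter> space N \<in> sets N" .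
  qed (auto simp: visited_set_def)
qed simp

lemma measurable_visited_set_fun:
  assumes "M \<in> measurable N (count_space UNIV)"
    "\<And>j. aisle j \<in> measurable N (count_space UNIV)" and "\<And>S. f S \<in> space L"
  shows "(\<lambda>\<omega>. f (visited_set k M aisle \<omega>)) \<in> measurable N L"
  by (rule measurable_compose[OF measurable_visited_set[OF assms(1,2)]]) (use assms in auto)

lemma measurable_last_aisle:
  assumes "M \<in> measurable N (count_space UNIV)"
    "\<And>j. aisle j \<in> measurable N (count_space UNIV)"
  shows "last_aisle k M aisle \<in> measurable N (count_space UNIV)"
  using measurable_visited_set_fun[OF assms, where L = "count_space UNIV" and f = "\<lambda>S. Max (insert 0 S)"]
  by (simp add: last_aisle_eq_Max[abs_def])

lemma farthest_location_le_iff: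
  "farthest_location M aisle loc i \<omega> \<le> z \<longleftrightarrow>
    (if \<exists>j<M \<omega>. aisle j \<omega> = i then \<forall>j<M \<omega>. aisle j \<omega> = i \<longrightarrow> loc j \<omega> \<le> z else 0 \<le> z)"
proof (cases "\<exists>j<M \<omega>. aisle j \<omega> = i")
  case True
  let ?L = "{loc j \<omega> |j. j < M \<omega> \<and> aisle j \<omega> = i}"
  have "?L = (\<lambda>j. loc j \<omega>) ` {j. j < M \<omega> \<and> aisle j \<omega> = i}" by auto
  then have "finite ?L" "?L \<noteq> {}" using True by auto
  moreover have "farthest_location M aisle loc i \<omega> = Max ?L"
    using True items_in_aisle_pos_iff[of M aisle i \<omega>] by (simp add: farthest_location_def)
  ultimately show ?thesis using True by auto
next
  case False
  then show ?thesis
    using items_in_aisle_pos_iff[of M aisle i \<omega>] by (auto simp: farthest_location_def)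
qed

lemma farthest_location_eq_0:
  "i \<notin> visited_set k M aisle \<omega> \<Longrightarrow> i \<in> {1..k} \<Longrightarrow> farthest_location M aisle loc i \<omega> = 0"
  by (simp add: visited_set_def farthest_location_def)

lemma measurable_farthest_location:
  assumes [measurable]: "M \<in> measurable N (count_space UNIV)"
    "\<And>j. aisle j \<in> measurable N (count_space UNIV)" "\<And>j. loc j \<in> borel_measurable N"
  shows "farthest_location M aisle loc i \<in> borel_measurable N"
proof (subst borel_measurable_iff_le, intro allI)
  fix z
  have "{\<omega> \<in> space N. farthest_location M aisle loc i \<omega> \<le> z} = {\<omega> \<in> space N.
      if \<exists>j. j < M \<omega> \<and> aisle j \<omega> = i then \<forall>j. j < M \<omega> \<longrightarrow> aisle j \<omega> = i \<longrightarrow> loc j \<omega> \<le> z else 0 \<le> z}"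
    unfolding farthest_location_le_iff by auto
  also have "\<dots> \<in> sets N" by measurable
  finally show "{\<omega> \<in> space N. farthest_location M aisle loc i \<omega> \<le> z} \<in> sets N" .
qed

text \<open>
  The aisle index is itself random; it takes countably many values, so measurability for each fixed
  aisle suffices.
\<close>

lemma measurable_farthest_location_last:
  assumes "M \<in> measurable N (count_space UNIV)"
    "\<And>j. aisle j \<in> measurable N (count_space UNIV)" "\<And>j. loc j \<in> borel_measurable N"
  shows "(\<lambda>\<omega>. farthest_location M aisle loc (last_aisle k M aisle \<omega>) \<omega>) \<in> borel_measurable N"
  by (rule measurable_compose_countable[OF measurable_farthest_location[OF assms]
        measurable_last_aisle[OF assms(1,2)]])

section \<open>All items in a given region\<close>

definition item_distribution :: "nat \<Rightarrow> (nat \<times> real) measure" where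
  "item_distribution k = measure_pmf (pmf_of_set {1..k}) \<Otimes>\<^sub>M uniform_measure lborel {0..1}"

lemma prob_space_uniform_01: "prob_space (uniform_measure lborel {0..1::real})"
  by (rule prob_space_uniform_measure) auto

lemma measure_item_distribution_Times:
  assumes "B \<in> sets borel"
  shows "measure (item_distribution k) (A \<times> B)
       = measure (pmf_of_set {1..k}) A * measure (uniform_measure lborel {0..1}) B"
proof -
  interpret U: prob_space "uniform_measure lborel {0..1::real}" by (rule prob_space_uniform_01)
  show ?thesis unfolding item_distribution_def
    using assms by (simp add: U.emeasure_pair_measure_Times measure_def enn2real_mult)
qed

lemma measure_uniform_01_atMost: "0 \<le> z \<Longrightarrow> z \<le> 1 \<Longrightarrow> measure (uniform_measure lborel {0..1}) {..z} = (z :: real)"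
proof -
  assume z: "0 \<le> z" "z \<le> 1"
  then have "{0..1} \<inter> {..z} = {0..z}" by auto
  with z show ?thesis by simp
qed

text \<open>
  This region contains all items exactly when only aisles in \<open>U \<union> {i}\<close> are visited and no item in aisle
  \<open>i\<close> lies beyond \<open>z\<close>.
\<close>

lemma measure_item_distribution_region:
  assumes k: "1 \<le> k" and U: "U \<subseteq> {1..k}" and i: "i \<in> {1..k} - U" and z: "0 \<le> z" "z \<le> 1"
  shows "measure (item_distribution k) (U \<times> UNIV \<union> {i} \<times> {..z}) = (real (card U) + z) / real k"
proof -
  interpret U: prob_space "uniform_measure lborel {0..1::real}" by (rule prob_space_uniform_01)
  interpret P: pair_prob_space "measure_pmf (pmf_of_set {1..k})" "uniform_measure lborel {0..1::real}" ..
  have "measure (item_distribution k) (U \<times> UNIV \<union> {i} \<times> {..z})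
      = measure (item_distribution k) (U \<times> UNIV) + measure (item_distribution k) ({i} \<times> {..z})"
    using i unfolding item_distribution_def
    by (intro P.finite_measure_Union) (auto intro!: pair_measureI)
  also have "\<dots> = real (card U) / real k + z / real k"
    using k i U z U.prob_space
    by (simp add: measure_item_distribution_Times measure_pmf_of_set measure_uniform_01_atMost
        Int_absorb1 del: measure_uniform_measure)
  finally show ?thesis by (simp add: add_divide_distrib)
qed

lemma measure_item_distribution_aisles:
  assumes k: "1 \<le> k" and U: "U \<subseteq> {1..k}"
  shows "measure (item_distribution k) (U \<times> UNIV) = real (card U) / real k"
proof -
  interpret U: prob_space "uniform_measure lborel {0..1::real}" by (rule prob_space_uniform_01)
  show ?thesis
    using k U U.prob_space
    by (simp add: measure_item_distribution_Times measure_pmf_of_set Int_absorb1 del: measure_uniform_measure)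
qed

lemma measure_item_distribution_support:
  assumes k: "1 \<le> k"
  shows "measure (item_distribution k) ({1..k} \<times> {0..1}) = 1"
  using k by (simp add: measure_item_distribution_Times measure_pmf_of_set)

locale warehouse = prob_space \<Omega> for \<Omega> :: "'w measure" +
  fixes k :: nat and M :: "'w \<Rightarrow> nat"
    and aisle :: "nat \<Rightarrow> 'w \<Rightarrow> nat" and loc :: "nat \<Rightarrow> 'w \<Rightarrow> real"
  assumes k: "1 \<le> k"
    and measurable_M [measurable]: "M \<in> measurable \<Omega> (count_space UNIV)"
    and M_square_integrable: "integrable \<Omega> (\<lambda>\<omega>. (real (M \<omega>))\<^sup>2)"
    and measurable_aisle [measurable]: "\<And>j. aisle j \<in> measurable \<Omega> (count_space UNIV)"
    and measurable_loc [measurable]: "\<And>j. loc j \<in> borel_measurable \<Omega>"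
    and uniform: "uniform_items \<Omega> k M aisle loc"
begin

abbreviation "visited \<equiv> visited_set k M aisle"
abbreviation "farthest \<equiv> farthest_location M aisle loc"

text \<open>
  Given the order size, the items are independent with a common law, so the conditional probability is a
  product of equal factors. Sizes of probability zero have no conditional law, and the empty order
  gives an empty product; these are treated directly.
\<close>

lemma prob_all_items_in_region:
  assumes R: "R \<in> sets (count_space UNIV \<Otimes>\<^sub>M borel)"
  shows "prob {\<omega> \<in> space \<Omega>. M \<omega> = n \<and> (\<forall>j<n. (aisle j \<omega>, loc j \<omega>) \<in> R)}
       = prob {\<omega> \<in> space \<Omega>. M \<omega> = n} * measure (item_distribution k) R ^ n"
proof -
  let ?Mn = "{\<omega> \<in> space \<Omega>. M \<omega> = n}"
  let ?A = "{\<omega> \<in> space \<Omega>. \<forall>j<n. (aisle j \<omega>, loc j \<omega>) \<in> R}"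
  have [measurable]: "(\<lambda>\<omega>. (aisle j \<omega>, loc j \<omega>)) \<in> measurable \<Omega> (count_space UNIV \<Otimes>\<^sub>M borel)" for j
    by measurable
  note [measurable] = R
  have Int: "?Mn \<inter> ?A = {\<omega> \<in> space \<Omega>. M \<omega> = n \<and> (\<forall>j<n. (aisle j \<omega>, loc j \<omega>) \<in> R)}" by auto
  show ?thesis
  proof (cases "prob ?Mn = 0 \<or> n = 0")
    case True
    moreover have "prob (?Mn \<inter> ?A) \<le> prob ?Mn" by (intro finite_measure_mono) auto
    ultimately show ?thesis unfolding Int using measure_nonneg[of \<Omega>] by (auto simp: antisym)
  next
    case False
    then have pos: "prob ?Mn > 0" and n: "0 < n" by (auto simp: zero_less_measure_iff)
    then have em: "emeasure \<Omega> ?Mn \<noteq> 0" "emeasure \<Omega> ?Mn \<noteq> \<infinity>" by (auto simp: emeasure_eq_measure)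
    let ?G = "given_size \<Omega> M n"
    interpret G: prob_space ?G
      unfolding given_size_def by (rule prob_space_uniform_measure[OF em])
    have sp: "space ?G = space \<Omega>" "sets ?G = sets \<Omega>" by (auto simp: given_size_def)
    have indep: "G.indep_vars (\<lambda>_. count_space UNIV \<Otimes>\<^sub>M borel) (\<lambda>j \<omega>. (aisle j \<omega>, loc j \<omega>)) {..<n}"
      and distr: "\<And>j. j < n \<Longrightarrow> distr ?G (count_space UNIV \<Otimes>\<^sub>M borel) (\<lambda>\<omega>. (aisle j \<omega>, loc j \<omega>))
        = item_distribution k"
      using uniform pos unfolding uniform_items_def item_distribution_def by auto
    have one: "measure ?G ((\<lambda>\<omega>. (aisle j \<omega>, loc j \<omega>)) -` R \<inter> space ?G) = measure (item_distribution k) R"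
      if "j < n" for j
      unfolding distr[OF that, symmetric] using R
      by (subst measure_distr) (auto simp: measurable_cong_sets[OF sp(2) refl])
    have "measure ?G ?A = measure ?G (\<Inter>j\<in>{..<n}. (\<lambda>\<omega>. (aisle j \<omega>, loc j \<omega>)) -` R \<inter> space ?G)"
      using n by (intro arg_cong[where f = "measure ?G"]) (auto simp: sp)
    also have "\<dots> = (\<Prod>j\<in>{..<n}. measure (item_distribution k) R)"
      using n R one by (subst G.indep_varsD_finite[OF indep]) auto
    finally have "measure ?G ?A = measure (item_distribution k) R ^ n" by simp
    moreover have "measure ?G ?A = prob (?Mn \<inter> ?A) / prob ?Mn"
      unfolding given_size_def using em by (intro measure_uniform_measure) auto
    ultimately show ?thesis unfolding Int using pos by (simp add: field_simps)
  qed
qed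

text \<open>
  Each order size \<open>n\<close> contributes the power \<open>\<rho>\<^bsup>n\<^esup>\<close> of the measure \<open>\<rho>\<close> of the region, so averaging over
  the order size evaluates its weighted generating function at \<open>\<rho>\<close>.
\<close>

lemma integral_all_items_in_region:
  fixes h :: "nat \<Rightarrow> real"
  assumes R: "R \<in> sets (count_space UNIV \<Otimes>\<^sub>M borel)" and h: "integrable \<Omega> (\<lambda>\<omega>. h (M \<omega>))"
  shows "(\<integral>\<omega>. h (M \<omega>) * of_bool (\<forall>j<M \<omega>. (aisle j \<omega>, loc j \<omega>) \<in> R) \<partial>\<Omega>)
       = (\<integral>\<omega>. h (M \<omega>) * measure (item_distribution k) R ^ M \<omega> \<partial>\<Omega>)"
proof (rule integral_eq_by_size[OF measurable_M])
  interpret D: prob_space "item_distribution k"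
    unfolding item_distribution_def
    by (intro prob_space_pair prob_space_uniform_01 prob_space_measure_pmf)
  note [measurable] = R
  let ?\<rho> = "measure (item_distribution k) R"
  have [measurable]: "(\<lambda>\<omega>. (aisle j \<omega>, loc j \<omega>)) \<in> measurable \<Omega> (count_space UNIV \<Otimes>\<^sub>M borel)" for j
    by measurable
  have meas: "Measurable.pred \<Omega> (\<lambda>\<omega>. \<forall>j. j < M \<omega> \<longrightarrow> (aisle j \<omega>, loc j \<omega>) \<in> R)" by measurable
  show "integrable \<Omega> (\<lambda>\<omega>. h (M \<omega>) * of_bool (\<forall>j<M \<omega>. (aisle j \<omega>, loc j \<omega>) \<in> R))"
    using meas by (intro Bochner_Integration.integrable_bound[OF h]) auto
  show "integrable \<Omega> (\<lambda>\<omega>. h (M \<omega>) * ?\<rho> ^ M \<omega>)"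
    by (intro Bochner_Integration.integrable_bound[OF h])
       (auto simp: abs_mult power_abs intro!: mult_left_le power_le_one)
  fix n
  let ?Mn = "{\<omega> \<in> space \<Omega>. M \<omega> = n}"
  let ?MA = "{\<omega> \<in> space \<Omega>. M \<omega> = n \<and> (\<forall>j<n. (aisle j \<omega>, loc j \<omega>) \<in> R)}"
  have "(\<integral>\<omega>. of_bool (M \<omega> = n) * (h (M \<omega>) * of_bool (\<forall>j<M \<omega>. (aisle j \<omega>, loc j \<omega>) \<in> R)) \<partial>\<Omega>)
      = (\<integral>\<omega>. h n * indicator ?MA \<omega> \<partial>\<Omega>)"
    by (intro Bochner_Integration.integral_cong) (auto simp: indicator_def)
  also have "\<dots> = (\<integral>\<omega>. (h n * ?\<rho> ^ n) * indicator ?Mn \<omega> \<partial>\<Omega>)"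
    using prob_all_items_in_region[OF R, of n] by (simp add: Int_def conj_commute cong: conj_cong)
  also have "\<dots> = (\<integral>\<omega>. of_bool (M \<omega> = n) * (h (M \<omega>) * ?\<rho> ^ M \<omega>) \<partial>\<Omega>)"
    by (intro Bochner_Integration.integral_cong) (auto simp: indicator_def)
  finally show "(\<integral>\<omega>. of_bool (M \<omega> = n) * (h (M \<omega>) * of_bool (\<forall>j<M \<omega>. (aisle j \<omega>, loc j \<omega>) \<in> R)) \<partial>\<Omega>)
      = (\<integral>\<omega>. of_bool (M \<omega> = n) * (h (M \<omega>) * ?\<rho> ^ M \<omega>) \<partial>\<Omega>)" .
qed

text \<open>
  The support of the item law is a region of measure one, so almost surely all items lie in it.
\<close>

lemma AE_items_in_range:
  "AE \<omega> in \<Omega>. \<forall>j<M \<omega>. aisle j \<omega> \<in> {1..k} \<and> 0 \<le> loc j \<omega> \<and> loc j \<omega> \<le> 1"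
proof -
  let ?R = "{1..k} \<times> {0..1::real}"
  have R: "?R \<in> sets (count_space UNIV \<Otimes>\<^sub>M borel)" by (intro pair_measureI) auto
  let ?A = "{\<omega> \<in> space \<Omega>. \<forall>j<M \<omega>. (aisle j \<omega>, loc j \<omega>) \<in> ?R}"
  have "?A = {\<omega> \<in> space \<Omega>. \<forall>j. j < M \<omega> \<longrightarrow> aisle j \<omega> \<in> {1..k} \<and> loc j \<omega> \<in> {0..1}}"
    by auto
  also have "\<dots> \<in> sets \<Omega>"
  proof -
    have [measurable]: "Measurable.pred \<Omega> (\<lambda>\<omega>. aisle j \<omega> \<in> {1..k})" for j
      by (rule measurable_compose[OF measurable_aisle]) simp
    have [measurable]: "Measurable.pred \<Omega> (\<lambda>\<omega>. loc j \<omega> \<in> {0..1})" for j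
      by measurable
    show ?thesis by measurable
  qed
  finally have [measurable]: "?A \<in> sets \<Omega>" .
  have "prob ?A = (\<integral>\<omega>. indicator ?A \<omega> \<partial>\<Omega>)"
    by (simp add: Int_absorb1)
  also have "\<dots> = (\<integral>\<omega>. 1 * of_bool (\<forall>j<M \<omega>. (aisle j \<omega>, loc j \<omega>) \<in> ?R) \<partial>\<Omega>)"
    by (intro Bochner_Integration.integral_cong) (auto simp: indicator_def)
  also have "\<dots> = (\<integral>\<omega>. 1 * measure (item_distribution k) ?R ^ M \<omega> \<partial>\<Omega>)"
    by (rule integral_all_items_in_region[OF R]) simp
  also have "\<dots> = 1"
    using measure_item_distribution_support[OF k] by (simp add: prob_space)
  finally have "AE \<omega> in \<Omega>. \<omega> \<in> ?A" by (subst prob_eq_1[symmetric]) auto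
  then show ?thesis by eventually_elim auto
qed

text \<open>
  The weight \<open>h\<close> is \<open>1\<close> for the plain moments and the identity for the moments that involve the order size.
\<close>

definition size_gf :: "(nat \<Rightarrow> real) \<Rightarrow> real \<Rightarrow> real" where
  "size_gf h x = (\<integral>\<omega>. h (M \<omega>) * x ^ M \<omega> \<partial>\<Omega>)"

lemma size_gf_1: "size_gf (\<lambda>_. 1) x = pgf \<Omega> M x"
  by (simp add: size_gf_def pgf_def)

lemma size_gf_real: "\<bar>x\<bar> \<le> 1 \<Longrightarrow> size_gf real x = x * pgf_deriv \<Omega> M x"
  using expectation_size_power_eq_pgf_deriv[OF measurable_M M_square_integrable, of x] by (simp add: size_gf_def)

lemma AE_visited_subset_iff:
  assumes "U \<subseteq> {1..k}"
  shows "AE \<omega> in \<Omega>. visited \<omega> \<subseteq> U \<longleftrightarrow> (\<forall>j<M \<omega>. aisle j \<omega> \<in> U)"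
  using AE_items_in_range
proof eventually_elim
  case (elim \<omega>)
  then show ?case by (force simp: visited_set_def items_in_aisle_pos_iff)
qed

lemma integral_visited_subset:
  assumes U: "U \<subseteq> {1..k}" and h: "integrable \<Omega> (\<lambda>\<omega>. h (M \<omega>))"
  shows "(\<integral>\<omega>. h (M \<omega>) * of_bool (visited \<omega> \<subseteq> U) \<partial>\<Omega>) = size_gf h (real (card U) / real k)"
proof -
  have [measurable]: "(\<lambda>\<omega>. of_bool (visited \<omega> \<subseteq> U)) \<in> borel_measurable \<Omega>"
    by (rule measurable_visited_set_fun) auto
  have R: "U \<times> (UNIV :: real set) \<in> sets (count_space UNIV \<Otimes>\<^sub>M borel)" by (intro pair_measureI) auto
  have [measurable]: "Measurable.pred \<Omega> (\<lambda>\<omega>. \<forall>j<M \<omega>. aisle j \<omega> \<in> U)"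
  proof -
    have "Measurable.pred \<Omega> (\<lambda>\<omega>. \<forall>j. j < M \<omega> \<longrightarrow> aisle j \<omega> \<in> U)" by measurable
    then show ?thesis by simp
  qed
  have "(\<integral>\<omega>. h (M \<omega>) * of_bool (visited \<omega> \<subseteq> U) \<partial>\<Omega>)
      = (\<integral>\<omega>. h (M \<omega>) * of_bool (\<forall>j<M \<omega>. aisle j \<omega> \<in> U) \<partial>\<Omega>)"
    using AE_visited_subset_iff[OF U] by (intro integral_cong_AE) auto
  also have "\<dots> = size_gf h (real (card U) / real k)"
    using integral_all_items_in_region[OF R h] measure_item_distribution_aisles[OF k U]
    by (simp add: size_gf_def)
  finally show ?thesis .
qed

lemma AE_farthest_bounds:
  "AE \<omega> in \<Omega>. \<forall>i. 0 \<le> farthest i \<omega> \<and> farthest i \<omega> \<le> 1"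
  using AE_items_in_range
proof eventually_elim
  case (elim \<omega>)
  have "\<not> farthest i \<omega> < 0" for i
  proof
    assume neg: "farthest i \<omega> < 0"
    \<comment> \<open>A negative maximum would bound the nonnegative location of some item in this aisle.\<close>
    from order_refl[of "farthest i \<omega>"] neg elim show False
      unfolding farthest_location_le_iff by (auto split: if_splits) (smt (verit))
  qed
  moreover have "farthest i \<omega> \<le> 1" for i
    using elim by (simp add: farthest_location_le_iff)
  ultimately show ?case by (meson not_le)
qed

lemma integral_visited_subset_farthest_le:
  assumes U: "U \<subseteq> {1..k}" and i: "i \<in> {1..k} - U" and z: "0 \<le> z" "z \<le> 1"
    and h: "integrable \<Omega> (\<lambda>\<omega>. h (M \<omega>))"
  shows "(\<integral>\<omega>. h (M \<omega>) * (of_bool (visited \<omega> \<subseteq> insert i U) * of_bool (farthest i \<omega> \<le> z)) \<partial>\<Omega>)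
       = size_gf h ((real (card U) + z) / real k)"
proof -
  note [measurable] = measurable_farthest_location[OF measurable_M measurable_aisle measurable_loc]
  have [measurable]: "(\<lambda>\<omega>. of_bool (visited \<omega> \<subseteq> insert i U)) \<in> borel_measurable \<Omega>"
    by (rule measurable_visited_set_fun) auto
  let ?R = "U \<times> UNIV \<union> {i} \<times> {..z}"
  have R: "?R \<in> sets (count_space UNIV \<Otimes>\<^sub>M borel)" by (intro sets.Un pair_measureI) auto
  have [measurable]: "Measurable.pred \<Omega> (\<lambda>\<omega>. \<forall>j<M \<omega>. (aisle j \<omega>, loc j \<omega>) \<in> ?R)"
  proof -
    have "Measurable.pred \<Omega> (\<lambda>\<omega>. \<forall>j. j < M \<omega> \<longrightarrow> aisle j \<omega> \<in> U \<or> aisle j \<omega> = i \<and> loc j \<omega> \<le> z)" by measurable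
    then show ?thesis by simp
  qed
  have sub: "insert i U \<subseteq> {1..k}" using U i by auto
  have "AE \<omega> in \<Omega>. visited \<omega> \<subseteq> insert i U \<and> farthest i \<omega> \<le> z \<longleftrightarrow> (\<forall>j<M \<omega>. (aisle j \<omega>, loc j \<omega>) \<in> ?R)"
    using AE_visited_subset_iff[OF sub]
  proof eventually_elim
    case (elim \<omega>)
    then show ?case using i z by (auto simp: farthest_location_le_iff)
  qed
  then have "(\<integral>\<omega>. h (M \<omega>) * (of_bool (visited \<omega> \<subseteq> insert i U) * of_bool (farthest i \<omega> \<le> z)) \<partial>\<Omega>)
      = (\<integral>\<omega>. h (M \<omega>) * of_bool (\<forall>j<M \<omega>. (aisle j \<omega>, loc j \<omega>) \<in> ?R) \<partial>\<Omega>)"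
    by (intro integral_cong_AE) (measurable, auto simp flip: of_bool_conj)
  also have "\<dots> = size_gf h ((real (card U) + z) / real k)"
    using integral_all_items_in_region[OF R h] measure_item_distribution_region[OF k U i z]
    by (simp add: size_gf_def)
  finally show ?thesis .
qed

end

section \<open>Moments of the set of visited aisles\<close>

context warehouse
begin

abbreviation "gf_at h c \<equiv> size_gf h (real c / real k)"

lemma measurable_visited_fun [measurable]: "(\<lambda>\<omega>. \<phi> (visited \<omega>) :: real) \<in> borel_measurable \<Omega>"
  by (rule measurable_visited_set_fun) auto

lemma visited_fun_bound: "\<bar>\<phi> (visited \<omega>) :: real\<bar> \<le> (\<Sum>S\<in>Pow {1..k}. \<bar>\<phi> S\<bar>)"
  by (intro member_le_sum[where f = "\<lambda>S. \<bar>\<phi> S\<bar>"] PowI visited_set_subset) auto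

text \<open>
  Only finitely many sets can be visited, so every \<open>\<phi>\<close> is bounded on them and this is linear in \<open>\<phi>\<close> as
  soon as \<open>h (M)\<close> is integrable.
\<close>

definition visited_moment :: "(nat \<Rightarrow> real) \<Rightarrow> (nat set \<Rightarrow> real) \<Rightarrow> real" where
  "visited_moment h \<phi> = (\<integral>\<omega>. h (M \<omega>) * \<phi> (visited \<omega>) \<partial>\<Omega>)"

lemma visited_moment_cong:
  assumes "\<And>S. S \<subseteq> {1..k} \<Longrightarrow> \<phi> S = \<psi> S"
  shows "visited_moment h \<phi> = visited_moment h \<psi>"
  unfolding visited_moment_def
  by (intro Bochner_Integration.integral_cong refl arg_cong2[where f = "(*)"] assms visited_set_subset)

context
  fixes h :: "nat \<Rightarrow> real"
  assumes h: "integrable \<Omega> (\<lambda>\<omega>. h (M \<omega>))"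
begin

lemma integrable_visited_fun: "integrable \<Omega> (\<lambda>\<omega>. h (M \<omega>) * \<phi> (visited \<omega>))"
proof (rule Bochner_Integration.integrable_bound)
  let ?B = "\<Sum>S\<in>Pow {1..k}. \<bar>\<phi> S\<bar>"
  show "integrable \<Omega> (\<lambda>\<omega>. h (M \<omega>) * ?B)" using h by simp
  have "0 \<le> ?B" by (intro sum_nonneg) auto
  then show "AE \<omega> in \<Omega>. norm (h (M \<omega>) * \<phi> (visited \<omega>)) \<le> norm (h (M \<omega>) * ?B)"
    using visited_fun_bound[of \<phi>] by (auto simp: abs_mult intro!: mult_left_mono)
qed auto

lemma visited_moment_diff: "visited_moment h (\<lambda>S. \<phi> S - \<psi> S) = visited_moment h \<phi> - visited_moment h \<psi>"
  unfolding visited_moment_def right_diff_distrib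
  by (intro Bochner_Integration.integral_diff integrable_visited_fun)

lemma visited_moment_cmult: "visited_moment h (\<lambda>S. c * \<phi> S) = c * visited_moment h \<phi>"
  unfolding visited_moment_def by (simp add: mult.left_commute)

lemma visited_moment_sum: "visited_moment h (\<lambda>S. \<Sum>i\<in>A. \<phi> i S) = (\<Sum>i\<in>A. visited_moment h (\<phi> i))"
  unfolding visited_moment_def sum_distrib_left
  by (intro Bochner_Integration.integral_sum integrable_visited_fun)

lemma visited_moment_subset:
  "U \<subseteq> {1..k} \<Longrightarrow> visited_moment h (\<lambda>S. of_bool (S \<subseteq> U)) = gf_at h (card U)"
  unfolding visited_moment_def by (rule integral_visited_subset[OF _ h])

text \<open>
  Replaces a factor counting visited aisles by restrictions of the visited set, with an arbitrary further
  factor \<open>\<phi>\<close>; the same step then yields the moments of \<open>J\<close>, \<open>J\<^sup>2\<close> and \<open>I J\<close>.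
\<close>

lemma visited_moment_card_times:
  assumes C: "C \<subseteq> {1..k}"
  shows "visited_moment h (\<lambda>S. \<phi> S * (real (card S) * of_bool (S \<subseteq> C)))
       = real (card C) * visited_moment h (\<lambda>S. \<phi> S * of_bool (S \<subseteq> C))
       - (\<Sum>i\<in>C. visited_moment h (\<lambda>S. \<phi> S * of_bool (S \<subseteq> C - {i})))"
proof -
  have "finite C" using C finite_subset by blast
  then have "visited_moment h (\<lambda>S. \<phi> S * (real (card S) * of_bool (S \<subseteq> C)))
      = visited_moment h (\<lambda>S. real (card C) * (\<phi> S * of_bool (S \<subseteq> C)) - (\<Sum>i\<in>C. \<phi> S * of_bool (S \<subseteq> C - {i})))"
    unfolding card_eq_sum_avoided[OF \<open>finite C\<close>] right_diff_distrib sum_distrib_left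
    by (simp only: mult.left_commute)
  then show ?thesis by (simp only: visited_moment_diff visited_moment_cmult visited_moment_sum)
qed

text \<open>
  The analogous step for the last aisle: \<open>f\<close> is telescoped over the thresholds \<open>r\<close> that the last aisle
  does not exceed, and not exceeding \<open>r\<close> means that the visited set lies in \<open>{1..r}\<close>.
\<close>

lemma visited_moment_last_times:
  "visited_moment h (\<lambda>S. \<phi> S * f (Max (insert 0 S)))
   = f k * visited_moment h \<phi> - (\<Sum>r<k. (f (Suc r) - f r) * visited_moment h (\<lambda>S. \<phi> S * of_bool (S \<subseteq> {1..r})))"
proof -
  have "\<phi> S * f (Max (insert 0 S)) = f k * \<phi> S - (\<Sum>r<k. (f (Suc r) - f r) * (\<phi> S * of_bool (S \<subseteq> {1..r})))"
    if S: "S \<subseteq> {1..k}" for S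
  proof -
    have fin: "finite S" using S finite_subset by blast
    have le: "Max (insert 0 S) \<le> r \<longleftrightarrow> S \<subseteq> {1..r}" for r
      using S fin by (auto simp: subset_iff)
    have "f k - f (Max (insert 0 S)) = (\<Sum>r<k. (f (Suc r) - f r) * of_bool (S \<subseteq> {1..r}))"
      using sum_of_bool_less_telescope[of "Max (insert 0 S)" k f] le[of k] S by (simp only: le)
    then have "f (Max (insert 0 S)) = f k - (\<Sum>r<k. (f (Suc r) - f r) * of_bool (S \<subseteq> {1..r}))"
      by linarith
    then show ?thesis
      by (simp only: right_diff_distrib sum_distrib_left) (simp add: mult_ac)
  qed
  then have "visited_moment h (\<lambda>S. \<phi> S * f (Max (insert 0 S)))
      = visited_moment h (\<lambda>S. f k * \<phi> S - (\<Sum>r<k. (f (Suc r) - f r) * (\<phi> S * of_bool (S \<subseteq> {1..r}))))"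
    by (rule visited_moment_cong)
  then show ?thesis by (simp only: visited_moment_diff visited_moment_cmult visited_moment_sum)
qed

text \<open>
  For \<open>S \<subseteq> C\<close> this integrates the parity expansion; otherwise every indicator on both sides of it is zero.
\<close>

lemma visited_moment_odd_subset:
  assumes C: "C \<subseteq> {1..k}"
  shows "visited_moment h (\<lambda>S. of_bool (odd (card S)) * of_bool (S \<subseteq> C)) = odd_sum (gf_at h) (card C)"
proof -
  have fin: "finite C" using C finite_subset by blast
  have "visited_moment h (\<lambda>S. of_bool (odd (card S)) * of_bool (S \<subseteq> C))
      = visited_moment h (\<lambda>S. \<Sum>U\<in>Pow C. parity_coeff (card C) (card U) * of_bool (S \<subseteq> U))"
  proof (rule visited_moment_cong)
    fix S
    show "of_bool (odd (card S)) * of_bool (S \<subseteq> C) = (\<Sum>U\<in>Pow C. parity_coeff (card C) (card U) * of_bool (S \<subseteq> U))"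
    proof (cases "S \<subseteq> C")
      case True
      then show ?thesis using odd_card_expansion[OF fin True] by simp
    next
      case False
      then have "\<not> S \<subseteq> U" if "U \<in> Pow C" for U using that by blast
      then show ?thesis using False by simp
    qed
  qed
  also have "\<dots> = (\<Sum>U\<in>Pow C. parity_coeff (card C) (card U) * gf_at h (card U))"
    unfolding visited_moment_sum visited_moment_cmult
    using C by (intro sum.cong) (auto simp: visited_moment_subset)
  also have "\<dots> = odd_sum (gf_at h) (card C)"
    using fin unfolding odd_sum_eq_parity_coeff
    by (rule sum_subsets_by_card[where f = "\<lambda>r. parity_coeff (card C) r * gf_at h r"])
  finally show ?thesis .
qed

lemma visited_moment_card_subset:
  assumes C: "C \<subseteq> {1..k}"
  shows "visited_moment h (\<lambda>S. real (card S) * of_bool (S \<subseteq> C))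
       = real (card C) * (gf_at h (card C) - gf_at h (card C - 1))"
proof -
  have "visited_moment h (\<lambda>S. of_bool (S \<subseteq> C - {i})) = gf_at h (card C - 1)" if "i \<in> C" for i
    using C that by (subst visited_moment_subset) auto
  then show ?thesis
    using visited_moment_card_times[OF C, of "\<lambda>_. 1"] visited_moment_subset[OF C]
    by (simp add: right_diff_distrib)
qed

lemma visited_moment_all: "visited_moment h (\<lambda>S. \<phi> S * of_bool (S \<subseteq> {1..k})) = visited_moment h \<phi>"
  by (rule visited_moment_cong) simp

lemma visited_moment_card:
  "visited_moment h (\<lambda>S. real (card S)) = real k * (gf_at h k - gf_at h (k - 1))"
  using visited_moment_card_subset[OF subset_refl]
  by (simp only: visited_moment_all card_atLeastAtMost diff_Suc_1)

lemma visited_moment_card_square: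
  "visited_moment h (\<lambda>S. (real (card S))\<^sup>2)
   = real k * (real k * (gf_at h k - gf_at h (k - 1)) - real (k - 1) * (gf_at h (k - 1) - gf_at h (k - 1 - 1)))"
proof -
  have "visited_moment h (\<lambda>S. real (card S) * of_bool (S \<subseteq> {1..k} - {i}))
      = real (k - 1) * (gf_at h (k - 1) - gf_at h (k - 1 - 1))" if "i \<in> {1..k}" for i
  proof -
    have "card ({1..k} - {i}) = k - 1" using that by simp
    then show ?thesis using visited_moment_card_subset[of "{1..k} - {i}"] by (simp only: Diff_subset)
  qed
  then have "(\<Sum>i\<in>{1..k}. visited_moment h (\<lambda>S. real (card S) * of_bool (S \<subseteq> {1..k} - {i})))
      = (\<Sum>i\<in>{1..k}. real (k - 1) * (gf_at h (k - 1) - gf_at h (k - 1 - 1)))"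
    by (rule sum.cong[OF refl])
  also have "\<dots> = real k * (real (k - 1) * (gf_at h (k - 1) - gf_at h (k - 1 - 1)))"
    by (simp only: sum_constant card_atLeastAtMost diff_Suc_1)
  finally show ?thesis
    using visited_moment_card_times[of "{1..k}" "\<lambda>S. real (card S)"]
    by (simp only: mult.assoc[symmetric] visited_moment_all visited_moment_card subset_refl
        card_atLeastAtMost diff_Suc_1 power2_eq_square right_diff_distrib)
qed

lemma visited_moment_odd: "visited_moment h (\<lambda>S. of_bool (odd (card S))) = odd_sum (gf_at h) k"
  using visited_moment_odd_subset[of "{1..k}"] by (simp only: visited_moment_all) simp

lemma visited_moment_odd_card:
  "visited_moment h (\<lambda>S. of_bool (odd (card S)) * real (card S))
   = real k * (odd_sum (gf_at h) k - odd_sum (gf_at h) (k - 1))"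
proof -
  have "visited_moment h (\<lambda>S. of_bool (odd (card S)) * of_bool (S \<subseteq> {1..k} - {i})) = odd_sum (gf_at h) (k - 1)"
    if "i \<in> {1..k}" for i
    using that k by (subst visited_moment_odd_subset) auto
  then have "(\<Sum>i\<in>{1..k}. visited_moment h (\<lambda>S. of_bool (odd (card S)) * of_bool (S \<subseteq> {1..k} - {i})))
      = real k * odd_sum (gf_at h) (k - 1)"
    by simp
  then show ?thesis
    using visited_moment_card_times[of "{1..k}" "\<lambda>S. of_bool (odd (card S))"]
    by (simp only: mult.assoc[symmetric] visited_moment_all visited_moment_odd)
       (simp add: right_diff_distrib)
qed

lemma visited_moment_last:
  "visited_moment h (\<lambda>S. real (Max (insert 0 S))) = real k * gf_at h k - (\<Sum>r<k. gf_at h r)"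
proof -
  have "visited_moment h (\<lambda>S. of_bool (S \<subseteq> {1..r})) = gf_at h r" if "r < k" for r
    using that by (subst visited_moment_subset) auto
  then show ?thesis
    using visited_moment_last_times[of "\<lambda>_. 1" real] visited_moment_subset[of "{1..k}"]
      visited_moment_all[of "\<lambda>_. 1"]
    by simp
qed

lemma visited_moment_last_square:
  "visited_moment h (\<lambda>S. (real (Max (insert 0 S)))\<^sup>2)
   = (real k)\<^sup>2 * gf_at h k - (\<Sum>r<k. (2 * real r + 1) * gf_at h r)"
proof -
  have "visited_moment h (\<lambda>S. of_bool (S \<subseteq> {1..r})) = gf_at h r" if "r < k" for r
    using that by (subst visited_moment_subset) auto
  moreover have "(real (Suc r))\<^sup>2 - (real r)\<^sup>2 = 2 * real r + 1" for r
    by (simp add: power2_eq_square algebra_simps)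
  ultimately show ?thesis
    using visited_moment_last_times[of "\<lambda>_. 1" "\<lambda>r. (real r)\<^sup>2"] visited_moment_subset[of "{1..k}"]
      visited_moment_all[of "\<lambda>_. 1"]
    by (simp del: of_nat_Suc)
qed

lemma visited_moment_last_card:
  "visited_moment h (\<lambda>S. real (Max (insert 0 S)) * real (card S))
   = (real k)\<^sup>2 * gf_at h k - real k * (real k + 1) * gf_at h (k - 1) + (\<Sum>j = 1..k. gf_at h (j - 1))"
proof -
  have sub: "visited_moment h (\<lambda>S. real (card S) * of_bool (S \<subseteq> {1..r})) = real r * (gf_at h r - gf_at h (r - 1))"
    if "r < k" for r
    using that by (subst visited_moment_card_subset) auto
  have "(\<Sum>r<k. visited_moment h (\<lambda>S. real (card S) * of_bool (S \<subseteq> {1..r})))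
      = (\<Sum>r<k. real r * (gf_at h r - gf_at h (r - 1)))"
    by (intro sum.cong refl sub) simp
  also have "\<dots> = (\<Sum>r = 1..k - 1. real r * (gf_at h r - gf_at h (r - 1)))"
    by (rule sum.mono_neutral_right) (auto simp: not_le)
  also have "\<dots> = real (k - 1) * gf_at h (k - 1) - (\<Sum>r<k - 1. gf_at h r)"
    by (rule summation_by_parts[symmetric])
  also have "\<dots> = real k * gf_at h (k - 1) - (\<Sum>r<k. gf_at h r)"
    using k by (cases k) (auto simp: algebra_simps)
  also have "(\<Sum>r<k. gf_at h r) = (\<Sum>j = 1..k. gf_at h (j - 1))"
    by (rule sum.reindex_bij_witness[where i = "\<lambda>j. j - 1" and j = Suc]) auto
  finally have "(\<Sum>r<k. visited_moment h (\<lambda>S. real (card S) * of_bool (S \<subseteq> {1..r})))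
      = real k * gf_at h (k - 1) - (\<Sum>j = 1..k. gf_at h (j - 1))" .
  then show ?thesis
    using visited_moment_last_times[of "\<lambda>S. real (card S)" real]
    by (simp add: visited_moment_card mult.commute algebra_simps power2_eq_square)
qed

lemma visited_moment_odd_last:
  "visited_moment h (\<lambda>S. of_bool (odd (card S)) * real (Max (insert 0 S)))
   = (\<Sum>s = 1..k. real s * (odd_sum (gf_at h) s - odd_sum (gf_at h) (s - 1)))"
proof -
  have "visited_moment h (\<lambda>S. of_bool (odd (card S)) * of_bool (S \<subseteq> {1..r})) = odd_sum (gf_at h) r"
    if "r < k" for r
    using that by (subst visited_moment_odd_subset) auto
  then show ?thesis
    using visited_moment_last_times[of "\<lambda>S. of_bool (odd (card S))" real]
    by (simp add: visited_moment_odd summation_by_parts)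
qed

end

end

section \<open>The farthest item in the last visited aisle\<close>

lemma integral_layer_cake_power:
  fixes a :: real
  assumes "0 \<le> a" "a \<le> 1"
  shows "(\<integral>z. indicator {0..1} z * (real (Suc q) * z ^ q) * of_bool (a \<le> z) \<partial>lborel) = 1 - a ^ Suc q"
proof -
  have "(\<integral>z. indicator {0..1} z * (real (Suc q) * z ^ q) * of_bool (a \<le> z) \<partial>lborel)
      = (\<integral>z. real (Suc q) * (z ^ q * indicator {a..1} z) \<partial>lborel)"
    using assms by (intro Bochner_Integration.integral_cong) (auto simp: indicator_def)
  also have "\<dots> = real (Suc q) * ((1 - a ^ Suc q) / real (Suc q))"
    using integral_power[OF assms(2), of q] by (simp only: integral_mult_right_zero power_one)
  finally show ?thesis by simp
qed

context warehouse
begin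

text \<open>
  Minus the moment of order \<open>q + 1\<close> of the farthest location in aisle \<open>i\<close>, weighted by \<open>h (M)\<close> and
  restricted to the event that only \<open>i\<close> and \<open>r\<close> other given aisles may be visited. For \<open>h = 1\<close> and
  \<open>q = 0\<close> it is the quantity \<open>F r\<close> of the theorem. The order is shifted by one so that the density
  \<open>(q + 1) z\<^bsup>q\<^esup>\<close> of the layer cake formula needs no case distinction.
\<close>

definition gap :: "(nat \<Rightarrow> real) \<Rightarrow> nat \<Rightarrow> nat \<Rightarrow> real" where
  "gap h q r = integral {0..1} (\<lambda>z. real (Suc q) * z ^ q * size_gf h ((z + real r) / real k))
     - size_gf h ((real r + 1) / real k)"

lemma measurable_farthest [measurable]: "farthest i \<in> borel_measurable \<Omega>"
  by (rule measurable_farthest_location) auto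

context
  fixes h :: "nat \<Rightarrow> real"
  assumes h: "integrable \<Omega> (\<lambda>\<omega>. h (M \<omega>))"
begin

lemma integrable_visited_farthest: "integrable \<Omega> (\<lambda>\<omega>. h (M \<omega>) * (\<phi> (visited \<omega>) * farthest i \<omega> ^ q))"
proof (rule Bochner_Integration.integrable_bound[OF integrable_visited_fun[OF h, of \<phi>]])
  show "AE \<omega> in \<Omega>. norm (h (M \<omega>) * (\<phi> (visited \<omega>) * farthest i \<omega> ^ q)) \<le> norm (h (M \<omega>) * \<phi> (visited \<omega>))"
    using AE_farthest_bounds
  proof eventually_elim
    case (elim \<omega>)
    then have "\<bar>farthest i \<omega> ^ q\<bar> \<le> 1" by (simp add: power_abs power_le_one)
    then show ?case
      using mult_left_le[of "\<bar>farthest i \<omega> ^ q\<bar>" "\<bar>h (M \<omega>)\<bar> * \<bar>\<phi> (visited \<omega>)\<bar>"]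
      by (simp add: abs_mult mult.assoc)
  qed
qed measurable

text \<open>
  Writes \<open>1 - a\<^bsup>q + 1\<^esup>\<close> as an integral over thresholds \<open>z\<close> and exchanges it with the expectation; for
  fixed \<open>z\<close> the event is that all items lie in a region of measure \<open>(|U| + z) / k\<close>.
\<close>

lemma integral_farthest_power:
  assumes U: "U \<subseteq> {1..k}" and i: "i \<in> {1..k} - U"
  shows "(\<integral>\<omega>. h (M \<omega>) * (of_bool (visited \<omega> \<subseteq> insert i U) * farthest i \<omega> ^ Suc q) \<partial>\<Omega>) = - gap h q (card U)"
proof -
  interpret pair_sigma_finite \<Omega> lborel
    by unfold_locales
  let ?w = "\<lambda>z::real. indicator {0..1} z * (real (Suc q) * z ^ q)"
  let ?B = "\<lambda>\<omega>. of_bool (visited \<omega> \<subseteq> insert i U) :: real"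
  let ?f = "\<lambda>\<omega> z. ?w z * (h (M \<omega>) * (?B \<omega> * of_bool (farthest i \<omega> \<le> z)))"
  have [measurable]: "?B \<in> borel_measurable \<Omega>" by (rule measurable_visited_fun)
  have U': "insert i U \<subseteq> {1..k}" and fin: "finite U" using U i finite_subset by auto
  have card: "card (insert i U) = Suc (card U)" using fin i by simp
  have w01: "integrable lborel ?w"
  proof -
    have "integrable lborel (\<lambda>z. real (Suc q) * (z ^ q * indicator {0..1} z :: real))"
      by (intro integrable_mult_right borel_integrable_atLeastAtMost) auto
    then show ?thesis by (simp only: mult_ac)
  qed
  have joint: "integrable (\<Omega> \<Otimes>\<^sub>M lborel) (case_prod ?f)"
  proof (rule Bochner_Integration.integrable_bound)
    show "integrable (\<Omega> \<Otimes>\<^sub>M lborel) (\<lambda>(\<omega>, z). h (M \<omega>) * ?w z)"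
      using h w01 by (intro Fubini_integrable) (auto simp: abs_mult simp del: of_nat_Suc)
    show "AE x in \<Omega> \<Otimes>\<^sub>M lborel. norm (case_prod ?f x) \<le> norm (case x of (\<omega>, z) \<Rightarrow> h (M \<omega>) * ?w z)"
      by (intro AE_I2) (auto simp: abs_mult simp del: of_nat_Suc)
  qed measurable
  have inner: "(\<integral>\<omega>. ?f \<omega> z \<partial>\<Omega>)
      = indicator {0..1} z *\<^sub>R (real (Suc q) * z ^ q * size_gf h ((z + real (card U)) / real k))" for z
  proof (cases "0 \<le> z \<and> z \<le> 1")
    case True
    then show ?thesis
      using integral_visited_subset_farthest_le[OF U i _ _ h, of z] by (simp add: add.commute)
  qed (auto simp: indicator_def)
  have "set_integrable lborel {0..1} (\<lambda>z. real (Suc q) * z ^ q * size_gf h ((z + real (card U)) / real k))"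
    using integrable_snd[OF joint] unfolding inner set_integrable_def .
  from set_borel_integral_eq_integral(2)[OF this]
  have "integral {0..1} (\<lambda>z. real (Suc q) * z ^ q * size_gf h ((z + real (card U)) / real k))
      = (\<integral>z. \<integral>\<omega>. ?f \<omega> z \<partial>\<Omega> \<partial>lborel)"
    unfolding inner set_lebesgue_integral_def by simp
  also have "\<dots> = (\<integral>\<omega>. \<integral>z. ?f \<omega> z \<partial>lborel \<partial>\<Omega>)"
    by (rule Fubini_integral[OF joint])
  also have "\<dots> = (\<integral>\<omega>. h (M \<omega>) * ?B \<omega> - h (M \<omega>) * (?B \<omega> * farthest i \<omega> ^ Suc q) \<partial>\<Omega>)"
  proof (rule integral_cong_AE)
    show "AE \<omega> in \<Omega>. (\<integral>z. ?f \<omega> z \<partial>lborel) = h (M \<omega>) * ?B \<omega> - h (M \<omega>) * (?B \<omega> * farthest i \<omega> ^ Suc q)"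
      using AE_farthest_bounds
    proof eventually_elim
      case (elim \<omega>)
      have "(\<integral>z. ?f \<omega> z \<partial>lborel) = (\<integral>z. (h (M \<omega>) * ?B \<omega>) * (?w z * of_bool (farthest i \<omega> \<le> z)) \<partial>lborel)"
        by (simp only: mult_ac)
      also have "\<dots> = (h (M \<omega>) * ?B \<omega>) * (1 - farthest i \<omega> ^ Suc q)"
        using elim integral_layer_cake_power[of "farthest i \<omega>" q] by (simp only: integral_mult_right_zero)
      finally show ?case by (simp add: right_diff_distrib mult.assoc del: power_Suc)
    qed
  qed measurable
  also have "\<dots> = (\<integral>\<omega>. h (M \<omega>) * ?B \<omega> \<partial>\<Omega>) - (\<integral>\<omega>. h (M \<omega>) * (?B \<omega> * farthest i \<omega> ^ Suc q) \<partial>\<Omega>)"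
    by (intro Bochner_Integration.integral_diff integrable_visited_farthest integrable_visited_fun[OF h])
  also have "(\<integral>\<omega>. h (M \<omega>) * ?B \<omega> \<partial>\<Omega>) = size_gf h ((real (card U) + 1) / real k)"
    using integral_visited_subset[OF U' h] by (simp add: card add.commute)
  finally show ?thesis by (simp add: gap_def)
qed

text \<open>
  If aisle \<open>i\<close> is empty then its farthest location is \<open>0\<close>, so the expansion of \<open>\<phi>\<close> into indicators of
  \<open>W \<subseteq> insert i U\<close> matters only for sets \<open>W\<close> containing \<open>i\<close>.
\<close>

lemma integral_farthest_expansion:
  assumes i: "i \<in> C" and C: "C \<subseteq> {1..k}"
    and expand: "\<And>W. W \<subseteq> {1..k} \<Longrightarrow> i \<in> W \<Longrightarrow>
      \<phi> W = (\<Sum>U\<in>Pow (C - {i}). c (card U) * of_bool (W \<subseteq> insert i U))"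
  shows "(\<integral>\<omega>. h (M \<omega>) * (\<phi> (visited \<omega>) * farthest i \<omega> ^ Suc q) \<partial>\<Omega>)
       = - (\<Sum>r<card C. real (card C - 1 choose r) * (c r * gap h q r))"
proof -
  have fin: "finite C" using C finite_subset by blast
  have "\<phi> (visited \<omega>) * farthest i \<omega> ^ Suc q
      = (\<Sum>U\<in>Pow (C - {i}). c (card U) * (of_bool (visited \<omega> \<subseteq> insert i U) * farthest i \<omega> ^ Suc q))" for \<omega>
  proof (cases "i \<in> visited \<omega>")
    case True
    show ?thesis
      unfolding expand[OF visited_set_subset True] sum_distrib_right mult.assoc ..
  next
    case False
    then have "farthest i \<omega> = 0" using i C by (intro farthest_location_eq_0) auto
    then show ?thesis by simp
  qed
  then have "(\<integral>\<omega>. h (M \<omega>) * (\<phi> (visited \<omega>) * farthest i \<omega> ^ Suc q) \<partial>\<Omega>)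
      = (\<integral>\<omega>. (\<Sum>U\<in>Pow (C - {i}). c (card U) * (h (M \<omega>) * (of_bool (visited \<omega> \<subseteq> insert i U) * farthest i \<omega> ^ Suc q))) \<partial>\<Omega>)"
    by (simp only: sum_distrib_left mult.left_commute)
  also have "\<dots> = (\<Sum>U\<in>Pow (C - {i}). c (card U) * (- gap h q (card U)))"
  proof (subst Bochner_Integration.integral_sum)
    show "integrable \<Omega> (\<lambda>\<omega>. c (card U) * (h (M \<omega>) * (of_bool (visited \<omega> \<subseteq> insert i U) * farthest i \<omega> ^ Suc q)))" for U
      by (intro integrable_mult_right integrable_visited_farthest)
    show "(\<Sum>U\<in>Pow (C - {i}). \<integral>\<omega>. c (card U) * (h (M \<omega>) * (of_bool (visited \<omega> \<subseteq> insert i U) * farthest i \<omega> ^ Suc q)) \<partial>\<Omega>)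
        = (\<Sum>U\<in>Pow (C - {i}). c (card U) * (- gap h q (card U)))"
    proof (intro sum.cong refl, unfold integral_mult_right_zero)
      fix U assume "U \<in> Pow (C - {i})"
      then have "U \<subseteq> {1..k}" "i \<in> {1..k} - U" using i C by auto
      from integral_farthest_power[OF this, of q]
      show "c (card U) * (\<integral>\<omega>. h (M \<omega>) * (of_bool (visited \<omega> \<subseteq> insert i U) * farthest i \<omega> ^ Suc q) \<partial>\<Omega>)
          = c (card U) * (- gap h q (card U))" by (simp only:)
    qed
  qed
  also have "\<dots> = (\<Sum>r\<le>card (C - {i}). real (card (C - {i}) choose r) * (c r * (- gap h q r)))"
    using fin by (intro sum_subsets_by_card) simp
  also have "{..card (C - {i})} = {..<card C}"
    using fin i by (auto simp: card_Diff_singleton) (metis One_nat_def Suc_pred card_gt_0_iff empty_iff less_Suc_eq_le)+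
  finally show ?thesis using i by (simp add: sum_negf)
qed

text \<open>
  Moebius inversion over the subsets of \<open>S - {Max S}\<close>; the result depends only on the size of \<open>S\<close>.
\<close>

lemma integral_last_farthest_by_set:
  assumes S: "S \<subseteq> {1..k}" "S \<noteq> {}"
  shows "(\<integral>\<omega>. h (M \<omega>) * (of_bool (visited \<omega> = S) * farthest (Max S) \<omega> ^ Suc q) \<partial>\<Omega>)
       = (\<Sum>r<card S. real (card S - 1 choose r) * ((-1) ^ (card S - r) * gap h q r))"
proof -
  let ?i = "Max S"
  have fin: "finite S" using S finite_subset by blast
  then have i: "?i \<in> S" using S by simp
  have "(\<integral>\<omega>. h (M \<omega>) * (of_bool (visited \<omega> = S) * farthest ?i \<omega> ^ Suc q) \<partial>\<Omega>)
      = - (\<Sum>r<card S. real (card S - 1 choose r) * ((-1) ^ (card S - 1 - r) * gap h q r))"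
  proof (rule integral_farthest_expansion[OF i S(1)])
    fix W assume W: "?i \<in> W"
    show "of_bool (W = S) = (\<Sum>U\<in>Pow (S - {?i}). (-1) ^ (card S - 1 - card U) * of_bool (W \<subseteq> insert ?i U) :: real)"
    proof (cases "W \<subseteq> S")
      case True
      have "of_bool (W = S) = (of_bool (W - {?i} = S - {?i}) :: real)"
        using W i by (intro arg_cong[where f = of_bool]) blast
      also have "\<dots> = (\<Sum>U\<in>Pow (S - {?i}). (-1) ^ (card (S - {?i}) - card U) * of_bool (W - {?i} \<subseteq> U))"
        using fin True by (intro indicator_eq_moebius) auto
      also have "\<dots> = (\<Sum>U\<in>Pow (S - {?i}). (-1) ^ (card S - 1 - card U) * of_bool (W \<subseteq> insert ?i U))"
        using i by (intro sum.cong refl) (simp add: subset_insert_iff)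
      finally show ?thesis .
    next
      case False
      then have "\<not> W \<subseteq> insert ?i U" if "U \<in> Pow (S - {?i})" for U using that i by blast
      moreover have "W \<noteq> S" using False by blast
      ultimately show ?thesis by simp
    qed
  qed
  also have "\<dots> = (\<Sum>r<card S. real (card S - 1 choose r) * ((-1) ^ (card S - r) * gap h q r))"
    unfolding sum_negf[symmetric]
  proof (intro sum.cong refl)
    fix r assume "r \<in> {..<card S}"
    then have "card S - r = Suc (card S - 1 - r)" by auto
    then show "- (real (card S - 1 choose r) * ((-1) ^ (card S - 1 - r) * gap h q r))
        = real (card S - 1 choose r) * ((-1) ^ (card S - r) * gap h q r)"
      by (simp only: power_Suc)
  qed
  finally show ?thesis .
qed

text \<open>
  A decomposition according to the visited set. A weight depending only on its size leads to one
  binomial coefficient per size.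
\<close>

lemma integral_odd_farthest_last:
  "(\<integral>\<omega>. h (M \<omega>) * (\<psi> (card (visited \<omega>)) * of_bool (odd (card (visited \<omega>)))
      * farthest (last_aisle k M aisle \<omega>) \<omega> ^ Suc q) \<partial>\<Omega>)
   = (\<Sum>j | 1 \<le> j \<and> j \<le> k \<and> odd j. \<psi> j * real (k choose j) *
        (\<Sum>r<j. real (j - 1 choose r) * (-1) ^ (j - r) * gap h q r))"
proof -
  let ?O = "{S. S \<subseteq> {1..k} \<and> odd (card S)}"
  let ?g = "\<lambda>j. \<Sum>r<j. real (j - 1 choose r) * ((-1) ^ (j - r) * gap h q r)"
  have finO: "finite ?O" by (rule finite_subset[of _ "Pow {1..k}"]) auto
  have "\<psi> (card (visited \<omega>)) * of_bool (odd (card (visited \<omega>))) * farthest (last_aisle k M aisle \<omega>) \<omega> ^ Suc q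
      = (\<Sum>S\<in>?O. \<psi> (card S) * (of_bool (visited \<omega> = S) * farthest (Max S) \<omega> ^ Suc q))" for \<omega>
  proof (cases "odd (card (visited \<omega>))")
    case True
    then have "visited \<omega> \<noteq> {}" by auto
    then have "last_aisle k M aisle \<omega> = Max (visited \<omega>)"
      unfolding last_aisle_eq_Max by (subst Max_insert) auto
    moreover have "(\<Sum>S\<in>?O. \<psi> (card S) * (of_bool (visited \<omega> = S) * farthest (Max S) \<omega> ^ Suc q))
        = (\<Sum>S\<in>{visited \<omega>}. \<psi> (card S) * farthest (Max S) \<omega> ^ Suc q)"
      using True visited_set_subset[of k M aisle \<omega>] finO by (intro sum.mono_neutral_cong_right) auto
    ultimately show ?thesis using True by simp
  next
    case False
    then have "visited \<omega> \<noteq> S" if "S \<in> ?O" for S using that by auto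
    then show ?thesis using False by simp
  qed
  then have "(\<integral>\<omega>. h (M \<omega>) * (\<psi> (card (visited \<omega>)) * of_bool (odd (card (visited \<omega>)))
      * farthest (last_aisle k M aisle \<omega>) \<omega> ^ Suc q) \<partial>\<Omega>)
    = (\<integral>\<omega>. (\<Sum>S\<in>?O. \<psi> (card S) * (h (M \<omega>) * (of_bool (visited \<omega> = S) * farthest (Max S) \<omega> ^ Suc q))) \<partial>\<Omega>)"
    by (simp only: sum_distrib_left mult.left_commute)
  also have "\<dots> = (\<Sum>S\<in>?O. \<psi> (card S) * (\<integral>\<omega>. h (M \<omega>) * (of_bool (visited \<omega> = S) * farthest (Max S) \<omega> ^ Suc q) \<partial>\<Omega>))"
    by (subst Bochner_Integration.integral_sum)
       (intro integrable_mult_right integrable_visited_farthest, simp only: integral_mult_right_zero)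
  also have "\<dots> = (\<Sum>S\<in>?O. \<psi> (card S) * ?g (card S))"
    by (intro sum.cong refl arg_cong2[where f = "(*)"] integral_last_farthest_by_set) auto
  also have "\<dots> = (\<Sum>S\<in>Pow {1..k}. of_bool (odd (card S)) * (\<psi> (card S) * ?g (card S)))"
    by (rule sum.mono_neutral_cong_left) auto
  also have "\<dots> = (\<Sum>j\<le>card {1..k}. real (card {1..k} choose j) * (of_bool (odd j) * (\<psi> j * ?g j)))"
    by (rule sum_subsets_by_card) simp
  also have "\<dots> = (\<Sum>j | 1 \<le> j \<and> j \<le> k \<and> odd j. real (k choose j) * (\<psi> j * ?g j))"
    by (rule sum.mono_neutral_cong_right) (auto simp: Suc_le_eq intro: odd_pos)
  finally show ?thesis by (simp only: mult_ac)
qed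

text \<open>
  Uses the parity expansion inside \<open>{1..i}\<close>, keeping only the sets that contain \<open>i\<close>.
\<close>

lemma integral_odd_farthest_within:
  assumes i: "i \<in> {1..k}"
  shows "(\<integral>\<omega>. h (M \<omega>) * (of_bool (odd (card (visited \<omega>))) * of_bool (visited \<omega> \<subseteq> {1..i})
      * farthest i \<omega> ^ Suc q) \<partial>\<Omega>)
   = - (\<Sum>r<i. real (i - 1 choose r) * (parity_coeff i (Suc r) * gap h q r))"
proof -
  have "(\<integral>\<omega>. h (M \<omega>) * (of_bool (odd (card (visited \<omega>))) * of_bool (visited \<omega> \<subseteq> {1..i})
      * farthest i \<omega> ^ Suc q) \<partial>\<Omega>)
   = - (\<Sum>r<card {1..i}. real (card {1..i} - 1 choose r) * (parity_coeff i (Suc r) * gap h q r))"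
  proof (rule integral_farthest_expansion)
    fix W assume W: "i \<in> W"
    show "of_bool (odd (card W)) * of_bool (W \<subseteq> {1..i})
        = (\<Sum>U\<in>Pow ({1..i} - {i}). parity_coeff i (Suc (card U)) * of_bool (W \<subseteq> insert i U))"
    proof (cases "W \<subseteq> {1..i}")
      case True
      have "of_bool (odd (card W)) = (\<Sum>U\<in>Pow {1..i}. parity_coeff i (card U) * of_bool (W \<subseteq> U))"
        using odd_card_expansion[OF _ True] by simp
      also have "\<dots> = (\<Sum>U\<in>insert i ` Pow ({1..i} - {i}). parity_coeff i (card U) * of_bool (W \<subseteq> U))"
      proof (rule sum.mono_neutral_right)
        show "insert i ` Pow ({1..i} - {i}) \<subseteq> Pow {1..i}" using i by auto
        show "\<forall>U\<in>Pow {1..i} - insert i ` Pow ({1..i} - {i}). parity_coeff i (card U) * of_bool (W \<subseteq> U) = 0"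
        proof
          fix U assume U: "U \<in> Pow {1..i} - insert i ` Pow ({1..i} - {i})"
          have "i \<notin> U"
          proof
            assume "i \<in> U"
            then have "U = insert i (U - {i})" "U - {i} \<in> Pow ({1..i} - {i})" using U by auto
            then show False using U by blast
          qed
          then show "parity_coeff i (card U) * of_bool (W \<subseteq> U) = 0" using W by auto
        qed
      qed simp
      also have "\<dots> = (\<Sum>U\<in>Pow ({1..i} - {i}). parity_coeff i (card (insert i U)) * of_bool (W \<subseteq> insert i U))"
        by (subst sum.reindex) (auto simp: inj_on_def)
      also have "\<dots> = (\<Sum>U\<in>Pow ({1..i} - {i}). parity_coeff i (Suc (card U)) * of_bool (W \<subseteq> insert i U))"
      proof (intro sum.cong refl)
        fix U assume "U \<in> Pow ({1..i} - {i})"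
        then have "finite U" "i \<notin> U" using finite_subset[of U "{1..i} - {i}"] by auto
        then show "parity_coeff i (card (insert i U)) * of_bool (W \<subseteq> insert i U)
            = parity_coeff i (Suc (card U)) * of_bool (W \<subseteq> insert i U)" by simp
      qed
      finally show ?thesis using True by simp
    next
      case False
      then have "\<not> W \<subseteq> insert i U" if "U \<in> Pow ({1..i} - {i})" for U using that i by auto
      then show ?thesis using False by simp
    qed
  qed (use i in auto)
  then show ?thesis by simp
qed

text \<open>
  The weight is now the last aisle itself, so the decomposition is by its value \<open>n\<close>. The event that
  \<open>n\<close> is the last aisle becomes \<open>S \<subseteq> {1..n}\<close>, as the farthest location in aisle \<open>n\<close> vanishes if \<open>n\<close> is
  not visited.
\<close>

lemma integral_odd_farthest_last_times_last:
  "(\<integral>\<omega>. h (M \<omega>) * (of_bool (odd (card (visited \<omega>))) * farthest (last_aisle k M aisle \<omega>) \<omega>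
      * real (last_aisle k M aisle \<omega>)) \<partial>\<Omega>)
   = - (\<Sum>n | 1 \<le> n \<and> n \<le> k \<and> odd n. real n * gap h 0 (n - 1))
     + (\<Sum>n = 1..k. \<Sum>r<n - 1. real (n choose r) * real (n - r) * 2 ^ (n - r - 2) * (-1) ^ (r + 1) * gap h 0 r)"
proof -
  let ?X = "\<lambda>n \<omega>. of_bool (odd (card (visited \<omega>))) * of_bool (visited \<omega> \<subseteq> {1..n}) * farthest n \<omega> ^ Suc 0"
  have "of_bool (odd (card (visited \<omega>))) * farthest (last_aisle k M aisle \<omega>) \<omega> * real (last_aisle k M aisle \<omega>)
      = (\<Sum>n = 1..k. real n * ?X n \<omega>)" for \<omega>
  proof (cases "visited \<omega> = {}")
    case False
    let ?L = "last_aisle k M aisle \<omega>"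
    have L: "?L \<in> visited \<omega>" using False by (rule last_aisle_in_visited_set)
    have "(\<Sum>n = 1..k. real n * ?X n \<omega>) = (\<Sum>n\<in>{?L}. real n * ?X n \<omega>)"
    proof (rule sum.mono_neutral_right)
      show "{?L} \<subseteq> {1..k}" using L visited_set_subset[of k M aisle \<omega>] by blast
      show "\<forall>n\<in>{1..k} - {?L}. real n * ?X n \<omega> = 0"
      proof
        fix n assume n: "n \<in> {1..k} - {?L}"
        have "n \<notin> visited \<omega> \<or> \<not> visited \<omega> \<subseteq> {1..n}"
        proof (rule ccontr)
          assume "\<not> ?thesis"
          then have "n \<in> visited \<omega>" "?L \<le> n" by (auto simp: last_aisle_le_iff)
          moreover have "n \<le> ?L"
            using \<open>n \<in> visited \<omega>\<close> unfolding last_aisle_eq_Max by (intro Max_ge) auto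
          ultimately show False using n by simp
        qed
        then show "real n * ?X n \<omega> = 0" using n by (auto simp: farthest_location_eq_0)
      qed
    qed simp
    moreover have "visited \<omega> \<subseteq> {1..?L}" unfolding last_aisle_le_iff[symmetric] by simp
    ultimately show ?thesis by (simp add: mult_ac)
  qed simp
  then have "(\<integral>\<omega>. h (M \<omega>) * (of_bool (odd (card (visited \<omega>))) * farthest (last_aisle k M aisle \<omega>) \<omega>
      * real (last_aisle k M aisle \<omega>)) \<partial>\<Omega>) = (\<integral>\<omega>. (\<Sum>n = 1..k. real n * (h (M \<omega>) * ?X n \<omega>)) \<partial>\<Omega>)"
    by (simp only: sum_distrib_left mult.left_commute)
  also have "\<dots> = (\<Sum>n = 1..k. real n * (\<integral>\<omega>. h (M \<omega>) * ?X n \<omega> \<partial>\<Omega>))"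
  proof (subst Bochner_Integration.integral_sum)
    show "integrable \<Omega> (\<lambda>\<omega>. real n * (h (M \<omega>) * ?X n \<omega>))" for n
      using integrable_visited_farthest[of "\<lambda>S. of_bool (odd (card S)) * of_bool (S \<subseteq> {1..n})" n "Suc 0"]
      by (rule integrable_mult_right)
  qed (simp only: integral_mult_right_zero)
  also have "\<dots> = (\<Sum>n = 1..k. - (of_bool (odd n) * (real n * gap h 0 (n - 1)))
      + (\<Sum>r<n - 1. real (n choose r) * real (n - r) * 2 ^ (n - r - 2) * (-1) ^ (r + 1) * gap h 0 r))"
  proof (rule sum.cong[OF refl])
    fix n assume n: "n \<in> {1..k}"
    then obtain t where t: "n = Suc t" by (cases n) auto
    have "real n * (- (real (n - 1 choose r) * (parity_coeff n (Suc r) * gap h 0 r)))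
        = real (n choose r) * real (n - r) * 2 ^ (n - r - 2) * (-1) ^ (r + 1) * gap h 0 r" if "r < t" for r
    proof -
      have "Suc t * (t choose r) = (n - r) * (n choose r)"
        using that Suc_times_binomial_eq[of t "t - r"] binomial_symmetric[of r t] binomial_symmetric[of r n]
        by (simp add: t Suc_diff_le mult.commute)
      then have "real n * real (t choose r) = real (n - r) * real (n choose r)"
        unfolding t by (metis of_nat_mult)
      moreover have "real n * (- (real (n - 1 choose r) * (parity_coeff n (Suc r) * gap h 0 r)))
          = - ((real n * real (t choose r)) * (parity_coeff n (Suc r) * gap h 0 r))"
        by (simp add: t)
      ultimately show ?thesis using that by (simp add: t parity_coeff_def)
    qed
    then have "(\<Sum>r<t. real n * (- (real (n - 1 choose r) * (parity_coeff n (Suc r) * gap h 0 r))))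
        = (\<Sum>r<n - 1. real (n choose r) * real (n - r) * 2 ^ (n - r - 2) * (-1) ^ (r + 1) * gap h 0 r)"
      unfolding t by (intro sum.cong) auto
    moreover have "real n * (\<integral>\<omega>. h (M \<omega>) * ?X n \<omega> \<partial>\<Omega>)
        = (\<Sum>r<Suc t. real n * (- (real (n - 1 choose r) * (parity_coeff n (Suc r) * gap h 0 r))))"
      unfolding integral_odd_farthest_within[OF n] unfolding sum_negf[symmetric] sum_distrib_left t ..
    ultimately show "real n * (\<integral>\<omega>. h (M \<omega>) * ?X n \<omega> \<partial>\<Omega>) = - (of_bool (odd n) * (real n * gap h 0 (n - 1)))
      + (\<Sum>r<n - 1. real (n choose r) * real (n - r) * 2 ^ (n - r - 2) * (-1) ^ (r + 1) * gap h 0 r)"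
      unfolding sum.lessThan_Suc by (simp add: t parity_coeff_def)
  qed
  also have "\<dots> = (\<Sum>n = 1..k. - (of_bool (odd n) * (real n * gap h 0 (n - 1))))
      + (\<Sum>n = 1..k. \<Sum>r<n - 1. real (n choose r) * real (n - r) * 2 ^ (n - r - 2) * (-1) ^ (r + 1) * gap h 0 r)"
    by (rule sum.distrib)
  also have "(\<Sum>n = 1..k. - (of_bool (odd n) * (real n * gap h 0 (n - 1)))) =
      - (\<Sum>n | 1 \<le> n \<and> n \<le> k \<and> odd n. real n * gap h 0 (n - 1))"
    unfolding sum_negf by (intro arg_cong[where f = uminus] sum.mono_neutral_cong_right) auto
  finally show ?thesis .
qed

end

end

section \<open>The moments in terms of the probability generating function\<close>

context warehouse
begin

abbreviation "J \<omega> \<equiv> real (visited_aisles k M aisle \<omega>)"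
abbreviation "I \<omega> \<equiv> of_bool (odd (visited_aisles k M aisle \<omega>)) :: real"
abbreviation "K \<omega> \<equiv> real (last_aisle k M aisle \<omega>)"
abbreviation "A \<omega> \<equiv> farthest (last_aisle k M aisle \<omega>) \<omega>"
abbreviation "p r \<equiv> pgf \<Omega> M (real r / real k)"
abbreviation "p' r \<equiv> pgf_deriv \<Omega> M (real r / real k)"

lemma integrable_size: "integrable \<Omega> (\<lambda>\<omega>. real (M \<omega>))"
  by (rule square_integrable_imp_integrable[OF _ M_square_integrable]) simp

lemma gf_at_1: "gf_at (\<lambda>_. 1) r = p r"
  by (rule size_gf_1)

lemma p_k: "p k = 1"
  using k by (simp add: pgf_def prob_space)

lemma gf_at_real: "r \<le> k \<Longrightarrow> gf_at real r = real r / real k * p' r"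
  using k by (intro size_gf_real) auto

lemma gf_at_real_k: "gf_at real k = (\<integral>\<omega>. real (M \<omega>) \<partial>\<Omega>)"
  using k by (simp add: size_gf_def)

lemmas moment_simps = visited_moment_def visited_aisles_eq_card[symmetric] last_aisle_eq_Max[symmetric] mult_1

lemma integral_last: "(\<integral>\<omega>. K \<omega> \<partial>\<Omega>) = real k - (\<Sum>r<k. p r)"
  using visited_moment_last[of "\<lambda>_. 1"] unfolding moment_simps gf_at_1 p_k by simp

lemma integral_last_square: "(\<integral>\<omega>. (K \<omega>)\<^sup>2 \<partial>\<Omega>) = (real k)\<^sup>2 - (\<Sum>r<k. (2 * real r + 1) * p r)"
  using visited_moment_last_square[of "\<lambda>_. 1"] unfolding moment_simps gf_at_1 p_k by simp

lemma integral_size_last: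
  "(\<integral>\<omega>. real (M \<omega>) * K \<omega> \<partial>\<Omega>)
   = real k * (\<integral>\<omega>. real (M \<omega>) \<partial>\<Omega>) - (\<Sum>r<k. real r / real k * p' r)"
proof -
  have "(\<Sum>r<k. gf_at real r) = (\<Sum>r<k. real r / real k * p' r)"
    by (intro sum.cong gf_at_real) auto
  then show ?thesis
    using visited_moment_last[OF integrable_size] unfolding moment_simps gf_at_real_k by simp
qed

lemma integral_visited: "(\<integral>\<omega>. J \<omega> \<partial>\<Omega>) = real k - real k * pgf \<Omega> M (1 - 1 / real k)"
proof -
  have "real (k - 1) / real k = 1 - 1 / real k" using k by (simp add: field_simps of_nat_diff)
  then show ?thesis
    using visited_moment_card[of "\<lambda>_. 1"] unfolding moment_simps gf_at_1 p_k
    by (simp add: right_diff_distrib)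
qed

lemma integral_visited_square:
  "(\<integral>\<omega>. (J \<omega>)\<^sup>2 \<partial>\<Omega>) = (real k)\<^sup>2 + real k * (1 - 2 * real k) * pgf \<Omega> M (1 - 1 / real k)
      + real k * (real k - 1) * pgf \<Omega> M (1 - 2 / real k)"
proof -
  have 1: "real (k - 1) / real k = 1 - 1 / real k" using k by (simp add: field_simps of_nat_diff)
  \<comment> \<open>For a single aisle the argument \<open>1 - 2 / k\<close> is \<open>-1\<close> rather than \<open>0\<close>, but then both sides vanish.\<close>
  have 2: "real (k - 1) * p (k - 1 - 1) = (real k - 1) * pgf \<Omega> M (1 - 2 / real k)"
  proof (cases "k = 1")
    case False
    then have "real (k - 1 - 1) / real k = 1 - 2 / real k" using k by (simp add: field_simps of_nat_diff)
    then show ?thesis using k by (simp add: of_nat_diff)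
  qed simp
  have 3: "real (k - 1) = real k - 1" using k by simp
  have "(\<integral>\<omega>. (J \<omega>)\<^sup>2 \<partial>\<Omega>) = real k * (real k * (1 - p (k - 1)) - real (k - 1) * (p (k - 1) - p (k - 1 - 1)))"
    using visited_moment_card_square[of "\<lambda>_. 1"] unfolding moment_simps gf_at_1 p_k by simp
  also have "\<dots> = real k * (real k * (1 - p (k - 1)) - (real (k - 1) * p (k - 1) - real (k - 1) * p (k - 1 - 1)))"
    by (simp only: right_diff_distrib)
  also have "\<dots> = real k * (real k * (1 - pgf \<Omega> M (1 - 1 / real k))
      - ((real k - 1) * pgf \<Omega> M (1 - 1 / real k) - (real k - 1) * pgf \<Omega> M (1 - 2 / real k)))"
    unfolding 2 unfolding 1 unfolding 3 by (rule refl)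
  finally show ?thesis by (simp add: algebra_simps power2_eq_square)
qed

lemma integral_odd:
  "(\<integral>\<omega>. I \<omega> \<partial>\<Omega>) = (\<Sum>r<k. real (k choose r) * (-1) ^ (r + 1) * 2 ^ (k - r - 1) * p r) + of_bool (odd k)"
  using visited_moment_odd[of "\<lambda>_. 1"] unfolding moment_simps odd_sum_def gf_at_1 p_k by simp

lemma integral_size_visited:
  "(\<integral>\<omega>. real (M \<omega>) * J \<omega> \<partial>\<Omega>)
   = real k * (\<integral>\<omega>. real (M \<omega>) \<partial>\<Omega>) - (real k - 1) * pgf_deriv \<Omega> M ((real k - 1) / real k)"
proof -
  have "real k * gf_at real (k - 1) = (real k - 1) * pgf_deriv \<Omega> M ((real k - 1) / real k)"
    using k by (subst gf_at_real) (auto simp: of_nat_diff)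
  then show ?thesis
    using visited_moment_card[OF integrable_size] unfolding moment_simps gf_at_real_k
    by (simp add: right_diff_distrib)
qed

lemma integral_last_visited:
  "(\<integral>\<omega>. K \<omega> * J \<omega> \<partial>\<Omega>)
   = (real k)\<^sup>2 - real k * (real k + 1) * p (k - 1) + (\<Sum>j = 1..k. p (j - 1))"
  using visited_moment_last_card[of "\<lambda>_. 1"] unfolding moment_simps gf_at_1 p_k by simp

lemma integral_odd_visited:
  "(\<integral>\<omega>. I \<omega> * J \<omega> \<partial>\<Omega>) = (real k - (real k)\<^sup>2 * p (k - 1)) * of_bool (odd k)
      + real k * (real k - 1) * p (k - 1) * of_bool (even k)
      + (\<Sum>r<k - 1. real (k choose r) * p r * (-1) ^ (r + 1) * real (k + r) * 2 ^ (k - r - 2))"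
proof -
  have "(\<integral>\<omega>. I \<omega> * J \<omega> \<partial>\<Omega>) = real k * (odd_sum p k - odd_sum p (k - 1))"
    using visited_moment_odd_card[of "\<lambda>_. 1"] unfolding moment_simps gf_at_1 by simp
  then show ?thesis unfolding odd_sum_diff[OF k] p_k by (cases "odd k") (simp_all add: add.commute)
qed

lemma integral_odd_last:
  "(\<integral>\<omega>. I \<omega> * K \<omega> \<partial>\<Omega>) =
      (\<Sum>s = 1..k. \<Sum>n<s - 1. real (s choose n) * p n * (-1) ^ (n + 1) * real (n + s) * 2 ^ (s - n - 2))
    + (\<Sum>s | 1 \<le> s \<and> s \<le> k \<and> even s. real s * (real s - 1) * p (s - 1))
    + (\<Sum>s | 1 \<le> s \<and> s \<le> k \<and> odd s. real s * p s - (real s)\<^sup>2 * p (s - 1))"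
proof -
  have restrict: "(\<Sum>s = 1..k. of_bool (Q s) * f s) = (\<Sum>s | 1 \<le> s \<and> s \<le> k \<and> Q s. f s)"
    for Q and f :: "nat \<Rightarrow> real"
    by (rule sum.mono_neutral_cong_right) auto
  have "(\<integral>\<omega>. I \<omega> * K \<omega> \<partial>\<Omega>) = (\<Sum>s = 1..k. real s * (odd_sum p s - odd_sum p (s - 1)))"
    using visited_moment_odd_last[of "\<lambda>_. 1"] unfolding moment_simps gf_at_1 by simp
  also have "\<dots> = (\<Sum>s = 1..k.
      (\<Sum>n<s - 1. real (s choose n) * p n * (-1) ^ (n + 1) * real (n + s) * 2 ^ (s - n - 2))
    + of_bool (even s) * (real s * (real s - 1) * p (s - 1))
    + of_bool (odd s) * (real s * p s - (real s)\<^sup>2 * p (s - 1)))"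
    by (intro sum.cong refl odd_sum_diff) simp
  finally show ?thesis unfolding sum.distrib restrict .
qed

lemma integral_size_odd:
  "(\<integral>\<omega>. real (M \<omega>) * I \<omega> \<partial>\<Omega>) =
      (\<Sum>r<k - 1. real (k - 1 choose r) * (-1) ^ r * 2 ^ (k - 2 - r) * pgf_deriv \<Omega> M ((1 + real r) / real k))
    + (\<integral>\<omega>. real (M \<omega>) \<partial>\<Omega>) * of_bool (odd k)"
proof -
  obtain t where t: "k = Suc t" using k by (cases k) auto
  let ?F = "\<lambda>r. real (k choose r) * (-1) ^ (r + 1) * 2 ^ (k - r - 1) * gf_at real r"
  \<comment> \<open>The term \<open>r = 0\<close> vanishes because of the factor \<open>r / k\<close>, which absorbs the binomial coefficient of the others.\<close>
  have "(\<Sum>r<k. ?F r) = ?F 0 + (\<Sum>r<t. ?F (Suc r))"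
    unfolding t by (rule sum.lessThan_Suc_shift)
  moreover have "?F 0 = 0" using gf_at_real[of 0] by simp
  moreover have "?F (Suc r) = real (k choose Suc r) * (-1) ^ r * 2 ^ (t - Suc r) * gf_at real (Suc r)" for r
    by (simp add: t del: binomial_Suc_Suc)
  ultimately have "(\<Sum>r<k. ?F r) = (\<Sum>r<t. real (k choose Suc r) * (-1) ^ r * 2 ^ (t - Suc r) * gf_at real (Suc r))"
    by (simp only: add_0_left)
  also have "\<dots> = (\<Sum>r<t. real (t choose r) * (-1) ^ r * 2 ^ (t - Suc r) * p' (Suc r))"
  proof (rule sum.cong[OF refl])
    fix r assume "r \<in> {..<t}"
    then have gf: "gf_at real (Suc r) = real (Suc r) / real k * p' (Suc r)"
      by (intro gf_at_real) (simp add: t)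
    have "real (Suc r) * real (k choose Suc r) = real k * real (t choose r)"
      unfolding t using Suc_times_binomial[of r t] by (metis of_nat_mult)
    then have binom: "real (k choose Suc r) * (real (Suc r) / real k) = real (t choose r)"
      using k by (simp add: field_simps del: binomial_Suc_Suc of_nat_Suc)
    have "real (k choose Suc r) * (-1) ^ r * 2 ^ (t - Suc r) * gf_at real (Suc r)
        = (real (k choose Suc r) * (real (Suc r) / real k)) * ((-1) ^ r * 2 ^ (t - Suc r) * p' (Suc r))"
      unfolding gf by (simp only: mult_ac)
    then show "real (k choose Suc r) * (-1) ^ r * 2 ^ (t - Suc r) * gf_at real (Suc r)
        = real (t choose r) * (-1) ^ r * 2 ^ (t - Suc r) * p' (Suc r)"
      unfolding binom by (simp only: mult_ac)
  qed
  finally show ?thesis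
    using visited_moment_odd[OF integrable_size] unfolding moment_simps odd_sum_def gf_at_real_k
    by (simp add: t mult.commute)
qed

lemma gap_pgf:
  "gap (\<lambda>_. 1) 0 r = integral {0..1} (\<lambda>z. pgf \<Omega> M ((z + real r) / real k)) - pgf \<Omega> M ((real r + 1) / real k)"
  "gap (\<lambda>_. 1) 1 r = 2 * integral {0..1} (\<lambda>z. z * pgf \<Omega> M ((z + real r) / real k)) - pgf \<Omega> M ((real r + 1) / real k)"
  by (simp_all add: gap_def size_gf_1 mult.assoc)

lemma gap_pgf_deriv:
  assumes "r < k"
  shows "gap real 0 r
   = integral {0..1} (\<lambda>z. (z + real r) / real k * pgf_deriv \<Omega> M ((z + real r) / real k))
     - (real r + 1) / real k * pgf_deriv \<Omega> M ((real r + 1) / real k)"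
proof -
  have "size_gf real ((z + real r) / real k) = (z + real r) / real k * pgf_deriv \<Omega> M ((z + real r) / real k)"
    if "0 \<le> z" "z \<le> 1" for z
    using that assms by (intro size_gf_real) (auto simp: abs_le_iff field_simps)
  moreover from this[of 1] have "size_gf real ((real r + 1) / real k)
      = (real r + 1) / real k * pgf_deriv \<Omega> M ((real r + 1) / real k)"
    by (simp add: add.commute)
  moreover have "integral {0..1} (\<lambda>z. real (Suc 0) * z ^ 0 * size_gf real ((z + real r) / real k))
      = integral {0..1} (\<lambda>z. (z + real r) / real k * pgf_deriv \<Omega> M ((z + real r) / real k))"
    using calculation(1) by (intro Henstock_Kurzweil_Integration.integral_cong) simp
  ultimately show ?thesis unfolding gap_def by (simp only:)
qed

lemma integral_odd_farthest:
  "(\<integral>\<omega>. I \<omega> * A \<omega> \<partial>\<Omega>) = (\<Sum>j | 1 \<le> j \<and> j \<le> k \<and> odd j. real (k choose j) *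
      (\<Sum>r<j. real (j - 1 choose r) * (-1) ^ (j - r) * gap (\<lambda>_. 1) 0 r))"
  using integral_odd_farthest_last[of "\<lambda>_. 1" "\<lambda>_. 1" 0] by (simp add: visited_aisles_eq_card)

lemma integral_odd_farthest_square:
  "(\<integral>\<omega>. I \<omega> * (A \<omega>)\<^sup>2 \<partial>\<Omega>) = (\<Sum>j | 1 \<le> j \<and> j \<le> k \<and> odd j. real (k choose j) *
      (\<Sum>r<j. real (j - 1 choose r) * (-1) ^ (j - r) * gap (\<lambda>_. 1) 1 r))"
  using integral_odd_farthest_last[of "\<lambda>_. 1" "\<lambda>_. 1" 1] by (simp add: visited_aisles_eq_card numeral_2_eq_2)

lemma integral_odd_farthest_visited:
  "(\<integral>\<omega>. I \<omega> * A \<omega> * J \<omega> \<partial>\<Omega>) = (\<Sum>j | 1 \<le> j \<and> j \<le> k \<and> odd j. real j * real (k choose j) *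
      (\<Sum>r<j. real (j - 1 choose r) * (-1) ^ (j - r) * gap (\<lambda>_. 1) 0 r))"
  using integral_odd_farthest_last[of "\<lambda>_. 1" real 0] by (simp add: visited_aisles_eq_card mult_ac)

lemma integral_odd_farthest_times_last:
  "(\<integral>\<omega>. I \<omega> * A \<omega> * K \<omega> \<partial>\<Omega>) = - (\<Sum>n | 1 \<le> n \<and> n \<le> k \<and> odd n. real n * gap (\<lambda>_. 1) 0 (n - 1))
     + (\<Sum>n = 1..k. \<Sum>r<n - 1.
          real (n choose r) * real (n - r) * 2 ^ (n - r - 2) * (-1) ^ (r + 1) * gap (\<lambda>_. 1) 0 r)"
  using integral_odd_farthest_last_times_last[of "\<lambda>_. 1"] unfolding visited_aisles_eq_card mult_1 by simp

lemma integral_size_odd_farthest: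
  "(\<integral>\<omega>. real (M \<omega>) * I \<omega> * A \<omega> \<partial>\<Omega>) = (\<Sum>j | 1 \<le> j \<and> j \<le> k \<and> odd j. real (k choose j) *
      (\<Sum>r<j. real (j - 1 choose r) * (-1) ^ (j - r) *
        (integral {0..1} (\<lambda>z. (z + real r) / real k * pgf_deriv \<Omega> M ((z + real r) / real k))
          - (real r + 1) / real k * pgf_deriv \<Omega> M ((real r + 1) / real k))))"
proof -
  have "(\<integral>\<omega>. real (M \<omega>) * I \<omega> * A \<omega> \<partial>\<Omega>) = (\<Sum>j | 1 \<le> j \<and> j \<le> k \<and> odd j. real (k choose j) *
      (\<Sum>r<j. real (j - 1 choose r) * (-1) ^ (j - r) * gap real 0 r))"
    using integral_odd_farthest_last[OF integrable_size, of "\<lambda>_. 1" 0]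
    by (simp add: visited_aisles_eq_card mult.assoc)
  then show ?thesis by (auto intro!: sum.cong simp: gap_pgf_deriv simp del: One_nat_def)
qed

lemma measurable_last_farthest [measurable]: "A \<in> borel_measurable \<Omega>"
  by (rule measurable_farthest_location_last) auto

lemma integrable_visited_last_farthest:
  assumes h: "integrable \<Omega> (\<lambda>\<omega>. h (M \<omega>))"
  shows "integrable \<Omega> (\<lambda>\<omega>. h (M \<omega>) * (\<phi> (visited \<omega>) * A \<omega> ^ q))"
proof (rule Bochner_Integration.integrable_bound[OF integrable_visited_fun[OF h, of \<phi>]])
  show "AE \<omega> in \<Omega>. norm (h (M \<omega>) * (\<phi> (visited \<omega>) * A \<omega> ^ q)) \<le> norm (h (M \<omega>) * \<phi> (visited \<omega>))"
    using AE_farthest_bounds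
  proof eventually_elim
    case (elim \<omega>)
    then have "\<bar>A \<omega> ^ q\<bar> \<le> 1" by (simp add: power_abs power_le_one)
    then show ?case
      using mult_left_le[of "\<bar>A \<omega> ^ q\<bar>" "\<bar>h (M \<omega>)\<bar> * \<bar>\<phi> (visited \<omega>)\<bar>"]
      by (simp add: abs_mult mult.assoc)
  qed
qed measurable

end

section \<open>Independence of picking times and item positions\<close>

text \<open>
  Real functions of \<open>X\<close> and \<open>Y\<close> generate smaller sigma-algebras than \<open>X\<close> and \<open>Y\<close>, hence are independent
  real variables. This reduces values in different types to the product rule for real variables.
\<close>

lemma (in prob_space) indep_rvs_integral_mult:
  fixes f :: "'b \<Rightarrow> real" and g :: "'c \<Rightarrow> real"
  assumes indep: "indep_rvs M N X N' Y"
    and f [measurable]: "f \<in> borel_measurable N" and g [measurable]: "g \<in> borel_measurable N'"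
    and intf: "integrable M (\<lambda>\<omega>. f (X \<omega>))" and intg: "integrable M (\<lambda>\<omega>. g (Y \<omega>))"
  shows "integrable M (\<lambda>\<omega>. f (X \<omega>) * g (Y \<omega>))"
    and "(\<integral>\<omega>. f (X \<omega>) * g (Y \<omega>) \<partial>M) = (\<integral>\<omega>. f (X \<omega>) \<partial>M) * (\<integral>\<omega>. g (Y \<omega>) \<partial>M)"
proof -
  have X[measurable]: "X \<in> measurable M N" and Y[measurable]: "Y \<in> measurable M N'"
    and set: "indep_set (sets (vimage_algebra (space M) X N)) (sets (vimage_algebra (space M) Y N'))"
    using indep by (auto simp: indep_rvs_def)
  have sub: "sigma_sets (space M) {(\<lambda>\<omega>. e (Z \<omega>)) -` A \<inter> space M | A. A \<in> sets borel}
      \<subseteq> sets (vimage_algebra (space M) Z L)"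
    if Z: "Z \<in> measurable M L" and e: "e \<in> borel_measurable L" for e :: "'e \<Rightarrow> real" and Z L
  proof -
    have "{(\<lambda>\<omega>. e (Z \<omega>)) -` A \<inter> space M | A. A \<in> sets borel} \<subseteq> sets (vimage_algebra (space M) Z L)"
    proof clarify
      fix A :: "real set" assume "A \<in> sets borel"
      then have "e -` A \<inter> space L \<in> sets L" using e by (rule measurable_sets[rotated])
      then have "Z -` (e -` A \<inter> space L) \<inter> space M \<in> sets (vimage_algebra (space M) Z L)"
        by (rule in_vimage_algebra)
      moreover have "Z -` (e -` A \<inter> space L) \<inter> space M = (\<lambda>\<omega>. e (Z \<omega>)) -` A \<inter> space M"
        using measurable_space[OF Z] by auto
      ultimately show "(\<lambda>\<omega>. e (Z \<omega>)) -` A \<inter> space M \<in> sets (vimage_algebra (space M) Z L)" by simp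
    qed
    from sets.sigma_sets_subset[OF this] show ?thesis by simp
  qed
  have var: "indep_var borel (\<lambda>\<omega>. f (X \<omega>)) borel (\<lambda>\<omega>. g (Y \<omega>))"
    unfolding indep_var_eq
  proof (intro conjI)
    show "indep_set (sigma_sets (space M) {(\<lambda>\<omega>. f (X \<omega>)) -` A \<inter> space M | A. A \<in> sets borel})
        (sigma_sets (space M) {(\<lambda>\<omega>. g (Y \<omega>)) -` A \<inter> space M | A. A \<in> sets borel})"
      using set sub[OF X f] sub[OF Y g] unfolding indep_sets2_eq by (meson subset_iff)
  qed measurable
  show "integrable M (\<lambda>\<omega>. f (X \<omega>) * g (Y \<omega>))"
    by (rule indep_var_integrable[OF var intf intg])
  show "(\<integral>\<omega>. f (X \<omega>) * g (Y \<omega>) \<partial>M) = (\<integral>\<omega>. f (X \<omega>) \<partial>M) * (\<integral>\<omega>. g (Y \<omega>) \<partial>M)"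
    by (rule indep_var_lebesgue_integral[OF var intf intg])
qed

text \<open>
  The part of the total time that does not depend on the picking times. It is defined for arbitrary
  processes so that it can also be evaluated on the canonical space of orders below.
\<close>

definition walking_time ::
  "nat \<Rightarrow> real \<Rightarrow> real \<Rightarrow> ('w \<Rightarrow> nat) \<Rightarrow> (nat \<Rightarrow> 'w \<Rightarrow> nat) \<Rightarrow> (nat \<Rightarrow> 'w \<Rightarrow> real) \<Rightarrow> 'w \<Rightarrow> real" where
  "walking_time k c d M aisle loc \<omega> =
     c * (real (visited_aisles k M aisle \<omega>) + of_bool (odd (visited_aisles k M aisle \<omega>))
          * (2 * farthest_location M aisle loc (last_aisle k M aisle \<omega>) \<omega> - 1))
     + d * (real (last_aisle k M aisle \<omega>) - 1)"

lemma measurable_walking_time: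
  assumes M: "M \<in> measurable N (count_space UNIV)"
    and aisle: "\<And>j. aisle j \<in> measurable N (count_space UNIV)" and loc: "\<And>j. loc j \<in> borel_measurable N"
  shows "walking_time k c d M aisle loc \<in> borel_measurable N"
proof -
  note [measurable] = measurable_farthest_location_last[OF M aisle loc, where k = k]
  have [measurable]: "(\<lambda>\<omega>. \<phi> (visited_set k M aisle \<omega>) :: real) \<in> borel_measurable N" for \<phi>
    by (rule measurable_visited_set_fun[OF M aisle]) auto
  have J: "(\<lambda>\<omega>. f (visited_aisles k M aisle \<omega>) :: real) \<in> borel_measurable N" for f
    unfolding visited_aisles_eq_card by measurable
  have K: "(\<lambda>\<omega>. real (last_aisle k M aisle \<omega>)) \<in> borel_measurable N"
    unfolding last_aisle_eq_Max by measurable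
  note [measurable] = J[of real] J[of "\<lambda>n. of_bool (odd n)"] K
  show ?thesis unfolding walking_time_def[abs_def] by measurable
qed

text \<open>
  The canonical space of orders: order size and item positions.
\<close>

definition items_space :: "(nat \<times> (nat \<Rightarrow> nat \<times> real)) measure" where
  "items_space = count_space UNIV \<Otimes>\<^sub>M PiM UNIV (\<lambda>_. count_space UNIV \<Otimes>\<^sub>M borel)"

lemma measurable_items_space:
  "fst \<in> measurable items_space (count_space UNIV)"
  "(\<lambda>x. fst (snd x j)) \<in> measurable items_space (count_space UNIV)"
  "(\<lambda>x. snd (snd x j)) \<in> borel_measurable items_space"
  unfolding items_space_def by measurable

text \<open>
  The walking time is a measurable function of order size and positions, which is the form that the
  independence assumption requires.
\<close>

lemma walking_time_items_space:
  "walking_time k c d M aisle loc \<omega>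
   = walking_time k c d fst (\<lambda>j x. fst (snd x j)) (\<lambda>j x. snd (snd x j)) (M \<omega>, \<lambda>j. (aisle j \<omega>, loc j \<omega>))"
  unfolding walking_time_def visited_aisles_def last_aisle_def farthest_location_def items_in_aisle_def
  by (simp only: fst_conv snd_conv)

locale warehouse_picking = warehouse +
  fixes P :: "'a \<Rightarrow> real" and pick :: "nat \<Rightarrow> 'a \<Rightarrow> real"
  assumes measurable_P [measurable]: "P \<in> borel_measurable \<Omega>"
    and P_square_integrable: "integrable \<Omega> (\<lambda>\<omega>. (P \<omega>)\<^sup>2)"
    and indep_pick: "indep_vars (\<lambda>_. borel) pick UNIV"
    and distr_pick: "\<And>j. distr \<Omega> borel (pick j) = distr \<Omega> borel P"
    and indep_pick_items: "indep_rvs \<Omega> (PiM UNIV (\<lambda>_. borel)) (\<lambda>\<omega> j. pick j \<omega>)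
          (count_space UNIV \<Otimes>\<^sub>M PiM UNIV (\<lambda>_. count_space UNIV \<Otimes>\<^sub>M borel))
          (\<lambda>\<omega>. (M \<omega>, \<lambda>j. (aisle j \<omega>, loc j \<omega>)))"
begin

lemma measurable_pick [measurable]: "pick j \<in> borel_measurable \<Omega>"
  using indep_pick by (auto simp: indep_vars_def)

lemma integrable_pick_iff:
  "f \<in> borel_measurable borel \<Longrightarrow> integrable \<Omega> (\<lambda>\<omega>. f (pick j \<omega>) :: real) \<longleftrightarrow> integrable \<Omega> (\<lambda>\<omega>. f (P \<omega>))"
  using integrable_distr_eq[of "pick j" \<Omega> borel f] integrable_distr_eq[of P \<Omega> borel f] distr_pick[of j]
  by simp

lemma integral_pick:
  "f \<in> borel_measurable borel \<Longrightarrow> (\<integral>\<omega>. (f (pick j \<omega>) :: real) \<partial>\<Omega>) = (\<integral>\<omega>. f (P \<omega>) \<partial>\<Omega>)"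
  using integral_distr[of "pick j" \<Omega> borel f] integral_distr[of P \<Omega> borel f] distr_pick[of j]
  by simp

lemma integrable_P: "integrable \<Omega> P"
  using P_square_integrable by (rule square_integrable_imp_integrable[OF measurable_P])

lemma integrable_pick: "integrable \<Omega> (pick j)"
  using integrable_pick_iff[of "\<lambda>x. x" j] integrable_P by simp

abbreviation "total_of n \<omega> \<equiv> \<Sum>j<n. pick j \<omega>"

lemma integral_total: "(\<integral>\<omega>. total_of n \<omega> \<partial>\<Omega>) = real n * (\<integral>\<omega>. P \<omega> \<partial>\<Omega>)"
  using integral_pick[of "\<lambda>x. x"] by (simp add: integrable_pick)

lemma total_square:
  "integrable \<Omega> (\<lambda>\<omega>. (total_of n \<omega>)\<^sup>2)"
  "(\<integral>\<omega>. (total_of n \<omega>)\<^sup>2 \<partial>\<Omega>)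
     = real n * (\<integral>\<omega>. (P \<omega>)\<^sup>2 \<partial>\<Omega>) + real n * (real n - 1) * (\<integral>\<omega>. P \<omega> \<partial>\<Omega>)\<^sup>2"
proof (induction n)
  case (Suc n)
  {
    case 1
    have "indep_var borel (pick n) borel (total_of n)"
      using indep_pick by (intro indep_vars_sum) (auto intro: indep_vars_subset)
    note cross = indep_var_integrable[OF this integrable_pick] indep_var_lebesgue_integral[OF this integrable_pick]
    have sq: "(total_of (Suc n) \<omega>)\<^sup>2 = (total_of n \<omega>)\<^sup>2 + (2 * (pick n \<omega> * total_of n \<omega>) + (pick n \<omega>)\<^sup>2)" for \<omega>
      by (simp add: power2_eq_square algebra_simps)
    have i: "integrable \<Omega> (\<lambda>\<omega>. pick n \<omega> * total_of n \<omega>)"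
      by (rule cross) (simp add: integrable_pick)
    have p2: "integrable \<Omega> (\<lambda>\<omega>. (pick n \<omega>)\<^sup>2)"
      using integrable_pick_iff[of "\<lambda>x. x\<^sup>2" n] P_square_integrable by simp
    have "integrable \<Omega> (\<lambda>\<omega>. (total_of (Suc n) \<omega>)\<^sup>2)"
      unfolding sq using i p2 Suc.IH(1) by (intro Bochner_Integration.integrable_add integrable_mult_right)
    moreover have "(\<integral>\<omega>. pick n \<omega> * total_of n \<omega> \<partial>\<Omega>) = real n * (\<integral>\<omega>. P \<omega> \<partial>\<Omega>)\<^sup>2"
      using cross(2) integral_total[of n] integral_pick[of "\<lambda>x. x" n]
      by (simp add: integrable_pick power2_eq_square)
    then have "(\<integral>\<omega>. (total_of (Suc n) \<omega>)\<^sup>2 \<partial>\<Omega>)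
       = real (Suc n) * (\<integral>\<omega>. (P \<omega>)\<^sup>2 \<partial>\<Omega>) + real (Suc n) * (real (Suc n) - 1) * (\<integral>\<omega>. P \<omega> \<partial>\<Omega>)\<^sup>2"
      unfolding sq using i p2 Suc.IH integral_pick[of "\<lambda>x. x\<^sup>2" n]
      by (simp add: algebra_simps del: sum.lessThan_Suc)
    ultimately show ?case and "(\<integral>\<omega>. (total_of (Suc n) \<omega>)\<^sup>2 \<partial>\<Omega>)
       = real (Suc n) * (\<integral>\<omega>. (P \<omega>)\<^sup>2 \<partial>\<Omega>) + real (Suc n) * (real (Suc n) - 1) * (\<integral>\<omega>. P \<omega> \<partial>\<Omega>)\<^sup>2"
      by auto
  }
qed simp_all

text \<open>
  On the event \<open>M = n\<close> the random index is constant, and there \<open>X n\<close> is independent of the remaining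
  factor; hence \<open>X (M)\<close> may be replaced by the means of the \<open>X n\<close> evaluated at \<open>M\<close>. Partial sums of
  the picking times and their squares are the two instances.
\<close>

lemma random_index_independent:
  fixes f :: "nat \<Rightarrow> (nat \<Rightarrow> real) \<Rightarrow> real" and g :: "nat \<times> (nat \<Rightarrow> nat \<times> real) \<Rightarrow> real"
  defines "X \<equiv> \<lambda>n \<omega>. f n (\<lambda>j. pick j \<omega>)" and "Y \<equiv> \<lambda>\<omega>. g (M \<omega>, \<lambda>j. (aisle j \<omega>, loc j \<omega>))"
  assumes f: "\<And>n. f n \<in> borel_measurable (PiM UNIV (\<lambda>_. borel))"
    and g [measurable]: "g \<in> borel_measurable items_space"
    and X: "\<And>n. integrable \<Omega> (X n)" and Y: "integrable \<Omega> Y"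
    and bound: "\<And>n. (\<integral>\<omega>. \<bar>X n \<omega>\<bar> \<partial>\<Omega>) \<le> b n" and bY: "integrable \<Omega> (\<lambda>\<omega>. b (M \<omega>) * \<bar>Y \<omega>\<bar>)"
  shows "integrable \<Omega> (\<lambda>\<omega>. X (M \<omega>) \<omega> * Y \<omega>)"
    and "(\<integral>\<omega>. X (M \<omega>) \<omega> * Y \<omega> \<partial>\<Omega>) = (\<integral>\<omega>. (\<integral>\<omega>'. X (M \<omega>) \<omega>' \<partial>\<Omega>) * Y \<omega> \<partial>\<Omega>)"
proof -
  have [measurable]: "X n \<in> borel_measurable \<Omega>" "Y \<in> borel_measurable \<Omega>" for n using X Y by auto
  have [measurable]: "(\<lambda>\<omega>. X (M \<omega>) \<omega>) \<in> borel_measurable \<Omega>"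
    by (rule measurable_compose_countable) auto
  have b0: "0 \<le> b n" for n
    by (rule order_trans[OF Bochner_Integration.integral_nonneg bound]) simp
  note [measurable] = measurable_items_space(1)
  have prod: "integrable \<Omega> (\<lambda>\<omega>. e (\<lambda>j. pick j \<omega>) * (of_bool (M \<omega> = n) * y (Y \<omega>)))"
    "(\<integral>\<omega>. e (\<lambda>j. pick j \<omega>) * (of_bool (M \<omega> = n) * y (Y \<omega>)) \<partial>\<Omega>)
      = (\<integral>\<omega>. e (\<lambda>j. pick j \<omega>) \<partial>\<Omega>) * (\<integral>\<omega>. of_bool (M \<omega> = n) * y (Y \<omega>) \<partial>\<Omega>)"
    if e: "e \<in> borel_measurable (PiM UNIV (\<lambda>_. borel))" "integrable \<Omega> (\<lambda>\<omega>. e (\<lambda>j. pick j \<omega>))"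
      and y [measurable]: "y \<in> borel_measurable borel" and iy: "integrable \<Omega> (\<lambda>\<omega>. y (Y \<omega>))"
    for e :: "(nat \<Rightarrow> real) \<Rightarrow> real" and y :: "real \<Rightarrow> real" and n
  proof -
    have g': "(\<lambda>z. of_bool (fst z = n) * y (g z)) \<in> borel_measurable
        (count_space UNIV \<Otimes>\<^sub>M PiM UNIV (\<lambda>_. count_space UNIV \<Otimes>\<^sub>M borel))"
      unfolding items_space_def[symmetric] by measurable
    have i: "integrable \<Omega> (\<lambda>\<omega>. of_bool (M \<omega> = n) * y (Y \<omega>))"
      by (rule Bochner_Integration.integrable_bound[OF iy]) auto
    show "integrable \<Omega> (\<lambda>\<omega>. e (\<lambda>j. pick j \<omega>) * (of_bool (M \<omega> = n) * y (Y \<omega>)))"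
      using indep_rvs_integral_mult(1)[where f = e, OF indep_pick_items e(1) g' e(2)] i by (simp add: Y_def)
    show "(\<integral>\<omega>. e (\<lambda>j. pick j \<omega>) * (of_bool (M \<omega> = n) * y (Y \<omega>)) \<partial>\<Omega>)
      = (\<integral>\<omega>. e (\<lambda>j. pick j \<omega>) \<partial>\<Omega>) * (\<integral>\<omega>. of_bool (M \<omega> = n) * y (Y \<omega>) \<partial>\<Omega>)"
      using indep_rvs_integral_mult(2)[where f = e, OF indep_pick_items e(1) g' e(2)] i by (simp add: Y_def)
  qed
  have fibre: "of_bool (M \<omega> = n) * (X (M \<omega>) \<omega> * Y \<omega>) = X n \<omega> * (of_bool (M \<omega> = n) * Y \<omega>)" for n \<omega>
    by auto
  have absf: "(\<lambda>x. \<bar>f n x\<bar>) \<in> borel_measurable (PiM UNIV (\<lambda>_. borel))" for n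
    using f[of n] by measurable
  show int: "integrable \<Omega> (\<lambda>\<omega>. X (M \<omega>) \<omega> * Y \<omega>)"
  proof (rule integrable_by_size[OF measurable_M _ bY])
    show "integrable \<Omega> (\<lambda>\<omega>. of_bool (M \<omega> = n) * (X (M \<omega>) \<omega> * Y \<omega>))" for n
      unfolding fibre using prod(1)[of "f n" "\<lambda>y. y" n] f X Y by (simp add: X_def)
    fix n
    have "(\<integral>\<omega>. of_bool (M \<omega> = n) * \<bar>X (M \<omega>) \<omega> * Y \<omega>\<bar> \<partial>\<Omega>)
        = (\<integral>\<omega>. \<bar>X n \<omega>\<bar> * (of_bool (M \<omega> = n) * \<bar>Y \<omega>\<bar>) \<partial>\<Omega>)"
      by (intro Bochner_Integration.integral_cong) (auto simp: abs_mult)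
    also have "\<dots> = (\<integral>\<omega>. \<bar>X n \<omega>\<bar> \<partial>\<Omega>) * (\<integral>\<omega>. of_bool (M \<omega> = n) * \<bar>Y \<omega>\<bar> \<partial>\<Omega>)"
      using prod(2)[of "\<lambda>x. \<bar>f n x\<bar>" abs n, OF absf] integrable_abs[OF X[of n]] integrable_abs[OF Y]
      by (simp add: X_def)
    also have "\<dots> \<le> b n * (\<integral>\<omega>. of_bool (M \<omega> = n) * \<bar>Y \<omega>\<bar> \<partial>\<Omega>)"
      by (intro mult_right_mono bound Bochner_Integration.integral_nonneg) auto
    also have "\<dots> = (\<integral>\<omega>. of_bool (M \<omega> = n) * (b (M \<omega>) * \<bar>Y \<omega>\<bar>) \<partial>\<Omega>)"
      unfolding integral_mult_right_zero[symmetric]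
      by (intro Bochner_Integration.integral_cong) auto
    finally show "(\<integral>\<omega>. of_bool (M \<omega> = n) * \<bar>X (M \<omega>) \<omega> * Y \<omega>\<bar> \<partial>\<Omega>)
        \<le> (\<integral>\<omega>. of_bool (M \<omega> = n) * (b (M \<omega>) * \<bar>Y \<omega>\<bar>) \<partial>\<Omega>)" .
  qed (auto simp: b0)
  show "(\<integral>\<omega>. X (M \<omega>) \<omega> * Y \<omega> \<partial>\<Omega>) = (\<integral>\<omega>. (\<integral>\<omega>'. X (M \<omega>) \<omega>' \<partial>\<Omega>) * Y \<omega> \<partial>\<Omega>)"
  proof (rule integral_eq_by_size[OF measurable_M int])
    show "integrable \<Omega> (\<lambda>\<omega>. (\<integral>\<omega>'. X (M \<omega>) \<omega>' \<partial>\<Omega>) * Y \<omega>)"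
    proof (rule Bochner_Integration.integrable_bound[OF bY])
      show "AE \<omega> in \<Omega>. norm ((\<integral>\<omega>'. X (M \<omega>) \<omega>' \<partial>\<Omega>) * Y \<omega>) \<le> norm (b (M \<omega>) * \<bar>Y \<omega>\<bar>)"
        using order_trans[OF integral_abs_bound bound] b0
        by (intro AE_I2) (auto simp: abs_mult intro!: mult_right_mono)
      show "(\<lambda>\<omega>. (\<integral>\<omega>'. X (M \<omega>) \<omega>' \<partial>\<Omega>) * Y \<omega>) \<in> borel_measurable \<Omega>"
        by (intro borel_measurable_times measurable_compose[OF measurable_M]) auto
    qed
    fix n
    show "(\<integral>\<omega>. of_bool (M \<omega> = n) * (X (M \<omega>) \<omega> * Y \<omega>) \<partial>\<Omega>)
        = (\<integral>\<omega>. of_bool (M \<omega> = n) * ((\<integral>\<omega>'. X (M \<omega>) \<omega>' \<partial>\<Omega>) * Y \<omega>) \<partial>\<Omega>)"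
    proof -
      have "(\<integral>\<omega>. of_bool (M \<omega> = n) * (X (M \<omega>) \<omega> * Y \<omega>) \<partial>\<Omega>)
          = (\<integral>\<omega>. X n \<omega> \<partial>\<Omega>) * (\<integral>\<omega>. of_bool (M \<omega> = n) * Y \<omega> \<partial>\<Omega>)"
        unfolding fibre using prod(2)[of "f n" "\<lambda>y. y" n] f X Y by (simp add: X_def)
      also have "\<dots> = (\<integral>\<omega>. of_bool (M \<omega> = n) * ((\<integral>\<omega>'. X (M \<omega>) \<omega>' \<partial>\<Omega>) * Y \<omega>) \<partial>\<Omega>)"
        unfolding integral_mult_right_zero[symmetric]
        by (intro Bochner_Integration.integral_cong) auto
      finally show ?thesis .
    qed
  qed
qed

end

section \<open>Moments of the total picking time\<close>

context warehouse_picking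
begin

lemma integrable_items_fun:
  "integrable \<Omega> (\<lambda>\<omega>. real (M \<omega>) ^ e * (\<phi> (visited_aisles k M aisle \<omega>) (last_aisle k M aisle \<omega>) * A \<omega> ^ q))"
  if "e \<le> 1"
proof -
  have "integrable \<Omega> (\<lambda>\<omega>. real (M \<omega>) ^ e)"
    using that integrable_size by (cases e) auto
  from integrable_visited_last_farthest[of "\<lambda>n. real n ^ e", OF this, of "\<lambda>S. \<phi> (card S) (Max (insert 0 S))" q]
  show ?thesis by (simp only: visited_aisles_eq_card last_aisle_eq_Max)
qed

lemma integrable_basic:
  "integrable \<Omega> J" "integrable \<Omega> I" "integrable \<Omega> K" "integrable \<Omega> (\<lambda>\<omega>. I \<omega> * A \<omega>)"
  "integrable \<Omega> (\<lambda>\<omega>. (J \<omega>)\<^sup>2)" "integrable \<Omega> (\<lambda>\<omega>. (K \<omega>)\<^sup>2)" "integrable \<Omega> (\<lambda>\<omega>. I \<omega> * (A \<omega>)\<^sup>2)"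
  "integrable \<Omega> (\<lambda>\<omega>. I \<omega> * A \<omega> * J \<omega>)" "integrable \<Omega> (\<lambda>\<omega>. I \<omega> * J \<omega>)" "integrable \<Omega> (\<lambda>\<omega>. K \<omega> * J \<omega>)"
  "integrable \<Omega> (\<lambda>\<omega>. I \<omega> * A \<omega> * K \<omega>)" "integrable \<Omega> (\<lambda>\<omega>. I \<omega> * K \<omega>)"
  using integrable_items_fun[of 0 "\<lambda>j n. real j" 0] integrable_items_fun[of 0 "\<lambda>j n. of_bool (odd j)" 0]
    integrable_items_fun[of 0 "\<lambda>j n. real n" 0] integrable_items_fun[of 0 "\<lambda>j n. of_bool (odd j)" 1]
    integrable_items_fun[of 0 "\<lambda>j n. (real j)\<^sup>2" 0] integrable_items_fun[of 0 "\<lambda>j n. (real n)\<^sup>2" 0]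
    integrable_items_fun[of 0 "\<lambda>j n. of_bool (odd j)" 2] integrable_items_fun[of 0 "\<lambda>j n. of_bool (odd j) * real j" 1]
    integrable_items_fun[of 0 "\<lambda>j n. of_bool (odd j) * real j" 0] integrable_items_fun[of 0 "\<lambda>j n. real n * real j" 0]
    integrable_items_fun[of 0 "\<lambda>j n. of_bool (odd j) * real n" 1] integrable_items_fun[of 0 "\<lambda>j n. of_bool (odd j) * real n" 0]
  unfolding power_0 power_one_right mult_1 mult_1_right
  by (simp_all only: le0 mult_ac)

lemma integrable_size_basic:
  "integrable \<Omega> (\<lambda>\<omega>. real (M \<omega>) * J \<omega>)" "integrable \<Omega> (\<lambda>\<omega>. real (M \<omega>) * I \<omega>)"
  "integrable \<Omega> (\<lambda>\<omega>. real (M \<omega>) * K \<omega>)" "integrable \<Omega> (\<lambda>\<omega>. real (M \<omega>) * I \<omega> * A \<omega>)"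
  using integrable_items_fun[of 1 "\<lambda>j n. real j" 0] integrable_items_fun[of 1 "\<lambda>j n. of_bool (odd j)" 0]
    integrable_items_fun[of 1 "\<lambda>j n. real n" 0] integrable_items_fun[of 1 "\<lambda>j n. of_bool (odd j)" 1]
  unfolding power_0 power_one_right mult_1 mult_1_right
  by (simp_all only: order_refl mult_ac)

lemma walking_time_moments:
  shows "integrable \<Omega> (walking_time k c d M aisle loc)"
    and "(\<integral>\<omega>. walking_time k c d M aisle loc \<omega> \<partial>\<Omega>) = c * (\<integral>\<omega>. J \<omega> \<partial>\<Omega>) + 2 * c * (\<integral>\<omega>. I \<omega> * A \<omega> \<partial>\<Omega>)
      - c * (\<integral>\<omega>. I \<omega> \<partial>\<Omega>) + d * ((\<integral>\<omega>. K \<omega> \<partial>\<Omega>) - 1)"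
proof -
  have w: "walking_time k c d M aisle loc = (\<lambda>\<omega>. c * J \<omega> + 2 * c * (I \<omega> * A \<omega>) - c * I \<omega> + d * K \<omega> - d)"
    by (rule ext) (simp add: walking_time_def algebra_simps)
  note [simp] = integrable_basic
  show "integrable \<Omega> (walking_time k c d M aisle loc)" unfolding w by simp
  show "(\<integral>\<omega>. walking_time k c d M aisle loc \<omega> \<partial>\<Omega>) = c * (\<integral>\<omega>. J \<omega> \<partial>\<Omega>) + 2 * c * (\<integral>\<omega>. I \<omega> * A \<omega> \<partial>\<Omega>)
      - c * (\<integral>\<omega>. I \<omega> \<partial>\<Omega>) + d * ((\<integral>\<omega>. K \<omega> \<partial>\<Omega>) - 1)"
    unfolding w by (simp add: prob_space right_diff_distrib)
qed

lemma walking_time_square_moments: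
  shows "integrable \<Omega> (\<lambda>\<omega>. (walking_time k c d M aisle loc \<omega>)\<^sup>2)"
    and "(\<integral>\<omega>. (walking_time k c d M aisle loc \<omega>)\<^sup>2 \<partial>\<Omega>) =
        c\<^sup>2 * (\<integral>\<omega>. (J \<omega>)\<^sup>2 \<partial>\<Omega>) + 4 * c\<^sup>2 * (\<integral>\<omega>. I \<omega> * (A \<omega>)\<^sup>2 \<partial>\<Omega>) + c\<^sup>2 * (\<integral>\<omega>. I \<omega> \<partial>\<Omega>)
      + d\<^sup>2 * ((\<integral>\<omega>. (K \<omega>)\<^sup>2 \<partial>\<Omega>) - 2 * (\<integral>\<omega>. K \<omega> \<partial>\<Omega>) + 1)
      + 4 * c\<^sup>2 * (\<integral>\<omega>. I \<omega> * A \<omega> * J \<omega> \<partial>\<Omega>) - 2 * c\<^sup>2 * (\<integral>\<omega>. I \<omega> * J \<omega> \<partial>\<Omega>)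
      + 2 * c * d * ((\<integral>\<omega>. K \<omega> * J \<omega> \<partial>\<Omega>) - (\<integral>\<omega>. J \<omega> \<partial>\<Omega>))
      - 4 * c\<^sup>2 * (\<integral>\<omega>. I \<omega> * A \<omega> \<partial>\<Omega>)
      + 4 * c * d * ((\<integral>\<omega>. I \<omega> * A \<omega> * K \<omega> \<partial>\<Omega>) - (\<integral>\<omega>. I \<omega> * A \<omega> \<partial>\<Omega>))
      - 2 * c * d * ((\<integral>\<omega>. I \<omega> * K \<omega> \<partial>\<Omega>) - (\<integral>\<omega>. I \<omega> \<partial>\<Omega>))"
proof -
  have w: "(walking_time k c d M aisle loc \<omega>)\<^sup>2 =
        c\<^sup>2 * (J \<omega>)\<^sup>2 + 4 * c\<^sup>2 * (I \<omega> * (A \<omega>)\<^sup>2) + c\<^sup>2 * I \<omega> + d\<^sup>2 * ((K \<omega>)\<^sup>2 - 2 * K \<omega> + 1)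
      + 4 * c\<^sup>2 * (I \<omega> * A \<omega> * J \<omega>) - 2 * c\<^sup>2 * (I \<omega> * J \<omega>) + 2 * c * d * (K \<omega> * J \<omega> - J \<omega>)
      - 4 * c\<^sup>2 * (I \<omega> * A \<omega>) + 4 * c * d * (I \<omega> * A \<omega> * K \<omega> - I \<omega> * A \<omega>)
      - 2 * c * d * (I \<omega> * K \<omega> - I \<omega>)" for \<omega>
  \<comment> \<open>The parity indicator is idempotent, so the square is linear in it.\<close>
  proof (cases "odd (visited_aisles k M aisle \<omega>)")
    case True
    then have "I \<omega> = 1" by simp
    then show ?thesis unfolding walking_time_def power2_eq_square by (simp only:) (simp add: algebra_simps)
  next
    case False
    then have "I \<omega> = 0" by simp
    then show ?thesis unfolding walking_time_def power2_eq_square by (simp only:) (simp add: algebra_simps)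
  qed
  note [simp] = integrable_basic
  show "integrable \<Omega> (\<lambda>\<omega>. (walking_time k c d M aisle loc \<omega>)\<^sup>2)" unfolding w by simp
  show "(\<integral>\<omega>. (walking_time k c d M aisle loc \<omega>)\<^sup>2 \<partial>\<Omega>) =
        c\<^sup>2 * (\<integral>\<omega>. (J \<omega>)\<^sup>2 \<partial>\<Omega>) + 4 * c\<^sup>2 * (\<integral>\<omega>. I \<omega> * (A \<omega>)\<^sup>2 \<partial>\<Omega>) + c\<^sup>2 * (\<integral>\<omega>. I \<omega> \<partial>\<Omega>)
      + d\<^sup>2 * ((\<integral>\<omega>. (K \<omega>)\<^sup>2 \<partial>\<Omega>) - 2 * (\<integral>\<omega>. K \<omega> \<partial>\<Omega>) + 1)
      + 4 * c\<^sup>2 * (\<integral>\<omega>. I \<omega> * A \<omega> * J \<omega> \<partial>\<Omega>) - 2 * c\<^sup>2 * (\<integral>\<omega>. I \<omega> * J \<omega> \<partial>\<Omega>)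
      + 2 * c * d * ((\<integral>\<omega>. K \<omega> * J \<omega> \<partial>\<Omega>) - (\<integral>\<omega>. J \<omega> \<partial>\<Omega>))
      - 4 * c\<^sup>2 * (\<integral>\<omega>. I \<omega> * A \<omega> \<partial>\<Omega>)
      + 4 * c * d * ((\<integral>\<omega>. I \<omega> * A \<omega> * K \<omega> \<partial>\<Omega>) - (\<integral>\<omega>. I \<omega> * A \<omega> \<partial>\<Omega>))
      - 2 * c * d * ((\<integral>\<omega>. I \<omega> * K \<omega> \<partial>\<Omega>) - (\<integral>\<omega>. I \<omega> \<partial>\<Omega>))"
    unfolding w by (simp add: prob_space del: sum_of_bool_eq)
qed

lemma walking_time_size_moments:
  shows "integrable \<Omega> (\<lambda>\<omega>. real (M \<omega>) * walking_time k c d M aisle loc \<omega>)"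
    and "(\<integral>\<omega>. real (M \<omega>) * walking_time k c d M aisle loc \<omega> \<partial>\<Omega>) =
      c * (\<integral>\<omega>. real (M \<omega>) * J \<omega> \<partial>\<Omega>) + 2 * c * (\<integral>\<omega>. real (M \<omega>) * I \<omega> * A \<omega> \<partial>\<Omega>)
      - c * (\<integral>\<omega>. real (M \<omega>) * I \<omega> \<partial>\<Omega>) + d * ((\<integral>\<omega>. real (M \<omega>) * K \<omega> \<partial>\<Omega>) - (\<integral>\<omega>. real (M \<omega>) \<partial>\<Omega>))"
proof -
  have w: "real (M \<omega>) * walking_time k c d M aisle loc \<omega> = c * (real (M \<omega>) * J \<omega>)
      + 2 * c * (real (M \<omega>) * I \<omega> * A \<omega>) - c * (real (M \<omega>) * I \<omega>) + d * (real (M \<omega>) * K \<omega> - real (M \<omega>))" for \<omega>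
    by (simp add: walking_time_def algebra_simps)
  note [simp] = integrable_size_basic integrable_size
  show "integrable \<Omega> (\<lambda>\<omega>. real (M \<omega>) * walking_time k c d M aisle loc \<omega>)" unfolding w by simp
  show "(\<integral>\<omega>. real (M \<omega>) * walking_time k c d M aisle loc \<omega> \<partial>\<Omega>) =
      c * (\<integral>\<omega>. real (M \<omega>) * J \<omega> \<partial>\<Omega>) + 2 * c * (\<integral>\<omega>. real (M \<omega>) * I \<omega> * A \<omega> \<partial>\<Omega>)
      - c * (\<integral>\<omega>. real (M \<omega>) * I \<omega> \<partial>\<Omega>) + d * ((\<integral>\<omega>. real (M \<omega>) * K \<omega> \<partial>\<Omega>) - (\<integral>\<omega>. real (M \<omega>) \<partial>\<Omega>))"
    unfolding w by simp
qed

text \<open>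
  Wald's identity in the presence of a further factor that depends on the order.
\<close>

lemma total_times_independent:
  assumes g: "g \<in> borel_measurable items_space"
    and Y: "integrable \<Omega> (\<lambda>\<omega>. g (M \<omega>, \<lambda>j. (aisle j \<omega>, loc j \<omega>)))"
    and MY: "integrable \<Omega> (\<lambda>\<omega>. real (M \<omega>) * g (M \<omega>, \<lambda>j. (aisle j \<omega>, loc j \<omega>)))"
  shows "integrable \<Omega> (\<lambda>\<omega>. total_of (M \<omega>) \<omega> * g (M \<omega>, \<lambda>j. (aisle j \<omega>, loc j \<omega>)))"
    and "(\<integral>\<omega>. total_of (M \<omega>) \<omega> * g (M \<omega>, \<lambda>j. (aisle j \<omega>, loc j \<omega>)) \<partial>\<Omega>)
       = (\<integral>\<omega>. P \<omega> \<partial>\<Omega>) * (\<integral>\<omega>. real (M \<omega>) * g (M \<omega>, \<lambda>j. (aisle j \<omega>, loc j \<omega>)) \<partial>\<Omega>)"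
proof -
  let ?Y = "\<lambda>\<omega>. g (M \<omega>, \<lambda>j. (aisle j \<omega>, loc j \<omega>))"
  let ?p = "\<integral>\<omega>. \<bar>P \<omega>\<bar> \<partial>\<Omega>"
  have f: "(\<lambda>x. \<Sum>j<n. x j) \<in> borel_measurable (PiM UNIV (\<lambda>_. borel :: real measure))" for n :: nat
    by measurable
  have bound: "(\<integral>\<omega>. \<bar>total_of n \<omega>\<bar> \<partial>\<Omega>) \<le> real n * ?p" for n
  proof -
    have "(\<integral>\<omega>. \<bar>total_of n \<omega>\<bar> \<partial>\<Omega>) \<le> (\<integral>\<omega>. (\<Sum>j<n. \<bar>pick j \<omega>\<bar>) \<partial>\<Omega>)"
      using integrable_pick by (intro integral_mono) auto
    also have "\<dots> = real n * ?p"
      using integral_pick[of abs] integrable_pick by simp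
    finally show ?thesis .
  qed
  have "integrable \<Omega> (\<lambda>\<omega>. real (M \<omega>) * ?p * \<bar>?Y \<omega>\<bar>)"
    using integrable_mult_right[OF integrable_abs[OF MY], of ?p] by (simp add: abs_mult mult_ac)
  note rule = random_index_independent[where f = "\<lambda>n x. \<Sum>j<n. x j", OF f g _ Y bound this]
  show "integrable \<Omega> (\<lambda>\<omega>. total_of (M \<omega>) \<omega> * ?Y \<omega>)"
    by (rule rule(1)) (simp add: integrable_pick)
  have "(\<integral>\<omega>. total_of (M \<omega>) \<omega> * ?Y \<omega> \<partial>\<Omega>) = (\<integral>\<omega>. (\<integral>\<omega>'. total_of (M \<omega>) \<omega>' \<partial>\<Omega>) * ?Y \<omega> \<partial>\<Omega>)"
    by (rule rule(2)) (simp add: integrable_pick)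
  then show "(\<integral>\<omega>. total_of (M \<omega>) \<omega> * ?Y \<omega> \<partial>\<Omega>) = (\<integral>\<omega>. P \<omega> \<partial>\<Omega>) * (\<integral>\<omega>. real (M \<omega>) * ?Y \<omega> \<partial>\<Omega>)"
    unfolding integral_total mult.assoc mult.left_commute[of _ "\<integral>\<omega>. P \<omega> \<partial>\<Omega>"] integral_mult_right_zero .
qed

lemma integral_random_total:
  "integrable \<Omega> (\<lambda>\<omega>. total_of (M \<omega>) \<omega>)"
  "(\<integral>\<omega>. total_of (M \<omega>) \<omega> \<partial>\<Omega>) = (\<integral>\<omega>. real (M \<omega>) \<partial>\<Omega>) * (\<integral>\<omega>. P \<omega> \<partial>\<Omega>)"
proof -
  have g: "(\<lambda>_. 1 :: real) \<in> borel_measurable items_space" and Y: "integrable \<Omega> (\<lambda>\<omega>. 1 :: real)"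
    and MY: "integrable \<Omega> (\<lambda>\<omega>. real (M \<omega>) * 1)"
    using integrable_size by simp_all
  note total = total_times_independent[OF g Y MY, unfolded mult_1_right]
  show "integrable \<Omega> (\<lambda>\<omega>. total_of (M \<omega>) \<omega>)" by (rule total(1))
  show "(\<integral>\<omega>. total_of (M \<omega>) \<omega> \<partial>\<Omega>) = (\<integral>\<omega>. real (M \<omega>) \<partial>\<Omega>) * (\<integral>\<omega>. P \<omega> \<partial>\<Omega>)"
    unfolding total(2) by (rule mult.commute)
qed

lemma integral_random_total_square:
  "integrable \<Omega> (\<lambda>\<omega>. (total_of (M \<omega>) \<omega>)\<^sup>2)"
  "(\<integral>\<omega>. (total_of (M \<omega>) \<omega>)\<^sup>2 \<partial>\<Omega>)
   = (\<integral>\<omega>. real (M \<omega>) * (real (M \<omega>) - 1) \<partial>\<Omega>) * (\<integral>\<omega>. P \<omega> \<partial>\<Omega>)\<^sup>2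
     + (\<integral>\<omega>. real (M \<omega>) \<partial>\<Omega>) * (\<integral>\<omega>. (P \<omega>)\<^sup>2 \<partial>\<Omega>)"
proof -
  let ?c = "\<lambda>n. \<integral>\<omega>. (total_of n \<omega>)\<^sup>2 \<partial>\<Omega>"
  have f: "(\<lambda>x. (\<Sum>j<n. x j)\<^sup>2) \<in> borel_measurable (PiM UNIV (\<lambda>_. borel :: real measure))" for n :: nat
    by measurable
  have M2: "integrable \<Omega> (\<lambda>\<omega>. real (M \<omega>) * (real (M \<omega>) - 1))"
    using M_square_integrable integrable_size by (simp add: right_diff_distrib power2_eq_square)
  have c: "?c (M \<omega>) = real (M \<omega>) * (\<integral>\<omega>. (P \<omega>)\<^sup>2 \<partial>\<Omega>) + real (M \<omega>) * (real (M \<omega>) - 1) * (\<integral>\<omega>. P \<omega> \<partial>\<Omega>)\<^sup>2" for \<omega>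
    by (rule total_square(2))
  have "integrable \<Omega> (\<lambda>\<omega>. ?c (M \<omega>) * \<bar>1\<bar>)"
    unfolding c abs_one mult_1_right
    by (intro Bochner_Integration.integrable_add integrable_mult_left M2 integrable_size)
  moreover have "(\<integral>\<omega>. \<bar>(total_of n \<omega>)\<^sup>2\<bar> \<partial>\<Omega>) \<le> ?c n" for n
    by (simp only: abs_power2 order_refl)
  moreover have "(\<lambda>_. 1 :: real) \<in> borel_measurable items_space" "integrable \<Omega> (\<lambda>\<omega>. 1 :: real)"
    by simp_all
  ultimately have rule: "integrable \<Omega> (\<lambda>\<omega>. (total_of (M \<omega>) \<omega>)\<^sup>2 * 1)"
    "(\<integral>\<omega>. (total_of (M \<omega>) \<omega>)\<^sup>2 * 1 \<partial>\<Omega>) = (\<integral>\<omega>. ?c (M \<omega>) * 1 \<partial>\<Omega>)"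
    using random_index_independent[where f = "\<lambda>n x. (\<Sum>j<n. x j)\<^sup>2" and g = "\<lambda>_. 1" and b = ?c, OF f _ total_square(1)]
    by blast+
  show "integrable \<Omega> (\<lambda>\<omega>. (total_of (M \<omega>) \<omega>)\<^sup>2)"
    using rule(1) by (simp only: mult_1_right)
  have "(\<integral>\<omega>. (total_of (M \<omega>) \<omega>)\<^sup>2 \<partial>\<Omega>)
    = (\<integral>\<omega>. real (M \<omega>) * (\<integral>\<omega>. (P \<omega>)\<^sup>2 \<partial>\<Omega>) + real (M \<omega>) * (real (M \<omega>) - 1) * (\<integral>\<omega>. P \<omega> \<partial>\<Omega>)\<^sup>2 \<partial>\<Omega>)"
    using rule(2) unfolding c mult_1_right .
  also have "\<dots> = (\<integral>\<omega>. real (M \<omega>) * (\<integral>\<omega>. (P \<omega>)\<^sup>2 \<partial>\<Omega>) \<partial>\<Omega>)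
      + (\<integral>\<omega>. real (M \<omega>) * (real (M \<omega>) - 1) * (\<integral>\<omega>. P \<omega> \<partial>\<Omega>)\<^sup>2 \<partial>\<Omega>)"
    by (intro Bochner_Integration.integral_add integrable_mult_left M2 integrable_size)
  finally show "(\<integral>\<omega>. (total_of (M \<omega>) \<omega>)\<^sup>2 \<partial>\<Omega>)
   = (\<integral>\<omega>. real (M \<omega>) * (real (M \<omega>) - 1) \<partial>\<Omega>) * (\<integral>\<omega>. P \<omega> \<partial>\<Omega>)\<^sup>2
     + (\<integral>\<omega>. real (M \<omega>) \<partial>\<Omega>) * (\<integral>\<omega>. (P \<omega>)\<^sup>2 \<partial>\<Omega>)"
    unfolding integral_mult_left_zero by (simp only: add.commute)
qed

lemma picking_time_moments:
  fixes c d :: real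
  defines "W \<equiv> walking_time k c d M aisle loc"
  shows "integrable \<Omega> (\<lambda>\<omega>. total_of (M \<omega>) \<omega> + W \<omega>)"
    and "integrable \<Omega> (\<lambda>\<omega>. (total_of (M \<omega>) \<omega> + W \<omega>)\<^sup>2)"
    and "(\<integral>\<omega>. total_of (M \<omega>) \<omega> + W \<omega> \<partial>\<Omega>) = (\<integral>\<omega>. real (M \<omega>) \<partial>\<Omega>) * (\<integral>\<omega>. P \<omega> \<partial>\<Omega>) + (\<integral>\<omega>. W \<omega> \<partial>\<Omega>)"
    and "(\<integral>\<omega>. (total_of (M \<omega>) \<omega> + W \<omega>)\<^sup>2 \<partial>\<Omega>) =
      (\<integral>\<omega>. real (M \<omega>) * (real (M \<omega>) - 1) \<partial>\<Omega>) * (\<integral>\<omega>. P \<omega> \<partial>\<Omega>)\<^sup>2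
      + (\<integral>\<omega>. real (M \<omega>) \<partial>\<Omega>) * (\<integral>\<omega>. (P \<omega>)\<^sup>2 \<partial>\<Omega>)
      + 2 * (\<integral>\<omega>. P \<omega> \<partial>\<Omega>) * (\<integral>\<omega>. real (M \<omega>) * W \<omega> \<partial>\<Omega>) + (\<integral>\<omega>. (W \<omega>)\<^sup>2 \<partial>\<Omega>)"
proof -
  let ?g = "walking_time k c d fst (\<lambda>j x. fst (snd x j)) (\<lambda>j x. snd (snd x j))"
  have W: "W = (\<lambda>\<omega>. ?g (M \<omega>, \<lambda>j. (aisle j \<omega>, loc j \<omega>)))"
    unfolding W_def by (rule ext) (rule walking_time_items_space)
  have g: "?g \<in> borel_measurable items_space"
    by (rule measurable_walking_time[OF measurable_items_space])
  note iW = walking_time_moments(1)[of c d, folded W_def]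
  note iMW = walking_time_size_moments(1)[of c d, folded W_def]
  note iW2 = walking_time_square_moments(1)[of c d, folded W_def]
  have cross: "integrable \<Omega> (\<lambda>\<omega>. total_of (M \<omega>) \<omega> * W \<omega>)"
    "(\<integral>\<omega>. total_of (M \<omega>) \<omega> * W \<omega> \<partial>\<Omega>) = (\<integral>\<omega>. P \<omega> \<partial>\<Omega>) * (\<integral>\<omega>. real (M \<omega>) * W \<omega> \<partial>\<Omega>)"
    using total_times_independent[OF g iW[unfolded W] iMW[unfolded W]] by (simp_all only: W)
  have sq: "(total_of (M \<omega>) \<omega> + W \<omega>)\<^sup>2
      = (total_of (M \<omega>) \<omega>)\<^sup>2 + 2 * (total_of (M \<omega>) \<omega> * W \<omega>) + (W \<omega>)\<^sup>2" for \<omega>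
    by (simp add: power2_sum)
  note [simp] = iW iW2 cross(1) integral_random_total(1) integral_random_total_square(1)
  show "integrable \<Omega> (\<lambda>\<omega>. total_of (M \<omega>) \<omega> + W \<omega>)" by simp
  show "integrable \<Omega> (\<lambda>\<omega>. (total_of (M \<omega>) \<omega> + W \<omega>)\<^sup>2)" 
    unfolding sq by (intro Bochner_Integration.integrable_add integrable_mult_right iW2 cross(1)
        integral_random_total_square(1))
  show "(\<integral>\<omega>. total_of (M \<omega>) \<omega> + W \<omega> \<partial>\<Omega>) = (\<integral>\<omega>. real (M \<omega>) \<partial>\<Omega>) * (\<integral>\<omega>. P \<omega> \<partial>\<Omega>) + (\<integral>\<omega>. W \<omega> \<partial>\<Omega>)"
    by (simp add: integral_random_total(2))
  show "(\<integral>\<omega>. (total_of (M \<omega>) \<omega> + W \<omega>)\<^sup>2 \<partial>\<Omega>) =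
      (\<integral>\<omega>. real (M \<omega>) * (real (M \<omega>) - 1) \<partial>\<Omega>) * (\<integral>\<omega>. P \<omega> \<partial>\<Omega>)\<^sup>2
      + (\<integral>\<omega>. real (M \<omega>) \<partial>\<Omega>) * (\<integral>\<omega>. (P \<omega>)\<^sup>2 \<partial>\<Omega>)
      + 2 * (\<integral>\<omega>. P \<omega> \<partial>\<Omega>) * (\<integral>\<omega>. real (M \<omega>) * W \<omega> \<partial>\<Omega>) + (\<integral>\<omega>. (W \<omega>)\<^sup>2 \<partial>\<Omega>)"
  proof -
    have "(\<integral>\<omega>. (total_of (M \<omega>) \<omega> + W \<omega>)\<^sup>2 \<partial>\<Omega>)
        = (\<integral>\<omega>. (total_of (M \<omega>) \<omega>)\<^sup>2 + 2 * (total_of (M \<omega>) \<omega> * W \<omega>) \<partial>\<Omega>) + (\<integral>\<omega>. (W \<omega>)\<^sup>2 \<partial>\<Omega>)"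
      unfolding sq by (intro Bochner_Integration.integral_add Bochner_Integration.integrable_add
          integrable_mult_right iW2 cross(1) integral_random_total_square(1))
    also have "(\<integral>\<omega>. (total_of (M \<omega>) \<omega>)\<^sup>2 + 2 * (total_of (M \<omega>) \<omega> * W \<omega>) \<partial>\<Omega>)
        = (\<integral>\<omega>. (total_of (M \<omega>) \<omega>)\<^sup>2 \<partial>\<Omega>) + (\<integral>\<omega>. 2 * (total_of (M \<omega>) \<omega> * W \<omega>) \<partial>\<Omega>)"
      by (intro Bochner_Integration.integral_add integrable_mult_right cross(1) integral_random_total_square(1))
    finally show ?thesis
      unfolding integral_mult_right_zero integral_random_total_square(2) cross(2) mult.assoc .
  qed
qed

end

theorem theorem5p9:
  fixes \<Omega> :: "'w measure"
    and k :: nat and l w\<^sub>a v :: real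
    and M :: "'w \<Rightarrow> nat"
    and aisle :: "nat \<Rightarrow> 'w \<Rightarrow> nat" and loc :: "nat \<Rightarrow> 'w \<Rightarrow> real"
    and P :: "'w \<Rightarrow> real" and pick :: "nat \<Rightarrow> 'w \<Rightarrow> real"
  assumes "prob_space \<Omega>"
    and "1 \<le> k" and "0 < l" and "0 < w\<^sub>a" and "0 < v"
    and "M \<in> \<Omega> \<rightarrow>\<^sub>M count_space UNIV"
    and "integrable \<Omega> (\<lambda>\<omega>. (real (M \<omega>))\<^sup>2)"
    and "\<And>j. aisle j \<in> \<Omega> \<rightarrow>\<^sub>M count_space UNIV"
    and "\<And>j. loc j \<in> borel_measurable \<Omega>"
    and "uniform_items \<Omega> k M aisle loc"
    and "P \<in> borel_measurable \<Omega>"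
    and "AE \<omega> in \<Omega>. 0 \<le> P \<omega>"
    and "integrable \<Omega> (\<lambda>\<omega>. (P \<omega>)\<^sup>2)"
    and "prob_space.indep_vars \<Omega> (\<lambda>_. borel) pick UNIV"
    and "\<And>j. distr \<Omega> borel (pick j) = distr \<Omega> borel P"
    and "indep_rvs \<Omega>
          (PiM UNIV (\<lambda>_. borel)) (\<lambda>\<omega> j. pick j \<omega>)
          (count_space UNIV \<Otimes>\<^sub>M PiM UNIV (\<lambda>_. count_space UNIV \<Otimes>\<^sub>M borel))
            (\<lambda>\<omega>. (M \<omega>, \<lambda>j. (aisle j \<omega>, loc j \<omega>)))"
  defines "E \<equiv> (\<lambda>X :: 'w \<Rightarrow> real. \<integral>\<omega>. X \<omega> \<partial>\<Omega>)"
    and "m \<equiv> (\<lambda>\<omega>. real (M \<omega>))"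
    and "J \<equiv> (\<lambda>\<omega>. real (visited_aisles k M aisle \<omega>))"
    and "I \<equiv> (\<lambda>\<omega>. of_bool (odd (visited_aisles k M aisle \<omega>)) :: real)"
    and "K \<equiv> (\<lambda>\<omega>. real (last_aisle k M aisle \<omega>))"
    and "A \<equiv> (\<lambda>\<omega>. farthest_location M aisle loc (last_aisle k M aisle \<omega>) \<omega>)"
  defines "T \<equiv> (\<lambda>\<omega>. (\<Sum>j<M \<omega>. pick j \<omega>) + l / v * (J \<omega> + I \<omega> * (2 * A \<omega> - 1))
                  + 2 / v * w\<^sub>a * (K \<omega> - 1))"
    and "G \<equiv> pgf \<Omega> M"
    and "G' \<equiv> pgf_deriv \<Omega> M"
  defines "p \<equiv> (\<lambda>r :: nat. G (real r / real k))"
    and "F \<equiv> (\<lambda>r :: nat. integral {0..1} (\<lambda>z. G ((z + real r) / real k)) - G ((real r + 1) / real k))"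
  shows
    "integrable \<Omega> T
    \<and> integrable \<Omega> (\<lambda>\<omega>. (T \<omega>)\<^sup>2)
    \<and> E T = E m * E P + l / v * E J + 2 * l / v * E (\<lambda>\<omega>. I \<omega> * A \<omega>) - l / v * E I
           + 2 * w\<^sub>a / v * (E K - 1)
    \<and> E (\<lambda>\<omega>. (T \<omega>)\<^sup>2) =
          E (\<lambda>\<omega>. m \<omega> * (m \<omega> - 1)) * (E P)\<^sup>2 + E m * E (\<lambda>\<omega>. (P \<omega>)\<^sup>2)
        + l\<^sup>2 / v\<^sup>2 * E (\<lambda>\<omega>. (J \<omega>)\<^sup>2) + 4 * l\<^sup>2 / v\<^sup>2 * E (\<lambda>\<omega>. I \<omega> * (A \<omega>)\<^sup>2) + l\<^sup>2 / v\<^sup>2 * E I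
        + 4 * w\<^sub>a\<^sup>2 / v\<^sup>2 * (E (\<lambda>\<omega>. (K \<omega>)\<^sup>2) - 2 * E K + 1)
        + 2 * l / v * E P * E (\<lambda>\<omega>. m \<omega> * J \<omega>) + 4 * l / v * E P * E (\<lambda>\<omega>. m \<omega> * I \<omega> * A \<omega>)
        - 2 * l / v * E P * E (\<lambda>\<omega>. m \<omega> * I \<omega>)
        + 4 * w\<^sub>a / v * E P * (E (\<lambda>\<omega>. m \<omega> * K \<omega>) - E m)
        + 4 * l\<^sup>2 / v\<^sup>2 * E (\<lambda>\<omega>. I \<omega> * A \<omega> * J \<omega>) - 2 * l\<^sup>2 / v\<^sup>2 * E (\<lambda>\<omega>. I \<omega> * J \<omega>)
        + 4 * l * w\<^sub>a / v\<^sup>2 * (E (\<lambda>\<omega>. K \<omega> * J \<omega>) - E J)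
        - 4 * l\<^sup>2 / v\<^sup>2 * E (\<lambda>\<omega>. I \<omega> * A \<omega>)
        + 8 * l * w\<^sub>a / v\<^sup>2 * (E (\<lambda>\<omega>. I \<omega> * A \<omega> * K \<omega>) - E (\<lambda>\<omega>. I \<omega> * A \<omega>))
        - 4 * l * w\<^sub>a / v\<^sup>2 * (E (\<lambda>\<omega>. I \<omega> * K \<omega>) - E I)
    \<and> E K = real k - (\<Sum>r<k. p r)
    \<and> E (\<lambda>\<omega>. (K \<omega>)\<^sup>2) = (real k)\<^sup>2 - (\<Sum>r<k. (2 * real r + 1) * p r)
    \<and> E (\<lambda>\<omega>. m \<omega> * K \<omega>) = real k * E m - (\<Sum>r<k. real r / real k * G' (real r / real k))
    \<and> E J = real k - real k * G (1 - 1 / real k)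
    \<and> E (\<lambda>\<omega>. (J \<omega>)\<^sup>2) = (real k)\<^sup>2 + real k * (1 - 2 * real k) * G (1 - 1 / real k)
          + real k * (real k - 1) * G (1 - 2 / real k)
    \<and> E I = (\<Sum>r<k. real (k choose r) * (-1) ^ (r + 1) * 2 ^ (k - r - 1) * p r) + of_bool (odd k)
    \<and> E (\<lambda>\<omega>. m \<omega> * J \<omega>) = real k * E m - (real k - 1) * G' ((real k - 1) / real k)
    \<and> E (\<lambda>\<omega>. K \<omega> * J \<omega>) = (real k)\<^sup>2 - real k * (real k + 1) * p (k - 1) + (\<Sum>j = 1..k. p (j - 1))
    \<and> E (\<lambda>\<omega>. I \<omega> * J \<omega>) = (real k - (real k)\<^sup>2 * p (k - 1)) * of_bool (odd k)
          + real k * (real k - 1) * p (k - 1) * of_bool (even k)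
          + (\<Sum>r<k - 1. real (k choose r) * p r * (-1) ^ (r + 1) * real (k + r) * 2 ^ (k - r - 2))
    \<and> E (\<lambda>\<omega>. I \<omega> * K \<omega>) =
          (\<Sum>s = 1..k. \<Sum>n<s - 1. real (s choose n) * p n * (-1) ^ (n + 1) * real (n + s) * 2 ^ (s - n - 2))
        + (\<Sum>s | 1 \<le> s \<and> s \<le> k \<and> even s. real s * (real s - 1) * p (s - 1))
        + (\<Sum>s | 1 \<le> s \<and> s \<le> k \<and> odd s. real s * p s - (real s)\<^sup>2 * p (s - 1))
    \<and> E (\<lambda>\<omega>. m \<omega> * I \<omega>) =
          (\<Sum>r<k - 1. real (k - 1 choose r) * (-1) ^ r * 2 ^ (k - 2 - r) * G' ((1 + real r) / real k))
        + E m * of_bool (odd k)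
    \<and> E (\<lambda>\<omega>. I \<omega> * A \<omega>) = (\<Sum>j | 1 \<le> j \<and> j \<le> k \<and> odd j. real (k choose j) *
          (\<Sum>r<j. real (j - 1 choose r) * (-1) ^ (j - r) * F r))
    \<and> E (\<lambda>\<omega>. I \<omega> * (A \<omega>)\<^sup>2) = (\<Sum>j | 1 \<le> j \<and> j \<le> k \<and> odd j. real (k choose j) *
          (\<Sum>r<j. real (j - 1 choose r) * (-1) ^ (j - r) *
            (2 * integral {0..1} (\<lambda>z. z * G ((z + real r) / real k)) - G ((real r + 1) / real k))))
    \<and> E (\<lambda>\<omega>. I \<omega> * A \<omega> * J \<omega>) = (\<Sum>j | 1 \<le> j \<and> j \<le> k \<and> odd j. real j * real (k choose j) *
          (\<Sum>r<j. real (j - 1 choose r) * (-1) ^ (j - r) * F r))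
    \<and> E (\<lambda>\<omega>. I \<omega> * A \<omega> * K \<omega>) =
          - (\<Sum>n | 1 \<le> n \<and> n \<le> k \<and> odd n. real n * F (n - 1))
          + (\<Sum>n = 1..k. \<Sum>r<n - 1.
              real (n choose r) * real (n - r) * 2 ^ (n - r - 2) * (-1) ^ (r + 1) * F r)
    \<and> E (\<lambda>\<omega>. m \<omega> * I \<omega> * A \<omega>) = (\<Sum>j | 1 \<le> j \<and> j \<le> k \<and> odd j. real (k choose j) *
          (\<Sum>r<j. real (j - 1 choose r) * (-1) ^ (j - r) *
            (integral {0..1} (\<lambda>z. (z + real r) / real k * G' ((z + real r) / real k))
              - (real r + 1) / real k * G' ((real r + 1) / real k))))"
proof -
  interpret W: warehouse_picking \<Omega> k M aisle loc P pick
    using assms(1-16)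
    by (intro warehouse_picking.intro warehouse.intro warehouse_axioms.intro warehouse_picking_axioms.intro)
  define c d where "c = l / v" and "d = 2 / v * w\<^sub>a"
  have coeffs: "2 * l / v = 2 * c" "l / v = c" "2 * w\<^sub>a / v = d" "l\<^sup>2 / v\<^sup>2 = c\<^sup>2" "4 * l\<^sup>2 / v\<^sup>2 = 4 * c\<^sup>2"
    "4 * w\<^sub>a\<^sup>2 / v\<^sup>2 = d\<^sup>2" "4 * l / v = 4 * c" "4 * w\<^sub>a / v = 2 * d" "2 * l\<^sup>2 / v\<^sup>2 = 2 * c\<^sup>2"
    "4 * l * w\<^sub>a / v\<^sup>2 = 2 * c * d" "8 * l * w\<^sub>a / v\<^sup>2 = 4 * c * d"
    by (simp_all add: c_def d_def power2_eq_square)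
  have T: "T = (\<lambda>\<omega>. (\<Sum>j<M \<omega>. pick j \<omega>) + walking_time k c d M aisle loc \<omega>)"
    unfolding T_def J_def I_def K_def A_def walking_time_def c_def d_def by (simp only: add.assoc)
  note moments = W.walking_time_moments(2) W.walking_time_square_moments(2) W.walking_time_size_moments(2)
  note defs = E_def m_def J_def I_def K_def A_def G_def G'_def p_def F_def
  show ?thesis
    unfolding coeffs
  proof (intro conjI)
    show "integrable \<Omega> T" unfolding T by (rule W.picking_time_moments(1))
    show "integrable \<Omega> (\<lambda>\<omega>. (T \<omega>)\<^sup>2)" unfolding T by (rule W.picking_time_moments(2))
  qed (unfold defs W.gap_pgf[symmetric],
      simp only: T W.picking_time_moments(3) moments, simp only: algebra_simps,
      simp only: T W.picking_time_moments(4) moments, simp only: algebra_simps,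
      rule W.integral_last, rule W.integral_last_square, rule W.integral_size_last,
      rule W.integral_visited, rule W.integral_visited_square, rule W.integral_odd,
      rule W.integral_size_visited, rule W.integral_last_visited, rule W.integral_odd_visited,
      rule W.integral_odd_last, rule W.integral_size_odd, rule W.integral_odd_farthest,
      rule W.integral_odd_farthest_square, rule W.integral_odd_farthest_visited,
      rule W.integral_odd_farthest_times_last, rule W.integral_size_odd_farthest)
qed

end
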